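(* Let $X$ be a geodesic metric space. Then $X$ satisfies condition $(\sharp,m)$ for some $m>0$ if and only if there is $M>0$ such that $X$ has no $M$-fat theta curve.
   Context: For a subset $A$ of a metric space $X$, $N_m(A)=\{x\in X: d(x,A)<m\}$. Condition $(\sharp,m)$ for a geodesic metric space $X$: for any $x,y\in X$ with $d(x,y)\ge 10m$ there exist points $a,b\in X$ with $d(x,\{a,b\})\ge 4m$ and $d(y,\{a,b\})\ge 4m$ such that $x$ and $y$ lie in distinct connected components of $X\setminus N_m(\{a,b\})$. Theta curves: let $\Theta$ be a unit circle in the plane together with a diameter, let $x,y$ be the endpoints of the diameter and $q_1,q_2,q_3$ the three arcs of $\Theta$ joining them (closures of the connected components of $\Theta\setminus\{x,y\}$). A theta curve in $X$ is a continuous map $f:\Theta\to X$. Put $p_i=f(q_i)$ ($i=1,2,3$), $a=f(x)$, $b=f(y)$. For $M>0$ the theta curve is $M$-fat if there are subarcs $\alpha_i,\beta_i\subseteq p_i$, $i=1,2,3$, with $a\in\alpha_i$, $b\in\beta_i$, such that: (1) if $p_i'=p_i\setminus(\alpha_i\cup\beta_i)$ then $p_i'\neq\emptyset$, and for any $i\ne j$ and any $t\in p_i'$, $s\in p_j'$ we have $d(t,s)\ge M$; (2) $p_i'\cap\alpha_j=\emptyset$ and $p_i'\cap\beta_j=\emptyset$ for all $i,j$ ($p_i'$ is an open arc, not containing its endpoints); (3) for any $t\in\alpha_1\cup\alpha_2\cup\alpha_3$ and $s\in\beta_1\cup\beta_2\cup\beta_3$ we have $d(t,s)\ge 2M$.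 *)

theory Defs
  imports "HOL-Analysis.Analysis"
begin

section \<open>Geodesic spaces and the separation condition\<close>

text \<open>A metric space is a subset \<open>X\<close> of a metric type with the induced metric;
  \<open>X = UNIV\<close> is the case of a whole type.\<close>

definition geodesic_space :: "'a::metric_space set \<Rightarrow> bool" where
  "geodesic_space X \<longleftrightarrow>
     (\<forall>x\<in>X. \<forall>y\<in>X. \<exists>g. g 0 = x \<and> g (dist x y) = y \<and> g ` {0..dist x y} \<subseteq> X \<and>
        (\<forall>s\<in>{0..dist x y}. \<forall>t\<in>{0..dist x y}. dist (g s) (g t) = \<bar>s - t\<bar>))"

text \<open>\<^const>\<open>infdist\<close> returns 0 on the empty set, so \<open>nbhd\<close> should only be used for
  nonempty \<open>A\<close>; below \<open>A\<close> is always of the form \<open>{a, b}\<close>.\<close>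

definition nbhd :: "'a::metric_space set \<Rightarrow> real \<Rightarrow> 'a set \<Rightarrow> 'a set" where
  "nbhd X m A = {x \<in> X. infdist x A < m}"

definition sharp_condition :: "'a::metric_space set \<Rightarrow> real \<Rightarrow> bool" where
  "sharp_condition X m \<longleftrightarrow>
     (\<forall>x\<in>X. \<forall>y\<in>X. dist x y \<ge> 10 * m \<longrightarrow>
        (\<exists>a\<in>X. \<exists>b\<in>X.
           infdist x {a, b} \<ge> 4 * m \<and> infdist y {a, b} \<ge> 4 * m \<and>
           (\<exists>C \<in> components (X - nbhd X m {a, b}). \<exists>D \<in> components (X - nbhd X m {a, b}).
              x \<in> C \<and> y \<in> D \<and> C \<noteq> D)))"

section \<open>Fat theta curves\<close>

text \<open>The plane is \<^typ>\<open>complex\<close>, and the chosen diameter is the real one, with endpoints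
  \<open>x = -1\<close> and \<open>y = 1\<close>.\<close>

definition Theta :: "complex set" where
  "Theta = sphere 0 1 \<union> closed_segment (-1) 1"

definition theta_arcs :: "complex set set" where
  "theta_arcs = closure ` components (Theta - {-1, 1})"

text \<open>There are exactly three such arcs: the two closed half circles and the diameter.\<close>

lemma Theta_diameter: "closed_segment (-1) (1::complex) = {z. Im z = 0 \<and> \<bar>Re z\<bar> \<le> 1}"
proof -
  have "closed_segment (-1) (1::complex) = of_real ` closed_segment (-1) (1::real)"
    using closed_segment_of_real[of "-1" 1, where 'a = complex] by simp
  also have "\<dots> = {z. Im z = 0 \<and> \<bar>Re z\<bar> \<le> 1}"
  proof -
    have "z \<in> of_real ` {-1..1}" if "Im z = 0" "\<bar>Re z\<bar> \<le> 1" for z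
      using that by (intro image_eqI[of _ _ "Re z"]) (auto simp: complex_eq_iff)
    then show ?thesis by (auto simp: closed_segment_eq_real_ivl)
  qed
  finally show ?thesis .
qed

lemma theta_arcs_eq:
  "theta_arcs = {{z. norm z = 1 \<and> Im z \<ge> 0}, {z. norm z = 1 \<and> Im z \<le> 0}, closed_segment (-1) 1}"
proof -
  define h where "h = (\<lambda>s t. Complex t (s * sqrt (1 - t\<^sup>2)))"
  define S where "S = {-1, 0, 1::real}"
  define P where "P = (\<lambda>s. h s ` {-1<..<1})"
  have cont: "continuous_on T (h s)" for s T
    unfolding h_def Complex_eq by (intro continuous_intros)
  have sq: "t\<^sup>2 < 1" if "t \<in> {-1<..<1}" for t :: real
    using that by (simp add: abs_square_less_1 abs_less_iff)
  have P_iff: "z \<in> P s \<longleftrightarrow> z \<in> Theta - {-1, 1} \<and> sgn (Im z) = s" if "s \<in> S" for s z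
  proof
    assume "z \<in> P s"
    then obtain t where t: "t \<in> {-1<..<1}" "z = h s t" by (auto simp: P_def)
    then show "z \<in> Theta - {-1, 1} \<and> sgn (Im z) = s"
      using sq[OF t(1)] that
      by (auto simp: h_def S_def Theta_def Theta_diameter cmod_def sgn_if complex_eq_iff)
  next
    assume z: "z \<in> Theta - {-1, 1} \<and> sgn (Im z) = s"
    have "\<bar>Re z\<bar> < 1 \<and> Im z = s * sqrt (1 - (Re z)\<^sup>2)"
    proof (cases "Im z = 0")
      case True
      then show ?thesis using z
        by (auto simp: Theta_def Theta_diameter cmod_def complex_eq_iff abs_if abs_square_less_1 power2_eq_1_iff split: if_splits)
    next
      case False
      then have "(Re z)\<^sup>2 + (Im z)\<^sup>2 = 1"
        using z by (auto simp: Theta_def Theta_diameter cmod_def)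
      moreover have "(Im z)\<^sup>2 > 0" using False by simp
      moreover have "Im z = s * \<bar>Im z\<bar>" using z by (auto simp: sgn_if split: if_splits)
      ultimately show ?thesis
        using abs_square_less_1[of "Re z"] real_sqrt_abs[of "Im z"]
        by (metis add_diff_cancel_left' less_add_same_cancel1)
    qed
    then show "z \<in> P s"
      by (auto simp: P_def h_def complex_eq_iff abs_less_iff intro!: image_eqI[of _ _ "Re z"])
  qed
  have O_ex: "\<exists>U. open U \<and> (Theta - {-1, 1}) \<inter> U = P s" if sS: "s \<in> S" for s
  proof -
    consider "s = 1" | "s = -1" | "s = 0" using sS by (auto simp: S_def)
    then show ?thesis
    proof cases
      case 1
      show ?thesis
        by (rule exI[of _ "{z. Im z > 0}"])
           (use 1 in \<open>auto simp: P_iff S_def sgn_if open_halfspace_Im_gt split: if_splits\<close>)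
    next
      case 2
      show ?thesis
        by (rule exI[of _ "{z. Im z < 0}"])
           (use 2 in \<open>auto simp: P_iff S_def sgn_if open_halfspace_Im_lt split: if_splits\<close>)
    next
      case 3
      have "(Theta - {-1, 1}) \<inter> ball 0 1 = P s"
        using 3 by (auto simp: P_iff S_def Theta_def Theta_diameter cmod_def sgn_if
            complex_eq_iff abs_if abs_square_less_1 power2_eq_1_iff split: if_splits)
      then show ?thesis by blast
    qed
  qed
  then obtain U where U: "\<And>s. s \<in> S \<Longrightarrow> open (U s) \<and> (Theta - {-1, 1}) \<inter> U s = P s"
    by metis
  have un: "Theta - {-1, 1} = \<Union> (P ` S)"
  proof (rule set_eqI)
    fix z
    have "sgn (Im z) \<in> S" by (simp add: S_def sgn_if)
    then show "z \<in> Theta - {-1, 1} \<longleftrightarrow> z \<in> \<Union> (P ` S)" using P_iff by blast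
  qed
  have conn: "connected (P s)" for s
    unfolding P_def by (intro connected_continuous_image cont) simp
  have comp: "P s \<in> components (Theta - {-1, 1})" if s: "s \<in> S" for s
    unfolding in_components_maximal
  proof (intro conjI allI impI)
    show "P s \<noteq> {}" by (simp add: P_def)
    show "P s \<subseteq> Theta - {-1, 1}" using un s by blast
    show "connected (P s)" by (rule conn)
    fix C assume C: "C \<noteq> {} \<and> P s \<subseteq> C \<and> C \<subseteq> Theta - {-1, 1} \<and> connected C"
    let ?V = "\<Union> (U ` (S - {s}))"
    have "open (U s)" "open ?V" using U s by auto
    moreover have cover: "C \<subseteq> U s \<union> ?V"
    proof
      fix z assume "z \<in> C"
      then have "z \<in> \<Union> (P ` S)" using C un by auto
      then obtain r where r: "r \<in> S" "z \<in> P r" by blast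
      then have "z \<in> U r" using U[OF r(1)] by auto
      then show "z \<in> U s \<union> ?V" using r(1) by (cases "r = s") auto
    qed
    moreover have "U s \<inter> ?V \<inter> C = {}"
    proof -
      have False if "z \<in> U s" "r \<in> S" "r \<noteq> s" "z \<in> U r" "z \<in> C" for z r
      proof -
        have "z \<in> Theta - {-1, 1}" using that C by auto
        then have "z \<in> P s" "z \<in> P r" using that U[OF s] U[of r] by auto
        then have "sgn (Im z) = s" "sgn (Im z) = r" using P_iff s that(2) by auto
        then show False using that(3) by simp
      qed
      then show ?thesis by auto
    qed
    moreover have "U s \<inter> C \<noteq> {}"
      using U[OF s] C \<open>P s \<noteq> {}\<close> by auto
    ultimately have "?V \<inter> C = {}"
      using connectedD[of C "U s" ?V] C by auto
    then have "C \<subseteq> U s" using cover unfolding disjoint_iff subset_iff Un_iff by metis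
    then show "C = P s" using C U[OF s] by auto
  qed
  have "components (Theta - {-1, 1}) = P ` S"
  proof
    show "P ` S \<subseteq> components (Theta - {-1, 1})" using comp by blast
    show "components (Theta - {-1, 1}) \<subseteq> P ` S"
    proof
      fix C assume C: "C \<in> components (Theta - {-1, 1})"
      then obtain z where z: "z \<in> C" using in_components_nonempty by blast
      then have "z \<in> \<Union> (P ` S)" using un in_components_subset[OF C] by auto
      then obtain s where s: "s \<in> S" "z \<in> P s" by blast
      then have "C = P s"
        using components_nonoverlap[OF C comp[OF s(1)]] z by auto
      then show "C \<in> P ` S" using s(1) by simp
    qed
  qed
  have clo: "closure (P s) = h s ` {-1..1}" for s
  proof
    have "compact (h s ` {-1..1})" by (intro compact_continuous_image cont) simp
    then show "closure (P s) \<subseteq> h s ` {-1..1}"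
      unfolding P_def by (intro closure_minimal compact_imp_closed image_mono) auto
    show "h s ` {-1..1} \<subseteq> closure (P s)"
      using image_closure_subset[of "{-1<..<1}" "h s" "closure (P s)"] closure_subset[of "P s"] cont
      by (simp add: P_def)
  qed
  have up: "h 1 ` {-1..1} = {z. norm z = 1 \<and> Im z \<ge> 0}" (is "_ = ?R")
  proof
    show "h 1 ` {-1..1} \<subseteq> ?R"
      by (auto simp: h_def cmod_def abs_square_le_1 abs_le_iff)
    show "?R \<subseteq> h 1 ` {-1..1}"
    proof
      fix z assume "z \<in> ?R"
      then have "\<bar>Re z\<bar> \<le> 1" "(Re z)\<^sup>2 + (Im z)\<^sup>2 = 1" "Im z \<ge> 0"
        using abs_Re_le_cmod[of z] by (auto simp: cmod_def)
      moreover from this have "1 - (Re z)\<^sup>2 = (Im z)\<^sup>2" by simp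
      ultimately show "z \<in> h 1 ` {-1..1}"
        by (intro image_eqI[of _ _ "Re z"]) (auto simp: h_def complex_eq_iff)
    qed
  qed
  have "h (-1) ` {-1..1} = cnj ` h 1 ` {-1..1}"
    unfolding image_image by (intro image_cong) (simp_all add: h_def complex_eq_iff)
  also have "\<dots> = {z. norm z = 1 \<and> Im z \<le> 0}"
  proof -
    have "z \<in> cnj ` {z. norm z = 1 \<and> Im z \<ge> 0}" if "norm z = 1" "Im z \<le> 0" for z
      using that by (intro image_eqI[of _ cnj "cnj z"]) auto
    then show ?thesis unfolding up by auto
  qed
  finally have low: "h (-1) ` {-1..1} = {z. norm z = 1 \<and> Im z \<le> 0}" .
  have "h 0 ` {-1..1} = closed_segment (-1) 1"
  proof -
    have "z \<in> h 0 ` {-1..1}" if "Im z = 0" "\<bar>Re z\<bar> \<le> 1" for z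
      using that by (intro image_eqI[of _ _ "Re z"]) (auto simp: h_def complex_eq_iff)
    then show ?thesis unfolding Theta_diameter by (auto simp: h_def)
  qed
  with up low show ?thesis
    unfolding theta_arcs_def \<open>components (Theta - {-1, 1}) = P ` S\<close>
    by (auto simp: image_image clo S_def)
qed

definition theta_curve :: "'a::metric_space set \<Rightarrow> (complex \<Rightarrow> 'a) \<Rightarrow> bool" where
  "theta_curve X f \<longleftrightarrow> continuous_on Theta f \<and> f ` Theta \<subseteq> X"

definition subarc :: "'a::topological_space set \<Rightarrow> 'a set \<Rightarrow> bool" where
  "subarc A Q \<longleftrightarrow> (\<exists>g. arc g \<and> path_image g = A \<and> A \<subseteq> Q)"

text \<open>
  The three arcs \<open>q\<close> serve as their own indices. Since \<open>f\<close> need not be injective, the arcs in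
  \<open>X\<close> are images of arcs of the domain: \<open>A q\<close> and \<open>B q\<close> are subarcs of \<open>q\<close> containing the
  endpoints \<open>-1\<close> and \<open>1\<close>, and \<open>\<alpha> q\<close>, \<open>\<beta> q\<close> are their images. The set \<open>p' q\<close> is a
  difference of subsets of \<open>X\<close>; it is an open arc in the sense that it is the image of the open
  subarc \<open>q - (A q \<union> B q)\<close>.
\<close>

definition fat_theta_curve :: "real \<Rightarrow> 'a::metric_space set \<Rightarrow> (complex \<Rightarrow> 'a) \<Rightarrow> bool" where
  "fat_theta_curve M X f \<longleftrightarrow> theta_curve X f \<and>
     (\<exists>A B :: complex set \<Rightarrow> complex set.
        let \<alpha> = (\<lambda>q. f ` A q);
            \<beta> = (\<lambda>q. f ` B q);
            p' = (\<lambda>q. f ` q - (\<alpha> q \<union> \<beta> q))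
        in
          (\<forall>q\<in>theta_arcs. subarc (A q) q \<and> subarc (B q) q \<and> -1 \<in> A q \<and> 1 \<in> B q) \<and>
          (\<forall>q\<in>theta_arcs. p' q = f ` (q - (A q \<union> B q))) \<and>
          (\<forall>q\<in>theta_arcs. p' q \<noteq> {}) \<and>
          (\<forall>q\<in>theta_arcs. \<forall>r\<in>theta_arcs. q \<noteq> r \<longrightarrow> (\<forall>t\<in>p' q. \<forall>s\<in>p' r. dist t s \<ge> M)) \<and>
          (\<forall>q\<in>theta_arcs. \<forall>r\<in>theta_arcs. p' q \<inter> \<alpha> r = {} \<and> p' q \<inter> \<beta> r = {}) \<and>
          (\<forall>t\<in>\<Union> (\<alpha> ` theta_arcs). \<forall>s\<in>\<Union> (\<beta> ` theta_arcs). dist t s \<ge> 2 * M))"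

end

theory Submission
  imports Defs
begin

text \<open>
  A pair of balls separates two points if no path between them avoids both balls. Because connected
  sets in a geodesic space become path connected after thickening, the separation condition can be
  read in terms of paths, up to a change of the radius.

  Suppose that the condition fails for \<open>x\<close> and \<open>y\<close> at radius \<open>10M\<close>. Let \<open>a\<close> be the midpoint of a geodesic from \<open>x\<close>
  to \<open>y\<close>, and let \<open>A\<close> and \<open>B\<close> contain a ball around \<open>x\<close> or \<open>y\<close> and the two halves of the geodesic up to a short
  gap around \<open>a\<close>. Some path from \<open>x\<close> to \<open>y\<close> avoids a ball around \<open>a\<close>. Let \<open>b\<close> be its last point at distance \<open>2M\<close>
  from \<open>A\<close>, and add the rest of the path to \<open>B\<close>. Then \<open>A\<close> and \<open>B\<close> are linked near \<open>a\<close> and near \<open>b\<close>, and a path that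
  avoids balls around both points links them a third time. The three links are the arms of an
  \<open>M\<close>-fat theta curve (\<open>not_sharp_condition_imp_fat_theta_curve\<close>).

  Conversely, let the condition hold with radius \<open>m\<close> and let a \<open>1000m\<close>-fat theta curve be given. Cutting the
  arms produces path connected sets \<open>L\<close> and \<open>R\<close> at distance \<open>\<eta> = 300m\<close>, joined by geodesics \<open>J 0\<close>, \<open>J 1\<close>, \<open>J 2\<close> of length
  \<open>\<eta>\<close> that are far apart. Consider a point \<open>x0\<close> of \<open>J 0\<close> and a pair of balls, with centres \<open>u\<close> on the left of \<open>x0\<close> and
  \<open>v\<close> on the right, that separates \<open>x0\<close> from the midpoints of \<open>J 1\<close> and \<open>J 2\<close>. The decisive step is to apply the separation
  condition to \<open>u\<close> and \<open>v\<close> themselves. One of the new balls lies in the component of \<open>x0\<close>, because this component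
  connects \<open>u\<close> and \<open>v\<close>. The other one alone must interrupt the ways from \<open>u\<close> to \<open>v\<close> along \<open>J 1\<close> and along \<open>J 2\<close>, which
  is possible only at \<open>L\<close> or only at \<open>R\<close>. There it can replace \<open>u\<close> or \<open>v\<close>, and the new pair is further away from \<open>x0\<close>, by
  a definite amount as measured along a fixed path. As this cannot go on forever, no such pair exists (\<open>no_cut_pair\<close>).

  A pair of this kind, however, does exist. For two points near \<open>J 0\<close> that are not too close, a
  separating pair encloses one of them (\<open>pinched_or_pinched\<close>). So all points near a long stretch of \<open>J 0\<close> are enclosed by
  pairs of balls, but these pairs may be too narrow: the argument above needs \<open>u\<close> and \<open>v\<close> at distance \<open>10m\<close>, while
  the condition only places them at distance \<open>4m\<close> from the enclosed point. A narrow pair is widened by combining it with the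
  pairs that enclose its own two centres (\<open>widen\<close>), until it is wide enough.
\<close>

section \<open>First contact along a path\<close>

lemma first_crossing:
  fixes \<phi> :: "real \<Rightarrow> real"
  assumes "continuous_on {a..b} \<phi>" "c \<le> \<phi> a" "\<phi> b \<le> c" "a \<le> b"
  shows "\<exists>t\<in>{a..b}. \<phi> t = c \<and> (\<forall>s\<in>{a..t}. c \<le> \<phi> s)"
proof -
  define Z where "Z = {t\<in>{a..b}. \<phi> t = c}"
  have "closed Z"
    unfolding Z_def using continuous_closed_preimage_constant[OF assms(1)] by simp
  moreover have "Z \<subseteq> {a..b}" by (auto simp: Z_def)
  ultimately have "compact Z" by (metis bounded_subset bounded_closed_interval compact_eq_bounded_closed)
  moreover have "Z \<noteq> {}"
    using IVT2'[of \<phi> b c a] assms by (auto simp: Z_def)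
  ultimately obtain t where t: "t \<in> Z" "\<And>s. s \<in> Z \<Longrightarrow> t \<le> s"
    using compact_attains_inf by metis
  have "c \<le> \<phi> s" if s: "s \<in> {a..t}" for s
  proof (rule ccontr)
    assume "\<not> c \<le> \<phi> s"
    moreover have "continuous_on {a..s} \<phi>"
      using assms(1) s t(1) by (auto simp: Z_def intro: continuous_on_subset)
    ultimately obtain x where "x \<in> {a..s}" "\<phi> x = c"
      using IVT2'[of \<phi> s c a] assms(2) s by auto
    moreover from this have "t \<le> x" using t s by (auto simp: Z_def)
    moreover from calculation have "x = s" using s by auto
    ultimately show False using \<open>\<not> c \<le> \<phi> s\<close> by auto
  qed
  then show ?thesis using t(1) by (auto simp: Z_def)
qed

lemma last_crossing:
  fixes \<phi> :: "real \<Rightarrow> real"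
  assumes "continuous_on {a..b} \<phi>" "\<phi> a \<le> c" "c \<le> \<phi> b" "a \<le> b"
  shows "\<exists>t\<in>{a..b}. \<phi> t = c \<and> (\<forall>s\<in>{t..b}. c \<le> \<phi> s)"
proof -
  have "continuous_on {a..b} (\<lambda>x. \<phi> (a + b - x))"
    by (rule continuous_on_compose2[OF assms(1)]) (auto intro!: continuous_intros)
  from first_crossing[OF this, of c] assms
  obtain t where t: "t \<in> {a..b}" "\<phi> (a + b - t) = c" "\<forall>s\<in>{a..t}. c \<le> \<phi> (a + b - s)" by auto
  have "c \<le> \<phi> s" if "s \<in> {a+b-t..b}" for s
    using t(3)[rule_format, of "a + b - s"] that by auto
  with t show ?thesis by (intro bexI[of _ "a+b-t"]) auto
qed

lemma path_component_along:
  fixes g :: "real \<Rightarrow> 'a::topological_space"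
  assumes "continuous_on {a..b} g" "g ` {a..b} \<subseteq> S" "s \<in> {a..b}" "t \<in> {a..b}"
  shows "path_component S (g s) (g t)"
proof -
  define h where "h = (\<lambda>x. g (s + (t - s) * x))"
  have r: "s + (t - s) * x \<in> {a..b}" if "x \<in> {0..1}" for x
    using convexD_alt[of "{a..b}" s t x] assms(3,4) that by (simp add: algebra_simps)
  have "path h" unfolding path_def h_def
    by (rule continuous_on_compose2[OF assms(1)]) (use r in \<open>auto intro!: continuous_intros\<close>)
  moreover have "path_image h \<subseteq> S" using assms(2) r by (auto simp: path_image_def h_def)
  ultimately show ?thesis unfolding path_component_def
    by (intro exI[of _ h]) (auto simp: h_def pathstart_def pathfinish_def)
qed

lemma first_contact:
  fixes F :: "'a::topological_space \<Rightarrow> real"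
  assumes pc: "path_component Y p q" and F: "continuous_on Y F" and p: "c \<le> F p"
  shows "path_component {z\<in>Y. c \<le> F z} p q \<or>
         (\<exists>z\<in>Y. F z = c \<and> path_component {z\<in>Y. c \<le> F z} p z)"
proof -
  from pc obtain g where g: "path g" "path_image g \<subseteq> Y" "pathstart g = p" "pathfinish g = q"
    by (auto simp: path_component_def)
  show ?thesis
  proof (cases "\<exists>t\<in>{0..1}. F (g t) \<le> c")
    case False
    then have "path_image g \<subseteq> {z\<in>Y. c \<le> F z}" using g(2) by (fastforce simp: path_image_def)
    then show ?thesis using g by (auto simp: path_component_def)
  next
    case True
    then obtain b where b: "b \<in> {0..1}" "F (g b) \<le> c" by auto
    have "continuous_on {0..1} (F \<circ> g)"
      using g F by (intro continuous_on_compose) (auto simp: path_def path_image_def intro: continuous_on_subset)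
    then have "continuous_on {0..b} (F \<circ> g)" by (rule continuous_on_subset) (use b in auto)
    from first_crossing[OF this, of c] b p g(3)
    obtain t where t: "t \<in> {0..b}" "F (g t) = c" "\<forall>s\<in>{0..t}. c \<le> F (g s)"
      by (auto simp: pathstart_def)
    have "continuous_on {0..t} g" using g(1) t(1) b by (auto simp: path_def intro: continuous_on_subset)
    moreover have "g ` {0..t} \<subseteq> {z\<in>Y. c \<le> F z}"
      using t b g(2) by (auto simp: path_image_def)
    ultimately have "path_component {z\<in>Y. c \<le> F z} p (g t)"
      using path_component_along[of 0 t g _ 0 t] g(3) t(1) by (auto simp: pathstart_def)
    moreover have "g t \<in> Y" using g(2) t b by (auto simp: path_image_def)
    ultimately show ?thesis using t by auto
  qed
qed

section \<open>Geodesics\<close>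

lemma geodesic_path:
  assumes "geodesic_space X" "x \<in> X" "y \<in> X"
  obtains g where "path g" "pathstart g = x" "pathfinish g = y" "path_image g \<subseteq> X"
    "\<And>z. z \<in> path_image g \<Longrightarrow> dist x z + dist z y = dist x y"
proof -
  obtain h where h: "h 0 = x" "h (dist x y) = y" "h ` {0..dist x y} \<subseteq> X"
    "\<forall>s\<in>{0..dist x y}. \<forall>t\<in>{0..dist x y}. dist (h s) (h t) = \<bar>s - t\<bar>"
    using assms unfolding geodesic_space_def by metis
  define g where "g = (\<lambda>t. h (t * dist x y))"
  have r: "t * dist x y \<in> {0..dist x y}" if "t \<in> {0..1}" for t
    using that mult_right_mono[of t 1 "dist x y"] by auto
  have "continuous_on {0..dist x y} h"
    unfolding continuous_on_iff using h(4) by (metis abs_minus_commute dist_real_def)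
  then have "path g" unfolding path_def g_def
    by (rule continuous_on_compose2) (use r in \<open>auto intro!: continuous_intros\<close>)
  moreover have "pathstart g = x" "pathfinish g = y" using h by (auto simp: g_def pathstart_def pathfinish_def)
  moreover have "path_image g \<subseteq> X" using h(3) r by (auto simp: g_def path_image_def)
  moreover have "dist x z + dist z y = dist x y" if z: "z \<in> path_image g" for z
  proof -
    obtain t where t: "t \<in> {0..1}" "z = h (t * dist x y)" using z by (auto simp: path_image_def g_def)
    have "dist x z = t * dist x y"
      using h(4)[rule_format, of 0 "t * dist x y"] r[OF t(1)] h(1) t by auto
    moreover have "dist z y = \<bar>t * dist x y - dist x y\<bar>"
      using h(4)[rule_format, of "t * dist x y" "dist x y"] r[OF t(1)] h(2) t by auto
    ultimately show ?thesis using r[OF t(1)] by auto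
  qed
  ultimately show ?thesis using that by blast
qed

lemma geodesic_path_component:
  assumes "geodesic_space X" "x \<in> X" "y \<in> X"
    and "\<And>z. z \<in> X \<Longrightarrow> dist x z + dist z y = dist x y \<Longrightarrow> z \<in> S"
  shows "path_component S x y"
  using geodesic_path[OF assms(1-3)] assms(4) unfolding path_component_def by (metis subset_eq)

text \<open>
  Inside the thickening, the points of \<open>K\<close> that can be reached from a given one form a relatively open
  and closed subset of \<open>K\<close>. This is how the components in the separation condition are turned into paths.
\<close>

lemma connected_thickening_path_component:
  assumes geo: "geodesic_space X" and K: "connected K" "K \<subseteq> X" and e: "e > 0"
    and xy: "x \<in> K" "y \<in> K"
  shows "path_component {z\<in>X. \<exists>k\<in>K. dist k z < e} x y"
    (is "path_component ?N x y")
proof (rule connected_equivalence_relation[OF K(1) xy])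
  show "path_component ?N b a" if "path_component ?N a b" for a b
    using that by (rule path_component_sym)
  show "path_component ?N a c" if "path_component ?N a b" "path_component ?N b c" for a b c
    using that by (rule path_component_trans)
  fix a assume a: "a \<in> K"
  have "path_component ?N a z" if z: "z \<in> K \<inter> ball a e" for z
  proof (rule geodesic_path_component[OF geo])
    show "a \<in> X" "z \<in> X" using a z K by auto
    fix w assume w: "w \<in> X" "dist a w + dist w z = dist a z"
    then have "dist a w \<le> dist a z" using zero_le_dist[of w z] by linarith
    then have "dist a w < e" using z by (metis IntD2 mem_ball order_le_less_trans)
    then show "w \<in> ?N" using w a by auto
  qed
  then show "\<exists>T. openin (top_of_set K) T \<and> a \<in> T \<and> (\<forall>z\<in>T. path_component ?N a z)"
    using a e by (intro exI[of _ "K \<inter> ball a e"]) (auto intro: openin_open_Int)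
qed

section \<open>Theta curves as triples of paths\<close>

text \<open>The parameter \<open>\<epsilon>\<close> selects the upper half circle (\<open>1\<close>), the lower one (\<open>-1\<close>) or the diameter (\<open>0\<close>).\<close>

definition theta_arc_point :: "real \<Rightarrow> real \<Rightarrow> complex" where
  "theta_arc_point \<epsilon> t = Complex t (\<epsilon> * sqrt (1 - t\<^sup>2))"

lemma Re_theta_arc_point [simp]: "Re (theta_arc_point \<epsilon> t) = t"
  by (simp add: theta_arc_point_def)

lemma continuous_theta_arc_point: "continuous_on S (theta_arc_point \<epsilon>)"
  unfolding theta_arc_point_def Complex_eq by (intro continuous_intros)

lemma theta_arc_point_ends: "theta_arc_point \<epsilon> (-1) = -1" "theta_arc_point \<epsilon> 1 = 1"
  by (auto simp: theta_arc_point_def complex_eq_iff)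

definition theta_arc :: "real \<Rightarrow> complex set" where
  "theta_arc \<epsilon> = theta_arc_point \<epsilon> ` {-1..1}"

lemma theta_arc_explicit:
  "theta_arc 1 = {z. norm z = 1 \<and> Im z \<ge> 0}"
  "theta_arc (-1) = {z. norm z = 1 \<and> Im z \<le> 0}"
  "theta_arc 0 = closed_segment (-1) 1"
proof -
  have *: "\<bar>Re z\<bar> \<le> 1" "(Re z)\<^sup>2 + (Im z)\<^sup>2 = 1" if "norm z = 1" for z
    using that abs_Re_le_cmod[of z] by (auto simp: cmod_def)
  have sq: "1 - (Re z)\<^sup>2 = (Im z)\<^sup>2" if "norm z = 1" for z using *[OF that] by simp
  have a: "z \<in> theta_arc 1" if "norm z = 1" "Im z \<ge> 0" for z
    unfolding theta_arc_def using *[OF that(1)] sq[OF that(1)] that(2)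
    by (intro image_eqI[of _ _ "Re z"]) (auto simp: theta_arc_point_def complex_eq_iff)
  have b: "z \<in> theta_arc (-1)" if "norm z = 1" "Im z \<le> 0" for z
    unfolding theta_arc_def using *[OF that(1)] sq[OF that(1)] that(2)
    by (intro image_eqI[of _ _ "Re z"]) (auto simp: theta_arc_point_def complex_eq_iff)
  have c: "z \<in> theta_arc 0" if "Im z = 0" "\<bar>Re z\<bar> \<le> 1" for z
    unfolding theta_arc_def using that
    by (intro image_eqI[of _ _ "Re z"]) (auto simp: theta_arc_point_def complex_eq_iff)
  show "theta_arc 1 = {z. norm z = 1 \<and> Im z \<ge> 0}"
    using a by (auto simp: theta_arc_def theta_arc_point_def cmod_def abs_square_le_1 abs_le_iff)
  show "theta_arc (-1) = {z. norm z = 1 \<and> Im z \<le> 0}"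
    using b by (auto simp: theta_arc_def theta_arc_point_def cmod_def abs_square_le_1 abs_le_iff)
  show "theta_arc 0 = closed_segment (-1) 1"
    unfolding Theta_diameter using c by (auto simp: theta_arc_def theta_arc_point_def)
qed

lemma theta_arcs_param: "theta_arcs = theta_arc ` {1, -1, 0}"
  unfolding theta_arcs_eq by (auto simp: theta_arc_explicit)

lemma Theta_param: "Theta = theta_arc 1 \<union> theta_arc (-1) \<union> theta_arc 0"
  unfolding Theta_def theta_arc_explicit by (auto simp: sphere_def dist_norm)

text \<open>
  The sign of the imaginary part recovers the arc, except at the endpoints \<open>-1\<close> and \<open>1\<close>, which lie on all three.
\<close>

lemma theta_arc_sgn:
  assumes "\<epsilon> \<in> {1, -1, 0}" "z \<in> theta_arc \<epsilon>"
  shows "sgn (Im z) = \<epsilon> \<or> Re z = -1 \<or> Re z = 1"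
proof -
  obtain t where t: "t \<in> {-1..1}" "z = theta_arc_point \<epsilon> t"
    using assms(2) by (auto simp: theta_arc_def)
  have "sgn (sqrt (1 - t\<^sup>2)) = 1" if "t \<noteq> -1" "t \<noteq> 1"
    using that t(1) by (simp add: abs_square_less_1 abs_less_iff)
  moreover have "sgn (Im z) = sgn \<epsilon> * sgn (sqrt (1 - t\<^sup>2))" "Re z = t"
    using t(2) by (auto simp: theta_arc_point_def sgn_mult)
  moreover have "sgn \<epsilon> = \<epsilon>" using assms(1) by auto
  ultimately show ?thesis by (cases "t = -1"; cases "t = 1") simp_all
qed

lemma theta_arc_inj: "inj_on theta_arc {1, -1, 0}"
proof (rule inj_onI)
  fix \<epsilon> \<delta> :: real assume e: "\<epsilon> \<in> {1, -1, 0}" "\<delta> \<in> {1, -1, 0}" "theta_arc \<epsilon> = theta_arc \<delta>"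
  have "theta_arc_point \<epsilon> 0 \<in> theta_arc \<epsilon>" by (auto simp: theta_arc_def)
  with theta_arc_sgn[OF e(1)] theta_arc_sgn[OF e(2)] e(3) show "\<epsilon> = \<delta>" by fastforce
qed

lemma subarc_theta_arc:
  assumes "-1 \<le> a" "a < b" "b \<le> 1"
  shows "subarc {z\<in>theta_arc \<epsilon>. a \<le> Re z \<and> Re z \<le> b} (theta_arc \<epsilon>)"
proof -
  define g where "g = (\<lambda>t. theta_arc_point \<epsilon> (a + t * (b - a)))"
  have "path g" unfolding path_def g_def
    by (rule continuous_on_compose2[OF continuous_theta_arc_point[of UNIV]]) (auto intro!: continuous_intros)
  moreover have "inj_on g {0..1}"
  proof (rule inj_onI)
    fix s t assume "g s = g t"
    from arg_cong[OF this, of Re] show "s = t" using assms by (simp add: g_def)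
  qed
  ultimately have "arc g" by (simp add: arc_def)
  moreover have "path_image g = {z\<in>theta_arc \<epsilon>. a \<le> Re z \<and> Re z \<le> b}"
  proof -
    have "(\<lambda>t. a + t * (b - a)) ` {0..1} = {a..b}"
      using image_affinity_atLeastAtMost[of "b - a" a 0 1] assms by (simp add: mult.commute add.commute)
    then have "path_image g = theta_arc_point \<epsilon> ` {a..b}"
      unfolding path_image_def g_def by (metis image_image)
    also have "\<dots> = {z\<in>theta_arc \<epsilon>. a \<le> Re z \<and> Re z \<le> b}"
      using assms by (auto simp: theta_arc_def)
    finally show ?thesis .
  qed
  ultimately show ?thesis unfolding subarc_def by (intro exI[of _ g]) auto
qed

text \<open>Each arc is a graph over the real axis, so the real part serves as the common parameter.\<close>

lemma theta_curve_from_paths: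
  fixes G :: "real \<Rightarrow> real \<Rightarrow> 'a::metric_space"
  assumes G: "\<And>\<epsilon>. \<epsilon> \<in> {1, -1, 0} \<Longrightarrow> path (G \<epsilon>) \<and> path_image (G \<epsilon>) \<subseteq> X \<and> G \<epsilon> 0 = a \<and> G \<epsilon> 1 = b"
  obtains f where "theta_curve X f"
    "\<And>\<epsilon> z. \<epsilon> \<in> {1, -1, 0} \<Longrightarrow> z \<in> theta_arc \<epsilon> \<Longrightarrow> f z = G \<epsilon> ((Re z + 1) / 2)"
proof -
  define f where "f = (\<lambda>z. G (sgn (Im z)) ((Re z + 1) / 2))"
  have f: "f z = G \<epsilon> ((Re z + 1) / 2)" if e: "\<epsilon> \<in> {1, -1, 0}" and z: "z \<in> theta_arc \<epsilon>" for \<epsilon> z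
  proof -
    have "sgn (Im z) \<in> {1, -1, 0}" by (auto simp: sgn_if)
    then have "G \<epsilon> 0 = G (sgn (Im z)) 0" "G \<epsilon> 1 = G (sgn (Im z)) 1"
      using G e by metis+
    then show ?thesis using theta_arc_sgn[OF e z] by (auto simp: f_def)
  qed
  have r: "(Re z + 1) / 2 \<in> {0..1}" if "z \<in> theta_arc \<epsilon>" for z \<epsilon>
    using that by (auto simp: theta_arc_def)
  have cont: "continuous_on (theta_arc \<epsilon>) f" if e: "\<epsilon> \<in> {1, -1, 0}" for \<epsilon>
  proof -
    have "continuous_on (theta_arc \<epsilon>) (\<lambda>z. G \<epsilon> ((Re z + 1) / 2))"
      by (rule continuous_on_compose2[of "{0..1}" "G \<epsilon>"])
         (use G[OF e] r in \<open>auto simp: path_def intro!: continuous_intros\<close>)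
    then show ?thesis using f[OF e] by (simp cong: continuous_on_cong)
  qed
  have cl: "closed (theta_arc \<epsilon>)" for \<epsilon>
    unfolding theta_arc_def
    by (intro compact_imp_closed compact_continuous_image continuous_theta_arc_point) simp
  have "continuous_on Theta f"
    unfolding Theta_param by (intro continuous_on_closed_Un closed_Un cl cont) auto
  moreover have "f z \<in> X" if e: "\<epsilon> \<in> {1, -1, 0}" and z: "z \<in> theta_arc \<epsilon>" for z \<epsilon>
    using f[OF e z] r[OF z] G[OF e] by (auto simp: path_image_def)
  then have "f ` Theta \<subseteq> X" by (auto simp: Theta_param)
  ultimately show ?thesis using that[of f] f by (auto simp: theta_curve_def)
qed

text \<open>
  Fatness does not restrict the shape of the sets around the two vertices. So any two path connected sets
  can serve as these sets: each of the three arms is prolonged inside \<open>A\<close> and \<open>B\<close> to common endpoints. The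
  prolongations occupy \<open>{0..1/4}\<close> and \<open>{1/2..1}\<close> of the parameter interval, the arm itself the rest.
\<close>

lemma fat_theta_curve_from_arms:
  fixes A B X :: "'a::metric_space set" and p :: "real \<Rightarrow> real \<Rightarrow> 'a"
  assumes X: "A \<subseteq> X" "B \<subseteq> X" and conn: "path_connected A" "path_connected B"
    and p: "\<And>\<epsilon>. \<epsilon> \<in> {1, -1, 0} \<Longrightarrow> path (p \<epsilon>) \<and> path_image (p \<epsilon>) \<subseteq> X \<and> p \<epsilon> 0 \<in> A \<and> p \<epsilon> 1 \<in> B"
    and disj: "\<And>\<epsilon> t. \<epsilon> \<in> {1, -1, 0} \<Longrightarrow> t \<in> {0<..<1} \<Longrightarrow> p \<epsilon> t \<notin> A \<union> B"
    and sep: "\<And>\<epsilon> \<delta> s t. \<epsilon> \<in> {1, -1, 0} \<Longrightarrow> \<delta> \<in> {1, -1, 0} \<Longrightarrow> \<epsilon> \<noteq> \<delta> \<Longrightarrow> s \<in> {0<..<1} \<Longrightarrow> t \<in> {0<..<1} \<Longrightarrow>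
                 M \<le> dist (p \<epsilon> s) (p \<delta> t)"
    and AB: "\<And>a b. a \<in> A \<Longrightarrow> b \<in> B \<Longrightarrow> 2 * M \<le> dist a b"
  shows "\<exists>f. fat_theta_curve M X f"
proof -
  let ?E = "{1, -1, 0} :: real set"
  obtain a b where ab: "a \<in> A" "b \<in> B" using p[of 1] by auto
  have "\<exists>u v. path u \<and> path_image u \<subseteq> A \<and> pathstart u = a \<and> pathfinish u = p \<epsilon> 0 \<and>
              path v \<and> path_image v \<subseteq> B \<and> pathstart v = p \<epsilon> 1 \<and> pathfinish v = b" if "\<epsilon> \<in> ?E" for \<epsilon>
    using conn p[OF that] ab unfolding path_connected_def by metis
  then obtain u v where uv: "\<And>\<epsilon>. \<epsilon> \<in> ?E \<Longrightarrow> path (u \<epsilon>) \<and> path_image (u \<epsilon>) \<subseteq> A \<and> pathstart (u \<epsilon>) = a \<and>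
      pathfinish (u \<epsilon>) = p \<epsilon> 0 \<and> path (v \<epsilon>) \<and> path_image (v \<epsilon>) \<subseteq> B \<and> pathstart (v \<epsilon>) = p \<epsilon> 1 \<and> pathfinish (v \<epsilon>) = b"
    by metis
  define G where "G = (\<lambda>\<epsilon>. (u \<epsilon> +++ p \<epsilon>) +++ v \<epsilon>)"
  have G: "path (G \<epsilon>) \<and> path_image (G \<epsilon>) \<subseteq> X \<and> G \<epsilon> 0 = a \<and> G \<epsilon> 1 = b" if e: "\<epsilon> \<in> ?E" for \<epsilon>
  proof -
    have "pathstart (p \<epsilon>) = p \<epsilon> 0" "pathfinish (p \<epsilon>) = p \<epsilon> 1" by (auto simp: pathstart_def pathfinish_def)
    moreover from this have "path_image (G \<epsilon>) \<subseteq> X"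
      using uv[OF e] p[OF e] X by (auto simp: G_def path_image_join)
    moreover have "G \<epsilon> 0 = pathstart (u \<epsilon>)" "G \<epsilon> 1 = pathfinish (v \<epsilon>)"
      by (auto simp: G_def joinpaths_def pathstart_def pathfinish_def)
    ultimately show ?thesis using uv[OF e] p[OF e] by (auto simp: G_def)
  qed
  have GA: "G \<epsilon> t \<in> A" if "\<epsilon> \<in> ?E" "0 \<le> t" "t \<le> 1/4" for \<epsilon> t
    using uv[OF that(1)] that(2,3) by (auto simp: G_def joinpaths_def path_image_def image_subset_iff)
  have GB: "G \<epsilon> t \<in> B" if "\<epsilon> \<in> ?E" "1/2 \<le> t" "t \<le> 1" for \<epsilon> t
  proof (cases "t = 1/2")
    case True
    then have "G \<epsilon> t = p \<epsilon> 1" unfolding True by (simp add: G_def joinpaths_def)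
    then show ?thesis using p[OF that(1)] by simp
  next
    case False
    then have "G \<epsilon> t = v \<epsilon> (2 * t - 1)" "2 * t - 1 \<in> {0..1}"
      using that by (auto simp: G_def joinpaths_def)
    then show ?thesis using uv[OF that(1)] by (auto simp: path_image_def)
  qed
  have Gp: "G \<epsilon> t = p \<epsilon> (4 * t - 1)" if "1/4 < t" "t < 1/2" for \<epsilon> t
    using that by (auto simp: G_def joinpaths_def)
  obtain f where f: "theta_curve X f"
    "\<And>\<epsilon> z. \<epsilon> \<in> ?E \<Longrightarrow> z \<in> theta_arc \<epsilon> \<Longrightarrow> f z = G \<epsilon> ((Re z + 1) / 2)"
    using theta_curve_from_paths[of G X a b] G by blast
  define P where "P = (\<lambda>q::complex set. {z\<in>q. -1 \<le> Re z \<and> Re z \<le> -1/2})"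
  define Q where "Q = (\<lambda>q::complex set. {z\<in>q. 0 \<le> Re z \<and> Re z \<le> 1})"
  have fP: "f ` P (theta_arc \<epsilon>) \<subseteq> A" if "\<epsilon> \<in> ?E" for \<epsilon>
    using f(2)[OF that] by (auto simp: P_def intro!: GA that)
  have fQ: "f ` Q (theta_arc \<epsilon>) \<subseteq> B" if "\<epsilon> \<in> ?E" for \<epsilon>
    using f(2)[OF that] by (auto simp: Q_def intro!: GB that)
  have fm: "f ` (theta_arc \<epsilon> - (P (theta_arc \<epsilon>) \<union> Q (theta_arc \<epsilon>))) = p \<epsilon> ` {0<..<1}" if e: "\<epsilon> \<in> ?E" for \<epsilon>
  proof (intro equalityI subsetI)
    fix y assume "y \<in> f ` (theta_arc \<epsilon> - (P (theta_arc \<epsilon>) \<union> Q (theta_arc \<epsilon>)))"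
    then obtain z where z: "z \<in> theta_arc \<epsilon>" "y = f z" "z \<notin> P (theta_arc \<epsilon>)" "z \<notin> Q (theta_arc \<epsilon>)"
      by blast
    moreover from z(1) have "-1 \<le> Re z" "Re z \<le> 1" by (auto simp: theta_arc_def)
    ultimately have "-1/2 < Re z" "Re z < 0" by (auto simp: P_def Q_def)
    note z = z(1) this z(2)
    then have "y = p \<epsilon> (4 * ((Re z + 1) / 2) - 1)" using f(2)[OF e z(1)] Gp by auto
    then show "y \<in> p \<epsilon> ` {0<..<1}" using z by auto
  next
    fix y assume "y \<in> p \<epsilon> ` {0<..<1}"
    then obtain t where t: "0 < t" "t < 1" "y = p \<epsilon> t" by auto
    define z where "z = theta_arc_point \<epsilon> ((t - 1) / 2)"
    have z: "z \<in> theta_arc \<epsilon>" "Re z = (t - 1) / 2" using t by (auto simp: z_def theta_arc_def)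
    have "f z = G \<epsilon> ((t + 1) / 4)" using f(2)[OF e z(1)] z(2) by (simp add: field_simps)
    also have "\<dots> = y" using Gp[of "(t + 1) / 4"] t by (simp add: field_simps)
    finally show "y \<in> f ` (theta_arc \<epsilon> - (P (theta_arc \<epsilon>) \<union> Q (theta_arc \<epsilon>)))"
      using z t by (intro image_eqI[of _ _ z]) (auto simp: P_def Q_def)
  qed
  have fm': "f ` theta_arc \<epsilon> - (f ` P (theta_arc \<epsilon>) \<union> f ` Q (theta_arc \<epsilon>)) = p \<epsilon> ` {0<..<1}" if e: "\<epsilon> \<in> ?E" for \<epsilon>
  proof -
    have "p \<epsilon> ` {0<..<1} \<inter> (A \<union> B) = {}" using disj[OF e] by auto
    then have "p \<epsilon> ` {0<..<1} \<inter> (f ` P (theta_arc \<epsilon>) \<union> f ` Q (theta_arc \<epsilon>)) = {}"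
      using fP[OF e] fQ[OF e] by blast
    with fm[OF e] show ?thesis by blast
  qed
  have "fat_theta_curve M X f"
    unfolding fat_theta_curve_def Let_def
  proof (rule conjI, rule f, rule exI[of _ P], rule exI[of _ Q], intro conjI)
    show "\<forall>q\<in>theta_arcs. subarc (P q) q \<and> subarc (Q q) q \<and> - 1 \<in> P q \<and> 1 \<in> Q q"
    proof
      fix q assume "q \<in> theta_arcs"
      then obtain \<epsilon> where e: "q = theta_arc \<epsilon>" by (auto simp: theta_arcs_param)
      have "theta_arc_point \<epsilon> (-1) \<in> q" "theta_arc_point \<epsilon> 1 \<in> q"
        unfolding e theta_arc_def by (intro imageI; simp)+
      then have "-1 \<in> q" "1 \<in> q" by (simp_all add: theta_arc_point_ends)
      then show "subarc (P q) q \<and> subarc (Q q) q \<and> - 1 \<in> P q \<and> 1 \<in> Q q"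
        using subarc_theta_arc[of "-1" "-1/2" \<epsilon>] subarc_theta_arc[of 0 1 \<epsilon>] by (auto simp: P_def Q_def e)
    qed
    show "\<forall>q\<in>theta_arcs. f ` q - (f ` P q \<union> f ` Q q) = f ` (q - (P q \<union> Q q))"
    proof
      fix q assume "q \<in> theta_arcs"
      then obtain \<epsilon> where e: "\<epsilon> \<in> ?E" "q = theta_arc \<epsilon>" unfolding theta_arcs_param by (rule imageE)
      show "f ` q - (f ` P q \<union> f ` Q q) = f ` (q - (P q \<union> Q q))"
        unfolding e(2) fm[OF e(1)] fm'[OF e(1)] ..
    qed
    show "\<forall>q\<in>theta_arcs. f ` q - (f ` P q \<union> f ` Q q) \<noteq> {}"
    proof
      fix q assume "q \<in> theta_arcs"
      then obtain \<epsilon> where e: "\<epsilon> \<in> ?E" "q = theta_arc \<epsilon>" unfolding theta_arcs_param by (rule imageE)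
      show "f ` q - (f ` P q \<union> f ` Q q) \<noteq> {}"
        unfolding e(2) fm'[OF e(1)] by simp
    qed
    show "\<forall>q\<in>theta_arcs. \<forall>r\<in>theta_arcs. q \<noteq> r \<longrightarrow>
        (\<forall>t\<in>f ` q - (f ` P q \<union> f ` Q q). \<forall>s\<in>f ` r - (f ` P r \<union> f ` Q r). M \<le> dist t s)"
    proof (intro ballI impI)
      fix q r t s assume qr: "q \<in> theta_arcs" "r \<in> theta_arcs" "q \<noteq> r"
        "t \<in> f ` q - (f ` P q \<union> f ` Q q)" "s \<in> f ` r - (f ` P r \<union> f ` Q r)"
      obtain \<epsilon> where e1: "\<epsilon> \<in> ?E" "q = theta_arc \<epsilon>" using qr(1) unfolding theta_arcs_param by (rule imageE)
      obtain \<delta> where e2: "\<delta> \<in> ?E" "r = theta_arc \<delta>" using qr(2) unfolding theta_arcs_param by (rule imageE)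
      note e = e1(1) e2(1) e1(2) e2(2)
      have "t \<in> p \<epsilon> ` {0<..<1}" "s \<in> p \<delta> ` {0<..<1}" "\<epsilon> \<noteq> \<delta>"
        using qr(3-5) fm'[OF e(1)] fm'[OF e(2)] unfolding e(3,4) by metis+
      then show "M \<le> dist t s" using sep[OF e(1,2)] by (elim imageE) metis
    qed
    show "\<forall>q\<in>theta_arcs. \<forall>r\<in>theta_arcs. (f ` q - (f ` P q \<union> f ` Q q)) \<inter> f ` P r = {} \<and>
            (f ` q - (f ` P q \<union> f ` Q q)) \<inter> f ` Q r = {}"
    proof (intro ballI)
      fix q r assume qr: "q \<in> theta_arcs" "r \<in> theta_arcs"
      obtain \<epsilon> where e1: "\<epsilon> \<in> ?E" "q = theta_arc \<epsilon>" using qr(1) unfolding theta_arcs_param by (rule imageE)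
      obtain \<delta> where e2: "\<delta> \<in> ?E" "r = theta_arc \<delta>" using qr(2) unfolding theta_arcs_param by (rule imageE)
      note e = e1(1) e2(1) e1(2) e2(2)
      have "p \<epsilon> ` {0<..<1} \<inter> (A \<union> B) = {}" using disj[OF e(1)] by auto
      then show "(f ` q - (f ` P q \<union> f ` Q q)) \<inter> f ` P r = {} \<and>
            (f ` q - (f ` P q \<union> f ` Q q)) \<inter> f ` Q r = {}"
        unfolding e(3,4) fm'[OF e(1)] using fP[OF e(2)] fQ[OF e(2)] by blast
    qed
    show "\<forall>t\<in>\<Union> ((\<lambda>q. f ` P q) ` theta_arcs). \<forall>s\<in>\<Union> ((\<lambda>q. f ` Q q) ` theta_arcs). 2 * M \<le> dist t s"
    proof (intro ballI)
      fix t s assume "t \<in> \<Union> ((\<lambda>q. f ` P q) ` theta_arcs)" "s \<in> \<Union> ((\<lambda>q. f ` Q q) ` theta_arcs)"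
      then obtain q r where q: "q \<in> theta_arcs" "t \<in> f ` P q" and r: "r \<in> theta_arcs" "s \<in> f ` Q r"
        by (elim UnionE imageE) simp
      obtain \<epsilon> where e1: "\<epsilon> \<in> ?E" "q = theta_arc \<epsilon>" using q(1) unfolding theta_arcs_param by (rule imageE)
      obtain \<delta> where e2: "\<delta> \<in> ?E" "r = theta_arc \<delta>" using r(1) unfolding theta_arcs_param by (rule imageE)
      have "t \<in> A" using q(2) fP[OF e1(1)] unfolding e1(2) by (rule rev_subsetD)
      moreover have "s \<in> B" using r(2) fQ[OF e2(1)] unfolding e2(2) by (rule rev_subsetD)
      ultimately show "2 * M \<le> dist t s" by (rule AB)
    qed
  qed
  then show ?thesis by blast
qed

text \<open>
  The crossing runs from the last visit to \<open>A\<close> to the first visit to \<open>B\<close>. Relatively closed sets suffice because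
  the whole path stays in \<open>X\<close>.
\<close>

lemma crossing_subpath:
  fixes h :: "real \<Rightarrow> 'a::metric_space"
  assumes h: "path h" "path_image h \<subseteq> X" "h 0 \<in> A" "h 1 \<in> B"
    and cl: "closed A'" "closed B'" "A = X \<inter> A'" "B = X \<inter> B'" and disj: "A \<inter> B = {}"
  obtains p where "path p" "path_image p \<subseteq> path_image h" "p 0 \<in> A" "p 1 \<in> B"
    "\<And>t. t \<in> {0<..<1} \<Longrightarrow> p t \<notin> A \<union> B"
proof -
  have hX: "h t \<in> X" if "t \<in> {0..1}" for t using h(2) that by (auto simp: path_image_def)
  have cont: "continuous_on {0..1} h" using h(1) by (simp add: path_def)
  define T where "T = {t\<in>{0..1}. h t \<in> B'}"
  have "T = {0..1} \<inter> h -` B'" by (auto simp: T_def)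
  then have "closed T" using continuous_closed_preimage[OF cont _ cl(2)] by simp
  moreover have "bounded T" by (rule bounded_subset[of "{0..1}"]) (auto simp: T_def)
  moreover have "1 \<in> T" using h(4) cl by (auto simp: T_def)
  ultimately obtain t1 where t1: "t1 \<in> T" "\<And>t. t \<in> T \<Longrightarrow> t1 \<le> t"
    using compact_attains_inf[of T] compact_eq_bounded_closed by blast
  define S where "S = {t\<in>{0..t1}. h t \<in> A'}"
  have "continuous_on {0..t1} h" using cont t1(1) by (auto simp: T_def intro: continuous_on_subset)
  moreover have "S = {0..t1} \<inter> h -` A'" by (auto simp: S_def)
  ultimately have "closed S" using continuous_closed_preimage[OF _ closed_real_atLeastAtMost cl(1)] by metis
  moreover have "bounded S" by (rule bounded_subset[of "{0..t1}"]) (auto simp: S_def)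
  moreover have "0 \<in> S" using h(3) cl t1 by (auto simp: S_def T_def)
  ultimately obtain t0 where t0: "t0 \<in> S" "\<And>t. t \<in> S \<Longrightarrow> t \<le> t0"
    using compact_attains_sup[of S] compact_eq_bounded_closed by blast
  have r: "0 \<le> t0" "t0 \<le> t1" "t1 \<le> 1" using t0(1) t1(1) by (auto simp: S_def T_def)
  have A: "h t0 \<in> A" and B: "h t1 \<in> B"
    using t0(1) t1(1) hX[of t0] hX[of t1] r cl by (auto simp: S_def T_def)
  then have lt: "t0 < t1" using disj r by (cases "t0 = t1") auto
  define p where "p = (\<lambda>t. h (t0 + t * (t1 - t0)))"
  have "(\<lambda>t. t0 + t * (t1 - t0)) ` {0..1} = {t0..t1}"
    using image_affinity_atLeastAtMost[of "t1 - t0" t0 0 1] lt by (simp add: mult.commute add.commute)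
  then have im: "t0 + t * (t1 - t0) \<in> {t0..t1}" if "t \<in> {0..1}" for t using that by blast
  have "path p" unfolding path_def p_def
    by (rule continuous_on_compose2[OF cont]) (use im r in \<open>fastforce intro!: continuous_intros\<close>)+
  moreover have "path_image p \<subseteq> path_image h" using im r by (fastforce simp: p_def path_image_def)
  moreover have "p t \<notin> A \<union> B" if t: "t \<in> {0<..<1}" for t
  proof -
    let ?s = "t0 + t * (t1 - t0)"
    have "0 < t * (t1 - t0)" "t * (t1 - t0) < t1 - t0" using t lt by auto
    then have "t0 < ?s" "?s < t1" by auto
    then have "?s \<notin> S" "?s \<notin> T" using t0(2) t1(2) by force+
    then show ?thesis using \<open>t0 < ?s\<close> \<open>?s < t1\<close> r cl by (auto simp: S_def T_def p_def)
  qed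
  ultimately show ?thesis using that[of p] A B by (auto simp: p_def)
qed

section \<open>The separation condition in terms of paths\<close>

lemma infdist_pair_le_iff: "r \<le> infdist x {a, b} \<longleftrightarrow> r \<le> dist x a \<and> r \<le> dist x b"
proof -
  have "infdist x {a, b} = min (dist x a) (dist x b)"
    using infdist_Un_min[of "{a}" "{b}" x] by (simp add: insert_commute)
  then show ?thesis by simp
qed

lemma nbhd_pair: "X - nbhd X m {a, b} = X - (ball a m \<union> ball b m)"
proof -
  have "x \<in> nbhd X m {a, b} \<longleftrightarrow> x \<in> X \<and> \<not> (m \<le> dist x a \<and> m \<le> dist x b)" for x
    unfolding nbhd_def infdist_pair_le_iff[symmetric] not_le by simp
  then show ?thesis by (fastforce simp: dist_commute)
qed

lemma sharp_condition_imp_separated: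
  assumes "sharp_condition X m" "x \<in> X" "y \<in> X" "10 * m \<le> dist x y"
  obtains a b where "a \<in> X" "b \<in> X" "4 * m \<le> dist x a" "4 * m \<le> dist x b"
    "4 * m \<le> dist y a" "4 * m \<le> dist y b"
    "\<not> path_component (X - (ball a m \<union> ball b m)) x y"
proof -
  obtain a b C D where *: "a \<in> X" "b \<in> X" "4 * m \<le> infdist x {a, b}" "4 * m \<le> infdist y {a, b}"
    "C \<in> components (X - nbhd X m {a, b})" "D \<in> components (X - nbhd X m {a, b})"
    "x \<in> C" "y \<in> D" "C \<noteq> D"
    using assms unfolding sharp_condition_def by metis
  have "\<not> path_component (X - (ball a m \<union> ball b m)) x y"
  proof
    assume "path_component (X - (ball a m \<union> ball b m)) x y"
    then have "connected_component (X - nbhd X m {a, b}) x y"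
      unfolding nbhd_pair using path_component_subset_connected_component[of _ x] by (metis mem_Collect_eq subsetD)
    moreover have "C = connected_component_set (X - nbhd X m {a, b}) x"
      using *(5,7) by (metis components_iff connected_component_eq)
    moreover have "D = connected_component_set (X - nbhd X m {a, b}) y"
      using *(6,8) by (metis components_iff connected_component_eq)
    ultimately show False using \<open>C \<noteq> D\<close> connected_component_eq[of y _ x] by (metis mem_Collect_eq)
  qed
  with * that show ?thesis unfolding infdist_pair_le_iff by blast
qed

text \<open>
  The radius drops from \<open>m\<close> to \<open>n\<close>: a path can be found only in a thickening of a common component.
\<close>

lemma not_sharp_condition_imp_linked:
  assumes "\<not> sharp_condition X m" and geo: "geodesic_space X" and m: "0 < m" and n: "n < m"
  obtains x y where "x \<in> X" "y \<in> X" "10 * m \<le> dist x y"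
    "\<And>a b. a \<in> X \<Longrightarrow> b \<in> X \<Longrightarrow> 4 * m \<le> dist x a \<Longrightarrow> 4 * m \<le> dist x b \<Longrightarrow>
      4 * m \<le> dist y a \<Longrightarrow> 4 * m \<le> dist y b \<Longrightarrow> path_component (X - (ball a n \<union> ball b n)) x y"
proof -
  obtain x y where xy: "x \<in> X" "y \<in> X" "10 * m \<le> dist x y"
    and no: "\<And>a b. a \<in> X \<Longrightarrow> b \<in> X \<Longrightarrow> 4 * m \<le> infdist x {a, b} \<Longrightarrow> 4 * m \<le> infdist y {a, b} \<Longrightarrow>
      \<not> (\<exists>C \<in> components (X - nbhd X m {a, b}). \<exists>D \<in> components (X - nbhd X m {a, b}). x \<in> C \<and> y \<in> D \<and> C \<noteq> D)"
    using assms(1) unfolding sharp_condition_def by metis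
  have "path_component (X - (ball a n \<union> ball b n)) x y"
    if ab: "a \<in> X" "b \<in> X" "4 * m \<le> dist x a" "4 * m \<le> dist x b" "4 * m \<le> dist y a" "4 * m \<le> dist y b" for a b
  proof -
    define Y where "Y = X - (ball a m \<union> ball b m)"
    have xY: "x \<in> Y" "y \<in> Y" using xy ab m by (simp_all add: Y_def dist_commute)
    define K where "K = connected_component_set Y x"
    have "K \<in> components Y" "connected_component_set Y y \<in> components Y"
      using xY by (simp_all add: K_def componentsI)
    moreover have "x \<in> K" "y \<in> connected_component_set Y y"
      using xY by (simp_all add: K_def)
    moreover have "4 * m \<le> infdist x {a, b}" "4 * m \<le> infdist y {a, b}"
      using ab by (simp_all add: infdist_pair_le_iff)
    from no[OF ab(1,2) this] have "\<not> (\<exists>C\<in>components Y. \<exists>D\<in>components Y. x \<in> C \<and> y \<in> D \<and> C \<noteq> D)"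
      unfolding nbhd_pair Y_def .
    ultimately have "y \<in> K" by blast
    then have K: "connected K" "x \<in> K" "y \<in> K" "K \<subseteq> Y"
      using \<open>x \<in> K\<close> connected_component_subset[of Y x] by (simp_all add: K_def)
    have "path_component {z\<in>X. \<exists>k\<in>K. dist k z < m - n} x y"
    proof (rule connected_thickening_path_component[OF geo K(1) _ _ K(2,3)])
      show "K \<subseteq> X" "m - n > 0" using K(4) n by (auto simp: Y_def)
    qed
    moreover have "{z\<in>X. \<exists>k\<in>K. dist k z < m - n} \<subseteq> X - (ball a n \<union> ball b n)"
    proof
      fix z assume "z \<in> {z\<in>X. \<exists>k\<in>K. dist k z < m - n}"
      then obtain k where "z \<in> X" "k \<in> K" "dist k z < m - n" by blast
      then have "m \<le> dist a k" "m \<le> dist b k" using K(4) by (auto simp: Y_def)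
      then show "z \<in> X - (ball a n \<union> ball b n)"
        using \<open>z \<in> X\<close> \<open>dist k z < m - n\<close> dist_triangle[of a k z] dist_triangle[of b k z]
        by (auto simp: dist_commute)
    qed
    ultimately show ?thesis using path_component_of_subset by blast
  qed
  with xy that show ?thesis by blast
qed

section \<open>Two paths that evade balls give a fat theta curve\<close>

lemma infdist_witness:
  assumes "A \<noteq> {}" "infdist x A < r" obtains a where "a \<in> A" "dist x a < r"
proof -
  have "\<exists>a\<in>A. dist x a < r"
  proof (rule ccontr)
    assume "\<not> ?thesis"
    then have "r \<le> infdist x A" using assms(1) unfolding infdist_def by (auto intro!: cINF_greatest)
    then show False using assms(2) by simp
  qed
  with that show ?thesis by blast
qed

lemma path_connected_cball_geodesic:
  assumes geo: "geodesic_space X" and x: "x \<in> X" and r: "0 \<le> r"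
  shows "path_connected (X \<inter> cball x r)"
proof -
  have "path_component (X \<inter> cball x r) x y" if "y \<in> X \<inter> cball x r" for y
  proof (rule geodesic_path_component[OF geo x])
    fix z assume "z \<in> X" "dist x z + dist z y = dist x y"
    then show "z \<in> X \<inter> cball x r" using that zero_le_dist[of z y] by (auto simp del: zero_le_dist)
  qed (use that in auto)
  then show ?thesis unfolding path_connected_component
    by (meson path_component_sym path_component_trans)
qed

text \<open>
  The sets \<open>A\<close> and \<open>B\<close> consist of a large ball around \<open>x\<close> or \<open>y\<close> and one half of the geodesic without a short
  middle piece. The second centre \<open>b\<close> lies outside \<open>A\<close>, hence far from \<open>x\<close>, but close to \<open>A\<close>, hence far from \<open>y\<close>. So
  the pair \<open>a\<close>, \<open>b\<close> satisfies the distance requirements of the separation condition.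
\<close>

lemma not_sharp_condition_imp_fat_theta_curve:
  assumes geo: "geodesic_space X" and M: "0 < M" and ns: "\<not> sharp_condition X (10 * M)"
  shows "\<exists>f. fat_theta_curve M X f"
proof -
  obtain x y where xy: "x \<in> X" "y \<in> X" "100 * M \<le> dist x y"
    and link: "\<And>a b. a \<in> X \<Longrightarrow> b \<in> X \<Longrightarrow> 40 * M \<le> dist x a \<Longrightarrow> 40 * M \<le> dist x b \<Longrightarrow>
      40 * M \<le> dist y a \<Longrightarrow> 40 * M \<le> dist y b \<Longrightarrow> path_component (X - (ball a (5*M) \<union> ball b (5*M))) x y"
    using not_sharp_condition_imp_linked[OF ns geo, of "5 * M"] M by auto
  define l where "l = dist x y"
  obtain g where g: "g 0 = x" "g l = y" "g ` {0..l} \<subseteq> X"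
    "\<And>s t. s \<in> {0..l} \<Longrightarrow> t \<in> {0..l} \<Longrightarrow> dist (g s) (g t) = \<bar>s - t\<bar>"
    using geo xy unfolding geodesic_space_def l_def by metis
  have l: "100 * M \<le> l" using xy by (simp add: l_def)
  have gX: "g t \<in> X" if "t \<in> {0..l}" for t using g(3) that by auto
  have contg: "continuous_on {0..l} g"
    unfolding continuous_on_iff using g(4) by (metis abs_minus_commute dist_real_def)
  have dx: "dist x (g t) = t" and dy: "dist (g t) y = l - t" if "t \<in> {0..l}" for t
    using g(4)[of 0 t] g(4)[of t l] g(1,2) that by auto
  define a where "a = g (l/2)"
  define lo where "lo = l/2 - M"
  define hi where "hi = l/2 + M"
  define A' where "A' = cball x (40*M) \<union> g ` {0..lo}"
  define B0 where "B0 = cball y (40*M) \<union> g ` {hi..l}"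
  define A where "A = X \<inter> A'"
  have lohi: "0 \<le> lo" "lo \<le> l" "0 \<le> hi" "hi \<le> l" using l M by (auto simp: lo_def hi_def)
  have aX: "a \<in> X" using gX l M by (auto simp: a_def)
  have xA: "x \<in> A" and yB: "y \<in> X \<inter> B0" using xy M by (auto simp: A_def A'_def B0_def)
  have cg: "compact (g ` {s..t})" if "0 \<le> s" "t \<le> l" for s t
    by (intro compact_continuous_image continuous_on_subset[OF contg]) (use that in auto)
  have clA: "closed A'"
    unfolding A'_def by (rule closed_Un[OF closed_cball compact_imp_closed[OF cg]]) (use lohi in auto)
  have clB0: "closed B0"
    unfolding B0_def by (rule closed_Un[OF closed_cball compact_imp_closed[OF cg]]) (use lohi in auto)
  have pcg: "path_connected (g ` {s..t})" if "0 \<le> s" "t \<le> l" for s t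
    by (intro path_connected_continuous_image continuous_on_subset[OF contg])
       (use that in \<open>auto intro: convex_imp_path_connected\<close>)
  have pA: "path_connected A"
  proof -
    have "A = (X \<inter> cball x (40*M)) \<union> g ` {0..lo}" using gX lohi by (auto simp: A_def A'_def)
    moreover have "x \<in> (X \<inter> cball x (40*M)) \<inter> g ` {0..lo}"
      using xy M g(1) lohi by (auto intro!: image_eqI[of _ _ 0])
    moreover have "path_connected (X \<inter> cball x (40*M))" "path_connected (g ` {0..lo})"
      using path_connected_cball_geodesic[OF geo xy(1)] pcg M lohi by auto
    ultimately show ?thesis by (metis empty_iff path_connected_Un)
  qed
  have pB0: "path_connected (X \<inter> B0)"
  proof -
    have "X \<inter> B0 = (X \<inter> cball y (40*M)) \<union> g ` {hi..l}" using gX lohi by (auto simp: B0_def)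
    moreover have "y \<in> (X \<inter> cball y (40*M)) \<inter> g ` {hi..l}"
      using xy M g(2) lohi by (auto intro!: image_eqI[of _ _ l])
    moreover have "path_connected (X \<inter> cball y (40*M))" "path_connected (g ` {hi..l})"
      using path_connected_cball_geodesic[OF geo xy(2)] pcg M lohi by auto
    ultimately show ?thesis by (metis empty_iff path_connected_Un)
  qed
  have AB0: "2 * M \<le> dist p q" if pq: "p \<in> A" "q \<in> X \<inter> B0" for p q
  proof -
    have p: "dist x p \<le> 40*M \<or> (\<exists>s\<in>{0..lo}. p = g s)" using pq by (auto simp: A_def A'_def)
    have q: "dist y q \<le> 40*M \<or> (\<exists>s\<in>{hi..l}. q = g s)" using pq by (auto simp: B0_def)
    have tri: "dist x q \<le> dist x p + dist p q" "dist p y \<le> dist p q + dist q y"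
      "dist x y \<le> dist x q + dist q y"
      by (rule dist_triangle)+
    consider "dist x p \<le> 40*M" "dist y q \<le> 40*M" | s where "dist x p \<le> 40*M" "s \<in> {hi..l}" "q = g s"
      | s where "s \<in> {0..lo}" "p = g s" "dist y q \<le> 40*M"
      | s t where "s \<in> {0..lo}" "p = g s" "t \<in> {hi..l}" "q = g t"
      using p q by blast
    then show ?thesis
    proof cases
      case 1 then show ?thesis using tri l l_def M by (simp add: dist_commute)
    next
      case 2 then show ?thesis using tri dx[of s] l M lohi by (auto simp: hi_def)
    next
      case 3 then show ?thesis using tri dy[of s] l M lohi by (auto simp: lo_def dist_commute)
    next
      case 4 then show ?thesis using g(4)[of s t] lohi by (auto simp: lo_def hi_def)
    qed
  qed
  have Ay: "50 * M \<le> dist w y" if "w \<in> A" for w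
  proof -
    have "dist x w \<le> 40*M \<or> (\<exists>s\<in>{0..lo}. w = g s)" using that by (auto simp: A_def A'_def)
    then show ?thesis
      using dist_triangle[of x y w] dy l M lohi l_def by (auto simp: lo_def)
  qed
  \<comment> \<open>The first detour avoids the midpoint of the geodesic. The part of it after the last visit to the
      neighbourhood of \<open>A\<close> is added to \<open>B\<close>, which leaves a second short gap, next to \<open>b\<close>.\<close>
  have da: "dist x a = l/2" "dist y a = l/2" using dx[of "l/2"] dy[of "l/2"] l M by (auto simp: a_def dist_commute)
  obtain c where c: "path c" "path_image c \<subseteq> X - ball a (5*M)" "c 0 = x" "c 1 = y"
    using link[OF aX aX] da l M unfolding path_component_def pathstart_def pathfinish_def by auto
  have cX: "c t \<in> X" and ca: "5*M \<le> dist a (c t)" if "t \<in> {0..1}" for t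
    using subsetD[OF c(2), of "c t"] that by (auto simp: path_image_def)
  have contc: "continuous_on {0..1} c" using c(1) by (simp add: path_def)
  have "infdist (c 0) A \<le> 2*M" using xA M c(3) by simp
  moreover have "2*M \<le> infdist (c 1) A"
    using AB0[OF _ yB] xA c(4) unfolding infdist_def
    by (auto intro!: cINF_greatest simp: dist_commute)
  moreover have "continuous_on {0..1} (\<lambda>t. infdist (c t) A)" by (intro continuous_on_infdist contc)
  ultimately obtain T where T: "T \<in> {0..1}" "infdist (c T) A = 2*M" "\<forall>s\<in>{T..1}. 2*M \<le> infdist (c s) A"
    using last_crossing[of 0 1 "\<lambda>t. infdist (c t) A" "2*M"] by auto
  define b where "b = c T"
  define B' where "B' = B0 \<union> c ` {T..1}"
  define B where "B = X \<inter> B'"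
  have Beq: "B = (X \<inter> B0) \<union> c ` {T..1}" using cX T by (auto simp: B_def B'_def)
  have contc': "continuous_on {T..1} c" using T by (auto intro: continuous_on_subset[OF contc])
  have clB: "closed B'"
    unfolding B'_def by (intro closed_Un clB0 compact_imp_closed compact_continuous_image contc') simp
  have "y \<in> c ` {T..1}" using c(4) T by force
  then have pB: "path_connected B"
    unfolding Beq using yB
    by (intro path_connected_Un pB0 path_connected_continuous_image contc') (auto intro: convex_imp_path_connected)
  have AB: "2 * M \<le> dist p q" if pq: "p \<in> A" "q \<in> B" for p q
  proof -
    consider "q \<in> X \<inter> B0" | s where "s \<in> {T..1}" "q = c s" using pq(2) Beq by auto
    then show ?thesis
    proof cases
      case 1 then show ?thesis using AB0 pq by blast
    next
      case 2
      then have "2*M \<le> infdist q A" using T(3) by auto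
      also have "\<dots> \<le> dist q p" using pq(1) by (rule infdist_le)
      finally show ?thesis by (simp add: dist_commute)
    qed
  qed
  then have disj: "A \<inter> B = {}" using M by force
  have bX: "b \<in> X" using cX T by (simp add: b_def)
  have bB: "b \<in> B" using T by (auto simp: Beq b_def)
  obtain w where w: "w \<in> A" "dist b w < 3*M"
    using infdist_witness[of A b "3*M"] xA T M by (auto simp: b_def)
  have "b \<notin> A" using disj bB by auto
  then have "b \<notin> cball x (40*M)" using bX by (auto simp: A_def A'_def)
  then have dxb: "40*M \<le> dist x b" by (auto simp: not_le)
  have dyb: "40*M \<le> dist y b"
    using Ay[OF w(1)] w(2) dist_triangle[of w y b] M by (auto simp: dist_commute)
  have dab: "5*M \<le> dist a b" using ca T by (auto simp: b_def)
  \<comment> \<open>The second detour avoids both gaps, and therefore provides the third arm.\<close>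
  obtain e where e: "path e" "path_image e \<subseteq> X - (ball a (5*M) \<union> ball b (5*M))" "e 0 = x" "e 1 = y"
    using link[OF aX bX] da dxb dyb l M unfolding path_component_def pathstart_def pathfinish_def by auto
  have yB': "y \<in> B" using yB by (auto simp: Beq)
  obtain p3 where p3: "path p3" "path_image p3 \<subseteq> path_image e" "p3 0 \<in> A" "p3 1 \<in> B"
    "\<And>t. t \<in> {0<..<1} \<Longrightarrow> p3 t \<notin> A \<union> B"
    using crossing_subpath[of e X A B A' B'] e xA yB' clA clB disj A_def B_def by auto
  obtain h where h: "path h" "pathstart h = w" "pathfinish h = b" "path_image h \<subseteq> X"
    "\<And>z. z \<in> path_image h \<Longrightarrow> dist w z + dist z b = dist w b"
    using geodesic_path[OF geo _ bX, of w] w(1) A_def by auto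
  obtain p2 where p2: "path p2" "path_image p2 \<subseteq> path_image h" "p2 0 \<in> A" "p2 1 \<in> B"
    "\<And>t. t \<in> {0<..<1} \<Longrightarrow> p2 t \<notin> A \<union> B"
    using crossing_subpath[of h X A B A' B'] h w bB clA clB disj A_def B_def
    by (auto simp: pathstart_def pathfinish_def)
  define k where "k = (\<lambda>t. g (lo + t * (hi - lo)))"
  have kr: "lo + t * (hi - lo) \<in> {lo..hi}" if "t \<in> {0..1}" for t
    using that M mult_left_mono[of t 1 "hi - lo"] by (auto simp: lo_def hi_def algebra_simps)
  have "path k" unfolding path_def k_def
    by (rule continuous_on_compose2[OF contg]) (use kr lohi in \<open>fastforce intro!: continuous_intros\<close>)+
  moreover have "path_image k \<subseteq> X" using kr gX lohi by (fastforce simp: k_def path_image_def)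
  moreover have "k 0 \<in> A" "k 1 \<in> B"
    using gX lohi by (auto simp: k_def A_def A'_def Beq B0_def)
  ultimately obtain p1 where p1: "path p1" "path_image p1 \<subseteq> path_image k" "p1 0 \<in> A" "p1 1 \<in> B"
    "\<And>t. t \<in> {0<..<1} \<Longrightarrow> p1 t \<notin> A \<union> B"
    using crossing_subpath[of k X A B A' B'] clA clB disj A_def B_def by auto
  have i1: "dist a z \<le> M" if z: "z \<in> path_image p1" for z
  proof -
    obtain t where t: "t \<in> {0..1}" "z = g (lo + t * (hi - lo))"
      using subsetD[OF p1(2) z] by (auto simp: k_def path_image_def)
    define r where "r = lo + t * (hi - lo)"
    have r: "r \<in> {lo..hi}" using kr[OF t(1)] by (simp add: r_def)
    have "dist a z = \<bar>l/2 - r\<bar>"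
      unfolding a_def t(2) r_def[symmetric] by (rule g(4)) (use r lohi l M in auto)
    then show ?thesis using r by (auto simp: lo_def hi_def)
  qed
  have i2: "dist b z \<le> 3*M" if "z \<in> path_image p2" for z
  proof -
    have "dist w z + dist z b = dist w b" using that p2(2) h(5) by blast
    then show ?thesis using w(2) zero_le_dist[of w z] by (simp add: dist_commute del: zero_le_dist)
  qed
  have i3: "5*M \<le> dist a z" "5*M \<le> dist b z" if "z \<in> path_image p3" for z
    using subsetD[OF e(2) subsetD[OF p3(2) that]] by auto
  define p where "p = (\<lambda>\<epsilon>::real. if \<epsilon> = 1 then p1 else if \<epsilon> = -1 then p2 else p3)"
  have d12: "M \<le> dist u v" if "u \<in> path_image p1" "v \<in> path_image p2" for u v
    using i1[OF that(1)] i2[OF that(2)] dab dist_triangle[of a b u] dist_triangle[of u b v]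
    by (auto simp: dist_commute)
  have d13: "M \<le> dist u v" if "u \<in> path_image p1" "v \<in> path_image p3" for u v
    using i1[OF that(1)] i3[OF that(2)] dist_triangle[of a v u] M by (auto simp: dist_commute)
  have d23: "M \<le> dist u v" if "u \<in> path_image p2" "v \<in> path_image p3" for u v
    using i2[OF that(1)] i3[OF that(2)] dist_triangle[of b v u] M by (auto simp: dist_commute)
  have im: "p1 t \<in> path_image p1" "p2 t \<in> path_image p2" "p3 t \<in> path_image p3" if "t \<in> {0<..<1}" for t
    using that by (auto simp: path_image_def)
  show ?thesis
  proof (rule fat_theta_curve_from_arms[of A X B p M])
    show "A \<subseteq> X" "B \<subseteq> X" by (auto simp: A_def B_def)
    show "path_connected A" "path_connected B" by fact+
    show "path (p \<epsilon>) \<and> path_image (p \<epsilon>) \<subseteq> X \<and> p \<epsilon> 0 \<in> A \<and> p \<epsilon> 1 \<in> B" if "\<epsilon> \<in> {1, -1, 0}" for \<epsilon>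
      using p1 p2 p3 e(2) h(4) \<open>path_image k \<subseteq> X\<close> unfolding p_def by auto
    show "p \<epsilon> t \<notin> A \<union> B" if "\<epsilon> \<in> {1, -1, 0}" "t \<in> {0<..<1}" for \<epsilon> t
      using p1(5) p2(5) p3(5) that(2) by (simp add: p_def)
    show "M \<le> dist (p \<epsilon> s) (p \<delta> t)"
      if "\<epsilon> \<in> {1, -1, 0}" "\<delta> \<in> {1, -1, 0}" "\<epsilon> \<noteq> \<delta>" "s \<in> {0<..<1}" "t \<in> {0<..<1}" for \<epsilon> \<delta> s t
      using that(1-3) d12[OF im(1)[OF that(4)] im(2)[OF that(5)]] d12[OF im(1)[OF that(5)] im(2)[OF that(4)]]
        d13[OF im(1)[OF that(4)] im(3)[OF that(5)]] d13[OF im(1)[OF that(5)] im(3)[OF that(4)]]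
        d23[OF im(2)[OF that(4)] im(3)[OF that(5)]] d23[OF im(2)[OF that(5)] im(3)[OF that(4)]]
      by (auto simp: p_def dist_commute)
    show "2 * M \<le> dist u v" if "u \<in> A" "v \<in> B" for u v using AB that by blast
  qed
qed

section \<open>Separating pairs of balls\<close>

lemma path_component_within_component:
  assumes "path_component S x y" shows "path_component (path_component_set S x) x y"
proof -
  have "x \<in> path_component_set S x" using path_component_mem(1)[OF assms] by (simp add: path_component_refl)
  then show ?thesis
    using assms path_connected_path_component[of S x] unfolding path_connected_component by auto
qed

text \<open>The separation condition in the form in which it is applied below, in terms of paths.\<close>

locale separated_space =
  fixes X :: "'a::metric_space set" and m :: real
  assumes geo: "geodesic_space X" and m: "0 < m"
    and separated: "\<And>x y. x \<in> X \<Longrightarrow> y \<in> X \<Longrightarrow> 10 * m \<le> dist x y \<Longrightarrow>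
      \<exists>a\<in>X. \<exists>b\<in>X. 4 * m \<le> dist x a \<and> 4 * m \<le> dist x b \<and> 4 * m \<le> dist y a \<and> 4 * m \<le> dist y b \<and>
        \<not> path_component (X - (ball a m \<union> ball b m)) x y"
begin

definition off :: "'a \<Rightarrow> 'a \<Rightarrow> 'a set" where
  "off a b = X - (ball a m \<union> ball b m)"

lemma off_iff: "z \<in> off a b \<longleftrightarrow> z \<in> X \<and> m \<le> dist a z \<and> m \<le> dist b z"
  by (auto simp: off_def)

lemma off_commute: "off a b = off b a"
  by (auto simp: off_def)

abbreviation joined :: "'a \<Rightarrow> 'a \<Rightarrow> 'a \<Rightarrow> 'a \<Rightarrow> bool" where
  "joined a b \<equiv> path_component (off a b)"

text \<open>A geodesic between points that are close to each other compared with their distance to \<open>a\<close> and \<open>b\<close> stays off both balls.\<close>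

lemma joined_near:
  assumes "x \<in> X" "y \<in> X" "dist x y \<le> r" "r + m \<le> dist x a" "r + m \<le> dist x b"
  shows "joined a b x y"
proof (rule geodesic_path_component[OF geo assms(1,2)])
  fix z assume z: "z \<in> X" "dist x z + dist z y = dist x y"
  then have "dist x z \<le> r" using assms(3) zero_le_dist[of z y] by linarith
  then show "z \<in> off a b"
    using z assms dist_triangle[of x a z] dist_triangle[of x b z] by (auto simp: off_iff dist_commute)
qed

lemma joined_ball:
  assumes "w \<in> X" "2 * m \<le> dist w a" "2 * m \<le> dist w b" "y \<in> X" "z \<in> X" "dist w y \<le> m" "dist w z \<le> m"
  shows "joined a b y z"
proof -
  have "joined a b w y" "joined a b w z" using assms by (auto intro!: joined_near[where r = m])
  then show ?thesis by (meson path_component_sym path_component_trans)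
qed

lemma first_contact_pair:
  assumes "path_component Y p q" "r \<le> dist u p" "r \<le> dist v p"
  shows "path_component {z\<in>Y. r \<le> dist u z \<and> r \<le> dist v z} p q \<or>
    (\<exists>z\<in>Y. (dist u z = r \<or> dist v z = r) \<and> path_component {z\<in>Y. r \<le> dist u z \<and> r \<le> dist v z} p z)"
proof -
  let ?F = "\<lambda>z. min (dist u z) (dist v z)"
  have "{z\<in>Y. r \<le> ?F z} = {z\<in>Y. r \<le> dist u z \<and> r \<le> dist v z}" by auto
  moreover have "continuous_on Y ?F" by (intro continuous_intros)
  moreover have "r \<le> ?F p" using assms by simp
  moreover have "dist u z = r \<or> dist v z = r" if "?F z = r" for z using that by (auto simp: min_def split: if_splits)
  ultimately show ?thesis using first_contact[OF assms(1), of ?F r] by metis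
qed

end

section \<open>No pair of balls separates a point of one arm from the other two arms\<close>

text \<open>
  The paths \<open>\<zeta>\<close> lead from \<open>x0\<close> to the points \<open>pt True\<close> and \<open>pt False\<close> on one side, the paths \<open>\<xi>\<close> on the other
  side. The frame is symmetric in \<open>\<zeta>\<close> and \<open>\<xi>\<close>, which halves the work below. A ball that touches
  both \<open>\<zeta> True \<union> \<xi> True\<close> and \<open>\<zeta> False \<union> \<xi> False\<close> belongs to one side only; two balls on different sides
  are far enough apart for the separation condition to apply to their centres.
\<close>

locale theta_frame = separated_space +
  fixes x0 :: 'a and pt :: "bool \<Rightarrow> 'a" and \<zeta> \<xi> :: "bool \<Rightarrow> real \<Rightarrow> 'a"
  assumes path_\<zeta>: "path (\<zeta> i)" and im_\<zeta>: "path_image (\<zeta> i) \<subseteq> X" and st_\<zeta>: "\<zeta> i 0 = x0" and fi_\<zeta>: "\<zeta> i 1 = pt i"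
    and path_\<xi>: "path (\<xi> i)" and im_\<xi>: "path_image (\<xi> i) \<subseteq> X" and st_\<xi>: "\<xi> i 0 = x0" and fi_\<xi>: "\<xi> i 1 = pt i"
    and one_sided: "\<And>w. w \<in> X \<Longrightarrow> 7 * m \<le> dist w x0 \<Longrightarrow>
      (\<And>i. ball w m \<inter> (path_image (\<zeta> i) \<union> path_image (\<xi> i)) \<noteq> {}) \<Longrightarrow>
      (\<forall>i. ball w m \<inter> path_image (\<xi> i) = {}) \<or> (\<forall>i. ball w m \<inter> path_image (\<zeta> i) = {})"
    and far: "\<And>u v. u \<in> X \<Longrightarrow> v \<in> X \<Longrightarrow> 7 * m \<le> dist u x0 \<Longrightarrow> 7 * m \<le> dist v x0 \<Longrightarrow>
      (\<And>i. ball u m \<inter> path_image (\<zeta> i) \<noteq> {}) \<Longrightarrow> (\<And>i. ball v m \<inter> path_image (\<xi> i) \<noteq> {}) \<Longrightarrow>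
      10 * m \<le> dist u v"
begin

definition cut_pair :: "'a \<Rightarrow> 'a \<Rightarrow> bool" where
  "cut_pair u v \<longleftrightarrow> u \<in> X \<and> v \<in> X \<and> 7 * m \<le> dist u x0 \<and> 7 * m \<le> dist v x0 \<and>
     (\<forall>i. ball u m \<inter> path_image (\<xi> i) = {}) \<and> (\<forall>i. ball v m \<inter> path_image (\<zeta> i) = {}) \<and>
     (\<forall>i. \<not> joined u v x0 (pt i))"

lemma x0X: "x0 \<in> X" using im_\<zeta> st_\<zeta> by (force simp: path_image_def)

lemma cont: "continuous_on {0..1} (\<zeta> i)" "continuous_on {0..1} (\<xi> i)"
  using path_\<zeta> path_\<xi> by (auto simp: path_def)

lemma mem: "t \<in> {0..1} \<Longrightarrow> \<zeta> i t \<in> path_image (\<zeta> i)" "t \<in> {0..1} \<Longrightarrow> \<xi> i t \<in> path_image (\<xi> i)"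
  by (auto simp: path_image_def)

lemma avoid_\<xi>: "ball w m \<inter> path_image (\<xi> i) = {} \<Longrightarrow> t \<in> {0..1} \<Longrightarrow> m \<le> dist w (\<xi> i t)"
  using mem(2)[of t i] by (auto simp: disjoint_iff not_less)

lemma avoid_\<zeta>: "ball w m \<inter> path_image (\<zeta> i) = {} \<Longrightarrow> t \<in> {0..1} \<Longrightarrow> m \<le> dist w (\<zeta> i t)"
  using mem(1)[of t i] by (auto simp: disjoint_iff not_less)

lemma \<zeta>X: "t \<in> {0..1} \<Longrightarrow> \<zeta> i t \<in> X" and \<xi>X: "t \<in> {0..1} \<Longrightarrow> \<xi> i t \<in> X"
  using mem im_\<zeta> im_\<xi> by blast+

text \<open>Otherwise the path itself would join \<open>x0\<close> to its endpoint off both balls.\<close>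

lemma cut_pair_meets_\<zeta>:
  assumes "cut_pair u v" shows "\<exists>t\<in>{0..1}. dist u (\<zeta> i t) < m"
proof (rule ccontr)
  assume "\<not> ?thesis"
  then have "\<zeta> i ` {0..1} \<subseteq> off u v"
    using assms avoid_\<zeta> \<zeta>X by (auto simp: off_iff not_less cut_pair_def)
  then have "joined u v (\<zeta> i 0) (\<zeta> i 1)" by (intro path_component_along[OF cont(1)]) auto
  then show False using assms by (simp add: cut_pair_def st_\<zeta> fi_\<zeta>)
qed

text \<open>
  Past its last visit to the ball around \<open>u\<close> the path is joined to \<open>pt i\<close>, which is not in the component of \<open>x0\<close>.
\<close>

lemma cut_pair_tail_\<zeta>:
  assumes "cut_pair u v" "t \<in> {0..1}" "dist u (\<zeta> i t) < m"
  shows "\<exists>T\<in>{t..1}. dist u (\<zeta> i T) = m \<and> (\<forall>s\<in>{T..1}. \<zeta> i s \<in> off u v \<and> \<not> joined u v x0 (\<zeta> i s))"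
proof -
  have "m \<le> dist u (\<xi> i 1)" using assms avoid_\<xi> by (auto simp: cut_pair_def)
  then have "m \<le> dist u (\<zeta> i 1)" by (simp add: fi_\<zeta> fi_\<xi>)
  moreover have "continuous_on {t..1} (\<lambda>s. dist u (\<zeta> i s))"
    using assms(2) by (intro continuous_intros continuous_on_subset[OF cont(1)]) auto
  ultimately obtain T where T: "T \<in> {t..1}" "dist u (\<zeta> i T) = m" "\<forall>s\<in>{T..1}. m \<le> dist u (\<zeta> i s)"
    using last_crossing[of t 1 "\<lambda>s. dist u (\<zeta> i s)" m] assms(2,3) by auto
  have o: "\<zeta> i s \<in> off u v" if "s \<in> {T..1}" for s
    using T that assms avoid_\<zeta> \<zeta>X by (auto simp: off_iff cut_pair_def)
  moreover have "\<not> joined u v x0 (\<zeta> i s)" if s: "s \<in> {T..1}" for s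
  proof
    assume *: "joined u v x0 (\<zeta> i s)"
    have "joined u v (\<zeta> i s) (\<zeta> i 1)"
      by (rule path_component_along[OF continuous_on_subset[OF cont(1)], of T 1])
         (use T s assms(2) o in auto)
    then show False using * assms(1) path_component_trans by (force simp: cut_pair_def fi_\<zeta>)
  qed
  ultimately show ?thesis using T by blast
qed

lemma swapped: "theta_frame X m x0 pt \<xi> \<zeta>"
proof unfold_locales
  show "(\<forall>i. ball w m \<inter> path_image (\<zeta> i) = {}) \<or> (\<forall>i. ball w m \<inter> path_image (\<xi> i) = {})"
    if "w \<in> X" "7 * m \<le> dist w x0" "\<And>i. ball w m \<inter> (path_image (\<xi> i) \<union> path_image (\<zeta> i)) \<noteq> {}" for w
    using one_sided[OF that(1,2)] that(3) by (simp add: Un_commute disj_commute)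
  show "10 * m \<le> dist u v" if "u \<in> X" "v \<in> X" "7 * m \<le> dist u x0" "7 * m \<le> dist v x0"
      "\<And>i. ball u m \<inter> path_image (\<xi> i) \<noteq> {}" "\<And>i. ball v m \<inter> path_image (\<zeta> i) \<noteq> {}" for u v
    using far[of v u] that by (simp add: dist_commute)
qed (use path_\<zeta> im_\<zeta> st_\<zeta> fi_\<zeta> path_\<xi> im_\<xi> st_\<xi> fi_\<xi> in auto)

lemma cut_pair_swapped: "theta_frame.cut_pair X m x0 pt \<xi> \<zeta> v u \<longleftrightarrow> cut_pair u v"
  unfolding theta_frame.cut_pair_def[OF swapped] cut_pair_def by (auto simp: off_commute)

lemma cut_pair_head_\<zeta>:
  assumes "cut_pair u v"
  shows "\<exists>z. dist u z = m \<and> z \<in> X \<and> joined u v x0 z"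
proof -
  obtain t where t: "t \<in> {0..1}" "dist u (\<zeta> True t) < m" using cut_pair_meets_\<zeta>[OF assms] by blast
  have "continuous_on {0..t} (\<lambda>s. dist u (\<zeta> True s))"
    using t by (intro continuous_intros continuous_on_subset[OF cont(1)]) auto
  moreover have "m \<le> dist u (\<zeta> True 0)" using assms m by (simp add: cut_pair_def st_\<zeta>)
  ultimately obtain T where T: "T \<in> {0..t}" "dist u (\<zeta> True T) = m" "\<forall>s\<in>{0..T}. m \<le> dist u (\<zeta> True s)"
    using first_crossing[of 0 t "\<lambda>s. dist u (\<zeta> True s)" m] t by auto
  have o: "\<zeta> True ` {0..T} \<subseteq> off u v"
  proof (rule image_subsetI)
    fix s assume s: "s \<in> {0..T}"
    then have "m \<le> dist v (\<zeta> True s)" "\<zeta> True s \<in> X"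
      using T(1) t(1) assms avoid_\<zeta>[of v True s] \<zeta>X[of s] by (simp_all add: cut_pair_def)
    then show "\<zeta> True s \<in> off u v" using T(3) s by (simp add: off_iff)
  qed
  have "joined u v (\<zeta> True 0) (\<zeta> True T)"
    by (rule path_component_along[OF continuous_on_subset[OF cont(1)] o]) (use T t in auto)
  then have "joined u v x0 (\<zeta> True T)" by (simp add: st_\<zeta>)
  moreover have "\<zeta> True T \<in> X" using T(1) t(1) by (intro \<zeta>X) simp
  ultimately show ?thesis using T(2) by blast
qed

lemma cut_pair_far: "cut_pair u v \<Longrightarrow> 10 * m \<le> dist u v"
proof (rule far)
  assume c: "cut_pair u v"
  then show "u \<in> X" "v \<in> X" "7 * m \<le> dist u x0" "7 * m \<le> dist v x0" by (auto simp: cut_pair_def)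
  show "ball u m \<inter> path_image (\<zeta> i) \<noteq> {}" for i
    using cut_pair_meets_\<zeta>[OF c, of i] mem(1)[of _ i] by force
  show "ball v m \<inter> path_image (\<xi> i) \<noteq> {}" for i
    using theta_frame.cut_pair_meets_\<zeta>[OF swapped, of v u i] c mem(2)[of _ i]
    unfolding cut_pair_swapped by force
qed

text \<open>
  The two balls \<open>w\<close> and \<open>w'\<close> separate \<open>u\<close> from \<open>v\<close>. One of them, \<open>w'\<close>, lies in the component of
  \<open>x0\<close>, so it does not touch the tails that run from \<open>u\<close> and \<open>v\<close> to the points \<open>pt i\<close>. The other
  one has to block all these tails alone, and therefore can replace \<open>u\<close> or \<open>v\<close>.
\<close>

lemma cut_pair_blocker:
  assumes c: "cut_pair u v"
  obtains w w' where "w \<in> X" "w' \<in> X" "4 * m \<le> dist u w" "4 * m \<le> dist v w" "4 * m \<le> dist u w'" "4 * m \<le> dist v w'"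
    "\<not> joined w w' u v" "7 * m \<le> dist w x0"
    "\<forall>z\<in>off u v. \<not> joined u v x0 z \<longrightarrow> m \<le> dist w' z"
    "(\<forall>i. ball w m \<inter> path_image (\<xi> i) = {}) \<or> (\<forall>i. ball w m \<inter> path_image (\<zeta> i) = {})"
proof -
  interpret sw: theta_frame X m x0 pt \<xi> \<zeta> by (rule swapped)
  have c': "sw.cut_pair v u" using c by (simp add: cut_pair_swapped)
  have uv: "u \<in> X" "v \<in> X" "7 * m \<le> dist u x0" "7 * m \<le> dist v x0" using c by (auto simp: cut_pair_def)
  obtain a b where ab: "a \<in> X" "b \<in> X" "4 * m \<le> dist u a" "4 * m \<le> dist u b" "4 * m \<le> dist v a" "4 * m \<le> dist v b"
      "\<not> joined a b u v"
    using separated[OF uv(1,2) cut_pair_far[OF c]] unfolding off_def by blast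
  obtain zu where zu: "dist u zu = m" "zu \<in> X" "joined u v x0 zu" using cut_pair_head_\<zeta>[OF c] by blast
  obtain zv where zv: "dist v zv = m" "zv \<in> X" "joined u v x0 zv"
    using sw.cut_pair_head_\<zeta>[OF c'] by (auto simp: off_commute)
  \<comment> \<open>One of the two balls meets the component of \<open>x0\<close> \<dots>\<close>
  have "\<exists>z. joined u v x0 z \<and> (dist a z < m \<or> dist b z < m)"
  proof (rule ccontr)
    assume no: "\<not> ?thesis"
    have z: "joined u v zu zv" using zu zv by (meson path_component_sym path_component_trans)
    then have "path_component (path_component_set (off u v) zu) zu zv"
      by (rule path_component_within_component)
    moreover have "path_component_set (off u v) zu \<subseteq> off a b"
    proof
      fix y assume "y \<in> path_component_set (off u v) zu"
      then have y: "joined u v zu y" by simp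
      then have "joined u v x0 y" using zu(3) path_component_trans by blast
      then show "y \<in> off a b" using no path_component_mem(2)[OF y] by (auto simp: off_iff not_less)
    qed
    ultimately have "joined a b zu zv" by (rule path_component_of_subset[rotated])
    moreover have "joined a b u zu" by (rule joined_near[OF uv(1) zu(2), where r = m]) (use zu ab m in simp_all)
    moreover have "joined a b v zv" by (rule joined_near[OF uv(2) zv(2), where r = m]) (use zv ab m in simp_all)
    ultimately have "joined a b u v" by (meson path_component_sym path_component_trans)
    then show False using ab by blast
  qed
  then obtain w w' where ww: "{w, w'} = {a, b}" "\<exists>z. joined u v x0 z \<and> dist w' z < m" by blast
  then have w: "w \<in> X" "w' \<in> X" "4 * m \<le> dist u w" "4 * m \<le> dist u w'" "4 * m \<le> dist v w" "4 * m \<le> dist v w'"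
      "\<not> joined w w' u v"
    using ab off_commute by (auto simp: doubleton_eq_iff)
  obtain zw where zw: "joined u v x0 zw" "dist w' zw < m" using ww by blast
  \<comment> \<open>\<dots> and hence lies in it.\<close>
  have inC: "joined u v x0 z" if "z \<in> X" "dist w' z < m" for z
  proof -
    have "joined u v zw z"
      using joined_ball[of w' u v zw z] w m that zw path_component_mem(2)[OF zw(1)] by (auto simp: off_iff dist_commute)
    then show ?thesis using zw(1) path_component_trans by blast
  qed
  have w'off: "m \<le> dist w' z" if "z \<in> off u v" "\<not> joined u v x0 z" for z
  proof (rule ccontr)
    assume "\<not> m \<le> dist w' z"
    then show False using inC[of z] that by (simp add: off_iff)
  qed
  \<comment> \<open>If both tails through \<open>pt i\<close> avoided \<open>w\<close>, they would join \<open>u\<close> to \<open>v\<close>.\<close>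
  have meets: "\<exists>z. z \<in> path_image (\<zeta> i) \<union> path_image (\<xi> i) \<and> dist w z < m \<and> z \<in> off u v \<and> \<not> joined u v x0 z" for i
  proof (rule ccontr)
    assume no: "\<not> ?thesis"
    obtain t where t: "t \<in> {0..1}" "dist u (\<zeta> i t) < m" using cut_pair_meets_\<zeta>[OF c] by blast
    obtain T where T: "T \<in> {t..1}" "dist u (\<zeta> i T) = m" "\<forall>s\<in>{T..1}. \<zeta> i s \<in> off u v \<and> \<not> joined u v x0 (\<zeta> i s)"
      using cut_pair_tail_\<zeta>[OF c t] by blast
    obtain t' where t': "t' \<in> {0..1}" "dist v (\<xi> i t') < m" using sw.cut_pair_meets_\<zeta>[OF c'] by blast
    obtain T' where T': "T' \<in> {t'..1}" "dist v (\<xi> i T') = m" "\<forall>s\<in>{T'..1}. \<xi> i s \<in> off u v \<and> \<not> joined u v x0 (\<xi> i s)"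
      using sw.cut_pair_tail_\<zeta>[OF c' t'] by (auto simp: off_commute)
    have "joined w w' (\<zeta> i T) (\<zeta> i 1)"
    proof (rule path_component_along[OF continuous_on_subset[OF cont(1)], of T 1])
      show "\<zeta> i ` {T..1} \<subseteq> off w w'"
      proof (rule image_subsetI)
        fix s assume s: "s \<in> {T..1}"
        then have s01: "s \<in> {0..1}" using T(1) t(1) by simp
        have z: "\<zeta> i s \<in> off u v" "\<not> joined u v x0 (\<zeta> i s)" using T(3) s by blast+
        then have "\<not> dist w (\<zeta> i s) < m" using no mem(1)[OF s01, of i] by blast
        then show "\<zeta> i s \<in> off w w'" using w'off[OF z] \<zeta>X[OF s01, of i] by (simp add: off_iff)
      qed
    qed (use T t in auto)
    moreover have "joined w w' (\<xi> i T') (\<xi> i 1)"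
    proof (rule path_component_along[OF continuous_on_subset[OF cont(2)], of T' 1])
      show "\<xi> i ` {T'..1} \<subseteq> off w w'"
      proof (rule image_subsetI)
        fix s assume s: "s \<in> {T'..1}"
        then have s01: "s \<in> {0..1}" using T'(1) t'(1) by simp
        have z: "\<xi> i s \<in> off u v" "\<not> joined u v x0 (\<xi> i s)" using T'(3) s by blast+
        then have "\<not> dist w (\<xi> i s) < m" using no mem(2)[OF s01, of i] by blast
        then show "\<xi> i s \<in> off w w'" using w'off[OF z] \<xi>X[OF s01, of i] by (simp add: off_iff)
      qed
    qed (use T' t' in auto)
    moreover have "joined w w' u (\<zeta> i T)"
      by (rule joined_near[OF uv(1) \<zeta>X, where r = m]) (use T t w m in simp_all)
    moreover have "joined w w' v (\<xi> i T')"
      by (rule joined_near[OF uv(2) \<xi>X, where r = m]) (use T' t' w m in simp_all)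
    ultimately have "joined w w' u v"
      unfolding fi_\<zeta> fi_\<xi> by (meson path_component_sym path_component_trans)
    then show False using w by blast
  qed
  \<comment> \<open>A ball that came closer to \<open>x0\<close> would lie in the component of \<open>x0\<close> and miss the tails.\<close>
  have far0: "7 * m \<le> dist w x0"
  proof (rule ccontr)
    assume less: "\<not> 7 * m \<le> dist w x0"
    obtain z where z: "dist w z < m" "z \<in> off u v" "\<not> joined u v x0 z" using meets by blast
    have "\<exists>y\<in>X. dist x0 y \<le> 6 * m \<and> dist w y < m"
    proof (cases "dist w x0 \<le> 6 * m")
      case True then show ?thesis using w m by (intro bexI[of _ w]) (auto simp: dist_commute)
    next
      case False
      obtain g where g: "path g" "pathstart g = x0" "pathfinish g = w" "path_image g \<subseteq> X"
        "\<And>z. z \<in> path_image g \<Longrightarrow> dist x0 z + dist z w = dist x0 w"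
        using geodesic_path[OF geo x0X w(1)] by blast
      have "continuous_on {0..1} (\<lambda>t. - dist x0 (g t))"
        using g(1) by (auto simp: path_def intro!: continuous_intros)
      then obtain t where t: "t \<in> {0..1}" "dist x0 (g t) = 6 * m"
        using first_crossing[of 0 1 "\<lambda>t. - dist x0 (g t)" "- (6 * m)"] g False m
        by (auto simp: pathstart_def pathfinish_def dist_commute)
      then have "g t \<in> path_image g" by (auto simp: path_image_def)
      then show ?thesis using g(4) g(5)[of "g t"] t less by (intro bexI[of _ "g t"]) (auto simp: dist_commute)
    qed
    then obtain y where y: "y \<in> X" "dist x0 y \<le> 6 * m" "dist w y < m" by blast
    have "joined u v x0 y" using y uv x0X by (intro joined_near[where r = "6*m"]) (auto simp: dist_commute)
    moreover have "joined u v y z"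
      using joined_ball[of w u v y z] w y z m by (auto simp: off_iff dist_commute)
    ultimately show False using z path_component_trans by blast
  qed
  have "ball w m \<inter> (path_image (\<zeta> i) \<union> path_image (\<xi> i)) \<noteq> {}" for i using meets[of i] by force
  then have "(\<forall>i. ball w m \<inter> path_image (\<xi> i) = {}) \<or> (\<forall>i. ball w m \<inter> path_image (\<zeta> i) = {})"
    using one_sided[OF w(1) far0] by blast
  then show ?thesis using that[of w w'] w far0 w'off by blast
qed

text \<open>
  On a path from \<open>pt i\<close> to \<open>x0\<close> that avoids \<open>w\<close> and \<open>v\<close>, the part before the first contact with the ball around \<open>u\<close> runs
  outside the component of \<open>x0\<close>, so it avoids \<open>w'\<close> too and would join \<open>u\<close> via \<open>pt i\<close> to \<open>v\<close>. Hence the new pair still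
  separates. It is better than the old one: \<open>\<zeta> True\<close> meets the ball around \<open>w\<close> after its last visit to
  the ball around \<open>u\<close>.
\<close>

lemma cut_pair_replace:
  assumes c: "cut_pair u v"
    and w: "w \<in> X" "w' \<in> X" "4 * m \<le> dist u w" "4 * m \<le> dist v w" "4 * m \<le> dist u w'" "4 * m \<le> dist v w'"
      "\<not> joined w w' u v" "7 * m \<le> dist w x0"
    and off_w': "\<forall>z\<in>off u v. \<not> joined u v x0 z \<longrightarrow> m \<le> dist w' z"
    and left: "\<forall>i. ball w m \<inter> path_image (\<xi> i) = {}"
    and t: "t \<in> {0..1}" "dist u (\<zeta> True t) < m"
  shows "cut_pair w v" "\<exists>s\<in>{t..1}. dist w (\<zeta> True s) < m \<and> 2 * m \<le> dist (\<zeta> True t) (\<zeta> True s)"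
proof -
  interpret sw: theta_frame X m x0 pt \<xi> \<zeta> by (rule swapped)
  have w': "m \<le> dist w' z" if "z \<in> off u v" "\<not> joined u v x0 z" for z using off_w' that by blast
  have c': "sw.cut_pair v u" using c by (simp add: cut_pair_swapped)
  have uv: "u \<in> X" "v \<in> X" "7 * m \<le> dist u x0" "7 * m \<le> dist v x0" using c by (auto simp: cut_pair_def)
  have v_pt: "joined w w' v (pt i)" for i
  proof -
    obtain t' where t': "t' \<in> {0..1}" "dist v (\<xi> i t') < m" using sw.cut_pair_meets_\<zeta>[OF c'] by blast
    obtain T' where T': "T' \<in> {t'..1}" "dist v (\<xi> i T') = m" "\<forall>s\<in>{T'..1}. \<xi> i s \<in> off u v \<and> \<not> joined u v x0 (\<xi> i s)"
      using sw.cut_pair_tail_\<zeta>[OF c' t'] by (auto simp: off_commute)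
    have "joined w w' (\<xi> i T') (\<xi> i 1)"
    proof (rule path_component_along[OF continuous_on_subset[OF cont(2)], of T' 1])
      show "\<xi> i ` {T'..1} \<subseteq> off w w'"
      proof (rule image_subsetI)
        fix s assume s: "s \<in> {T'..1}"
        then have s01: "s \<in> {0..1}" using T'(1) t'(1) by simp
        have z: "\<xi> i s \<in> off u v" "\<not> joined u v x0 (\<xi> i s)" using T'(3) s by blast+
        show "\<xi> i s \<in> off w w'"
          using w'[OF z] \<xi>X[OF s01, of i] avoid_\<xi>[OF spec[OF left] s01] by (simp add: off_iff)
      qed
    qed (use T' t' in auto)
    moreover have "joined w w' v (\<xi> i T')"
      by (rule joined_near[OF uv(2) \<xi>X, where r = m]) (use T' t' w m in simp_all)
    ultimately show ?thesis unfolding fi_\<xi> by (rule path_component_trans[rotated])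
  qed
  then have u_pt: "\<not> joined w w' u (pt i)" for i
    using w(7) by (meson path_component_sym path_component_trans)
  have "\<not> joined w v x0 (pt i)" for i
  proof
    assume "joined w v x0 (pt i)"
    then have j: "joined w v (pt i) x0" by (rule path_component_sym)
    have pu: "m \<le> dist u (pt i)"
      using c avoid_\<xi>[of u i 1] by (auto simp: cut_pair_def fi_\<xi>)
    from first_contact_pair[OF j this this]
    have "path_component {z \<in> off w v. m \<le> dist u z} (pt i) x0 \<or>
      (\<exists>z\<in>off w v. dist u z = m \<and> path_component {z \<in> off w v. m \<le> dist u z} (pt i) z)" by simp
    then show False
    proof (elim disjE bexE conjE)
      assume "path_component {z \<in> off w v. m \<le> dist u z} (pt i) x0"
      then have "joined u v (pt i) x0"
        by (rule path_component_of_subset[rotated]) (auto simp: off_iff)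
      then show False using c path_component_sym by (fastforce simp: cut_pair_def)
    next
      fix z assume z: "z \<in> off w v" "dist u z = m" and pz: "path_component {z \<in> off w v. m \<le> dist u z} (pt i) z"
      let ?S = "{z \<in> off w v. m \<le> dist u z}"
      have "path_component_set ?S (pt i) \<subseteq> off w w'"
      proof
        fix y assume "y \<in> path_component_set ?S (pt i)"
        then have y: "path_component ?S (pt i) y" by simp
        then have "joined u v (pt i) y"
          by (rule path_component_of_subset[rotated]) (auto simp: off_iff)
        then have "\<not> joined u v x0 y" "y \<in> off u v"
          using c path_component_sym path_component_trans path_component_mem(2)
          unfolding cut_pair_def by blast+
        then show "y \<in> off w w'" using w' path_component_mem(2)[OF y] by (auto simp: off_iff)
      qed
      moreover have "path_component (path_component_set ?S (pt i)) (pt i) z"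
        using pz by (rule path_component_within_component)
      ultimately have "joined w w' (pt i) z" using path_component_of_subset by blast
      moreover have "joined w w' u z"
        by (rule joined_near[OF uv(1), where r = m]) (use z w m in \<open>simp_all add: off_iff\<close>)
      ultimately show False using u_pt by (meson path_component_sym path_component_trans)
    qed
  qed
  then show "cut_pair w v" using c w left by (auto simp: cut_pair_def)
  obtain T where T: "T \<in> {t..1}" "dist u (\<zeta> True T) = m" "\<forall>s\<in>{T..1}. \<zeta> True s \<in> off u v \<and> \<not> joined u v x0 (\<zeta> True s)"
    using cut_pair_tail_\<zeta>[OF c t] by blast
  have "\<exists>s\<in>{T..1}. dist w (\<zeta> True s) < m"
  proof (rule ccontr)
    assume no: "\<not> ?thesis"
    have "joined w w' (\<zeta> True T) (\<zeta> True 1)"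
    proof (rule path_component_along[OF continuous_on_subset[OF cont(1)], of T 1])
      show "\<zeta> True ` {T..1} \<subseteq> off w w'"
      proof (rule image_subsetI)
        fix s assume s: "s \<in> {T..1}"
        then have s01: "s \<in> {0..1}" using T(1) t(1) by simp
        have z: "\<zeta> True s \<in> off u v" "\<not> joined u v x0 (\<zeta> True s)" using T(3) s by blast+
        have "\<not> dist w (\<zeta> True s) < m" using no s by blast
        then show "\<zeta> True s \<in> off w w'" using w'[OF z] \<zeta>X[OF s01, of True] by (simp add: off_iff)
      qed
    qed (use T t in auto)
    moreover have "joined w w' u (\<zeta> True T)"
      by (rule joined_near[OF uv(1) \<zeta>X, where r = m]) (use T t w m in simp_all)
    ultimately show False using u_pt[of True] path_component_trans unfolding fi_\<zeta> by blast
  qed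
  then obtain s where s: "s \<in> {T..1}" "dist w (\<zeta> True s) < m" by blast
  have "2 * m \<le> dist (\<zeta> True t) (\<zeta> True s)"
    using dist_triangle[of u w "\<zeta> True t"] dist_triangle[of "\<zeta> True t" w "\<zeta> True s"] s(2) t(2) w(3)
    by (auto simp: dist_commute)
  then show "\<exists>s\<in>{t..1}. dist w (\<zeta> True s) < m \<and> 2 * m \<le> dist (\<zeta> True t) (\<zeta> True s)"
    using s T by (intro bexI[of _ s]) auto
qed

text \<open>By uniform continuity, a jump of a fixed length costs a fixed amount of time.\<close>

lemma time_gap:
  obtains e where "e > 0" "\<And>s t. s \<in> {0..1} \<Longrightarrow> t \<in> {0..1} \<Longrightarrow> 2 * m \<le> dist (\<zeta> True t) (\<zeta> True s) \<Longrightarrow> e \<le> \<bar>s - t\<bar>"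
proof -
  have "uniformly_continuous_on {0..1} (\<zeta> True)"
    by (rule compact_uniformly_continuous[OF cont(1)]) simp
  then obtain e where "e > 0" "\<forall>t\<in>{0..1}. \<forall>s\<in>{0..1}. dist s t < e \<longrightarrow> dist (\<zeta> True s) (\<zeta> True t) < 2 * m"
    unfolding uniformly_continuous_on_def using m by (metis mult_pos_pos zero_less_numeral)
  then show ?thesis using that[of e] by (force simp: dist_real_def dist_commute not_less)
qed

text \<open>
  The times at which \<open>\<zeta>\<close> and \<open>\<xi>\<close> visit the two balls are bounded by \<open>1\<close>, but every replacement increases one of
  them by a fixed amount.
\<close>

lemma no_cut_pair: "\<not> cut_pair u0 v0"
proof
  assume c0: "cut_pair u0 v0"
  interpret sw: theta_frame X m x0 pt \<xi> \<zeta> by (rule swapped)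
  obtain e1 where e1: "e1 > 0" "\<And>s t. s \<in> {0..1} \<Longrightarrow> t \<in> {0..1} \<Longrightarrow> 2 * m \<le> dist (\<zeta> True t) (\<zeta> True s) \<Longrightarrow> e1 \<le> \<bar>s - t\<bar>"
    using time_gap by blast
  obtain e2 where e2: "e2 > 0" "\<And>s t. s \<in> {0..1} \<Longrightarrow> t \<in> {0..1} \<Longrightarrow> 2 * m \<le> dist (\<xi> True t) (\<xi> True s) \<Longrightarrow> e2 \<le> \<bar>s - t\<bar>"
    using sw.time_gap by blast
  define e where "e = min e1 e2"
  have e: "e > 0" using e1 e2 by (simp add: e_def)
  define Z where "Z = {r. \<exists>u v t t'. cut_pair u v \<and> t \<in> {0..1} \<and> t' \<in> {0..1} \<and>
      dist u (\<zeta> True t) < m \<and> dist v (\<xi> True t') < m \<and> r = t + t'}"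
  have Zi: "t + t' \<in> Z" if "cut_pair u v" "t \<in> {0..1}" "t' \<in> {0..1}"
      "dist u (\<zeta> True t) < m" "dist v (\<xi> True t') < m" for u v t t'
    unfolding Z_def using that by blast
  have "Z \<noteq> {}"
    using c0 cut_pair_meets_\<zeta>[OF c0, of True] sw.cut_pair_meets_\<zeta>[of v0 u0 True]
    unfolding Z_def cut_pair_swapped by blast
  moreover have bdd: "bdd_above Z" by (rule bdd_aboveI[of _ 2]) (auto simp: Z_def)
  ultimately obtain r where r: "r \<in> Z" "Sup Z - e < r"
    using less_cSup_iff[of Z "Sup Z - e"] e by auto
  then obtain u v t t' where c: "cut_pair u v" and t: "t \<in> {0..1}" "t' \<in> {0..1}"
    "dist u (\<zeta> True t) < m" "dist v (\<xi> True t') < m" "r = t + t'" by (auto simp: Z_def)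
  have c': "sw.cut_pair v u" using c by (simp add: cut_pair_swapped)
  obtain w w' where w: "w \<in> X" "w' \<in> X" "4 * m \<le> dist u w" "4 * m \<le> dist v w" "4 * m \<le> dist u w'" "4 * m \<le> dist v w'"
    "\<not> joined w w' u v" "7 * m \<le> dist w x0"
    "\<forall>z\<in>off u v. \<not> joined u v x0 z \<longrightarrow> m \<le> dist w' z"
    "(\<forall>i. ball w m \<inter> path_image (\<xi> i) = {}) \<or> (\<forall>i. ball w m \<inter> path_image (\<zeta> i) = {})"
    by (rule cut_pair_blocker[OF c])
  from w(10) have "\<exists>r'\<in>Z. r + e \<le> r'"
  proof
    assume left: "\<forall>i. ball w m \<inter> path_image (\<xi> i) = {}"
    note rep = cut_pair_replace[OF c w(1-9) left t(1,3)]
    obtain s where s: "s \<in> {t..1}" "dist w (\<zeta> True s) < m" "2 * m \<le> dist (\<zeta> True t) (\<zeta> True s)"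
      using rep(2) by blast
    have "e1 \<le> \<bar>s - t\<bar>" by (rule e1(2)) (use s t in auto)
    then have "r + e \<le> s + t'" using s t by (auto simp: e_def)
    moreover have "s + t' \<in> Z"
      by (rule Zi[OF rep(1) _ t(2) s(2) t(4)]) (use s(1) t(1) in auto)
    ultimately show ?thesis by blast
  next
    assume right: "\<forall>i. ball w m \<inter> path_image (\<zeta> i) = {}"
    have w9: "\<forall>z\<in>off v u. \<not> joined v u x0 z \<longrightarrow> m \<le> dist w' z"
      using w(9) unfolding off_commute[of v u] .
    have w7: "\<not> joined w w' v u" using w(7) path_component_sym by blast
    note rep = sw.cut_pair_replace[OF c' w(1,2) w(4,3) w(6,5) w7 w(8) w9 right t(2,4)]
    obtain s where s: "s \<in> {t'..1}" "dist w (\<xi> True s) < m" "2 * m \<le> dist (\<xi> True t') (\<xi> True s)"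
      using rep(2) by blast
    have "e2 \<le> \<bar>s - t'\<bar>" by (rule e2(2)) (use s t in auto)
    then have "r + e \<le> t + s" using s t by (auto simp: e_def)
    moreover have "t + s \<in> Z"
      by (rule Zi[OF _ t(1) _ t(3) s(2)]) (use rep(1) s(1) t(2) in \<open>auto simp: cut_pair_swapped\<close>)
    ultimately show ?thesis by blast
  qed
  then show False using cSup_upper[OF _ bdd] r(2) by fastforce
qed

end

section \<open>Widening a separating pair along a geodesic\<close>

text \<open>
  Both ends of \<open>J\<close> belong to \<open>\<Omega>\<close>, so a pair of balls that separates a point of \<open>J\<close> from \<open>\<Omega>\<close> has to block \<open>J\<close> on
  both sides; a window records the times \<open>s\<close> and \<open>r\<close> of two such hits. The separation condition by itself gives
  narrow windows only. Wide ones arise by pinching the centres of a narrow window in turn.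
\<close>

locale pinched_geodesic = separated_space +
  fixes J :: "real \<Rightarrow> 'a" and \<eta> :: real and \<Omega> :: "'a set"
  assumes JX: "\<And>t. t \<in> {0..\<eta>} \<Longrightarrow> J t \<in> X"
    and iso: "\<And>s t. s \<in> {0..\<eta>} \<Longrightarrow> t \<in> {0..\<eta>} \<Longrightarrow> dist (J s) (J t) = \<bar>s - t\<bar>"
    and ends: "J 0 \<in> \<Omega>" "J \<eta> \<in> \<Omega>" and \<Omega>X: "\<Omega> \<subseteq> X"
    and far_\<Omega>: "\<And>t \<omega>. t \<in> {50 * m..\<eta> - 50 * m} \<Longrightarrow> \<omega> \<in> \<Omega> \<Longrightarrow> 5 * m \<le> dist \<omega> (J t)"
begin

definition sep :: "'a \<Rightarrow> 'a \<Rightarrow> 'a \<Rightarrow> bool" where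
  "sep a b z \<longleftrightarrow> (\<forall>\<omega>\<in>\<Omega>. \<not> joined a b z \<omega>)"

definition pinched :: "'a \<Rightarrow> bool" where
  "pinched z \<longleftrightarrow> (\<exists>a\<in>X. \<exists>b\<in>X. 4 * m \<le> dist z a \<and> 4 * m \<le> dist z b \<and> sep a b z)"

definition window :: "real \<Rightarrow> 'a \<Rightarrow> 'a \<Rightarrow> real \<Rightarrow> real \<Rightarrow> bool" where
  "window c u v s r \<longleftrightarrow> u \<in> X \<and> v \<in> X \<and> 0 \<le> s \<and> s \<le> c - 3 * m \<and> c + 3 * m \<le> r \<and> r \<le> \<eta> \<and>
     dist u (J s) < m \<and> dist v (J r) < m \<and> sep u v (J c)"

lemma sep_commute: "sep a b z = sep b a z"
  by (simp add: sep_def off_commute)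

lemma cont_J: "continuous_on {0..\<eta>} J"
  unfolding continuous_on_iff using iso by (metis abs_minus_commute dist_real_def)

lemma joined_J:
  assumes "0 \<le> s" "s \<le> t" "t \<le> \<eta>" "\<And>x. x \<in> {s..t} \<Longrightarrow> m \<le> dist a (J x) \<and> m \<le> dist b (J x)"
  shows "joined a b (J s) (J t)" "joined a b (J t) (J s)"
proof -
  have "J ` {s..t} \<subseteq> off a b" using assms JX by (auto simp: off_iff)
  moreover have "continuous_on {s..t} J" using assms by (auto intro: continuous_on_subset[OF cont_J])
  ultimately show "joined a b (J s) (J t)" "joined a b (J t) (J s)"
    using path_component_along[of s t J] assms by auto
qed

lemma rev: "pinched_geodesic X m (\<lambda>t. J (\<eta> - t)) \<eta> \<Omega>"
proof unfold_locales
  show "5 * m \<le> dist \<omega> (J (\<eta> - t))" if "t \<in> {50 * m..\<eta> - 50 * m}" "\<omega> \<in> \<Omega>" for t \<omega>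
    by (rule far_\<Omega>) (use that in auto)
qed (use JX iso ends \<Omega>X in auto)

lemma rev_window:
  assumes "window c u v s r"
  shows "pinched_geodesic.window X m (\<lambda>t. J (\<eta> - t)) \<eta> \<Omega> (\<eta> - c) v u (\<eta> - r) (\<eta> - s)"
  using assms unfolding pinched_geodesic.window_def[OF rev] window_def by (auto simp: sep_commute)

lemma rev_window_back:
  assumes "pinched_geodesic.window X m (\<lambda>t. J (\<eta> - t)) \<eta> \<Omega> (\<eta> - c) v u s r"
  shows "window c u v (\<eta> - r) (\<eta> - s)"
  using assms unfolding pinched_geodesic.window_def[OF rev] window_def by (auto simp: sep_commute)

text \<open>The initial part of the geodesic leads to \<open>\<Omega>\<close>, so one of the two balls has to block it.\<close>

lemma left_block:
  assumes z: "z \<in> X" "s \<in> {0..\<eta>}" "dist z (J s) < m"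
    and ab: "2 * m \<le> dist z a" "2 * m \<le> dist z b" "sep a b z"
  shows "\<exists>x\<in>{0..s}. dist a (J x) < m \<or> dist b (J x) < m"
proof (rule ccontr)
  assume "\<not> ?thesis"
  then have "joined a b (J s) (J 0)" using z(2) by (intro joined_J(2)) (auto simp: not_less)
  moreover have "joined a b z (J s)"
    by (rule joined_near[where r = m]) (use z ab JX in auto)
  ultimately have "joined a b z (J 0)" by (rule path_component_trans[rotated])
  then show False using ab(3) ends by (auto simp: sep_def)
qed

lemma right_block:
  assumes z: "z \<in> X" "s \<in> {0..\<eta>}" "dist z (J s) < m"
    and ab: "2 * m \<le> dist z a" "2 * m \<le> dist z b" "sep a b z"
  shows "\<exists>x\<in>{s..\<eta>}. dist a (J x) < m \<or> dist b (J x) < m"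
proof -
  interpret rv: pinched_geodesic X m "\<lambda>t. J (\<eta> - t)" \<eta> \<Omega> by (rule rev)
  have "\<exists>x\<in>{0..\<eta> - s}. dist a (J (\<eta> - x)) < m \<or> dist b (J (\<eta> - x)) < m"
    using rv.left_block[of z "\<eta> - s" a b] assms by auto
  then obtain x where "x \<in> {0..\<eta> - s}" "dist a (J (\<eta> - x)) < m \<or> dist b (J (\<eta> - x)) < m" by blast
  then show ?thesis using z(2) by (intro bexI[of _ "\<eta> - x"]) auto
qed

lemma hits_apart:
  assumes "dist u (J s) < m" "dist a (J x) < m" "s \<in> {0..\<eta>}" "x \<in> {0..\<eta>}" "k * m \<le> dist u a"
  shows "(k - 2) * m < \<bar>s - x\<bar>"
  using dist_triangle[of u a "J s"] dist_triangle[of "J s" a "J x"] iso[OF assms(3,4)] assms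
  by (simp add: dist_commute algebra_simps)

lemma hits_close:
  assumes "dist a (J s) < m" "dist a (J x) < m" "s \<in> {0..\<eta>}" "x \<in> {0..\<eta>}"
  shows "\<bar>s - x\<bar> < 2 * m"
  using dist_triangle[of "J s" "J x" a] iso[OF assms(3,4)] assms by (simp add: dist_commute)

lemma dist_J_ge:
  assumes "dist u (J s) < m" "s \<in> {0..\<eta>}" "x \<in> {0..\<eta>}" shows "\<bar>s - x\<bar> - m \<le> dist u (J x)"
  using dist_triangle[of "J s" "J x" u] iso[OF assms(2,3)] assms(1) by (simp add: dist_commute)

lemma far_from_\<Omega>:
  assumes "dist u (J s) < m" "s \<in> {50 * m..\<eta> - 50 * m}" "\<omega> \<in> \<Omega>" shows "4 * m \<le> dist u \<omega>"
  using far_\<Omega>[OF assms(2,3)] dist_triangle[of \<omega> "J s" u] assms(1) by (simp add: dist_commute)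

text \<open>
  If the pair that pinches \<open>u\<close> stays away from \<open>v\<close>, it either encloses \<open>v\<close> as well, or one of its balls
  lies between \<open>u\<close> and \<open>v\<close> and the other one can replace \<open>u\<close>.
\<close>

lemma widen_one_side:
  assumes win: "window c u v s r" and sr: "50 * m \<le> s" "r \<le> \<eta> - 50 * m"
    and a: "a1 \<in> X" "a2 \<in> X" "4 * m \<le> dist u a1" "4 * m \<le> dist u a2" "sep a1 a2 u"
      "2 * m \<le> dist v a1" "2 * m \<le> dist v a2"
  shows "\<exists>u' v' s' r'. window c u' v' s' r' \<and> r - s + 2 * m \<le> r' - s'"
proof -
  have W: "u \<in> X" "v \<in> X" "0 \<le> s" "s \<le> c - 3 * m" "c + 3 * m \<le> r" "r \<le> \<eta>"
    "dist u (J s) < m" "dist v (J r) < m" "sep u v (J c)" using win by (auto simp: window_def)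
  have I: "s \<in> {0..\<eta>}" "r \<in> {0..\<eta>}" "c \<in> {0..\<eta>}" using W m by auto
  have \<omega>u: "m \<le> dist u \<omega>" and \<omega>v: "m \<le> dist v \<omega>" if "\<omega> \<in> \<Omega>" for \<omega>
    using far_from_\<Omega>[OF W(7) _ that] far_from_\<Omega>[OF W(8) _ that] W sr m by auto
  have u_z: "joined a1 a2 u z" if "z \<in> X" "dist u z = m" for z
    by (rule joined_near[where r = m]) (use that W a m in simp_all)
  obtain x where x: "x \<in> {0..s}" "dist a1 (J x) < m \<or> dist a2 (J x) < m"
    using left_block[OF W(1) I(1) W(7), of a1 a2] a m by auto
  have xs: "x < s - 2 * m" if "dist a (J x) < m" "a \<in> {a1, a2}" for a
  proof -
    have "4 * m \<le> dist u a" using a that by auto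
    from hits_apart[OF W(7) that(1) I(1) _ this] show ?thesis using x W m by auto
  qed
  show ?thesis
  proof (cases "sep a1 a2 v")
    case True
    obtain y where y: "y \<in> {r..\<eta>}" "dist a1 (J y) < m \<or> dist a2 (J y) < m"
      using right_block[OF W(2) I(2) W(8), of a1 a2] a True by auto
    have ne: "\<not> (dist a (J x) < m \<and> dist a (J y) < m)" for a
      using hits_close[of a x y] x y W m by auto
    \<comment> \<open>Any path from \<open>\<Omega>\<close> to \<open>J c\<close> touches the ball around \<open>u\<close> or \<open>v\<close>, and both are cut off.\<close>
    have S: "sep a1 a2 (J c)"
      unfolding sep_def
    proof (intro ballI notI)
      fix \<omega> assume \<omega>: "\<omega> \<in> \<Omega>" "joined a1 a2 (J c) \<omega>"
      then have j: "joined a1 a2 \<omega> (J c)" by (blast intro: path_component_sym)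
      let ?S = "{z \<in> off a1 a2. m \<le> dist u z \<and> m \<le> dist v z}"
      have sub: "?S \<subseteq> off u v" "?S \<subseteq> off a1 a2" by (auto simp: off_iff)
      from first_contact_pair[OF j \<omega>u[OF \<omega>(1)] \<omega>v[OF \<omega>(1)]]
      show False
      proof (elim disjE bexE conjE)
        assume "path_component ?S \<omega> (J c)"
        then have "joined u v \<omega> (J c)" using path_component_of_subset[OF sub(1)] by blast
        then show False using W(9) \<omega>(1) path_component_sym unfolding sep_def by blast
      next
        fix z assume z: "z \<in> off a1 a2" "dist u z = m" "path_component ?S \<omega> z"
        then have "joined a1 a2 \<omega> z" using path_component_of_subset[OF sub(2)] by blast
        moreover have "joined a1 a2 u z" using u_z z by (simp add: off_iff)
        ultimately have "joined a1 a2 u \<omega>" by (meson path_component_sym path_component_trans)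
        then show False using a(5) \<omega>(1) by (simp add: sep_def)
      next
        fix z assume z: "z \<in> off a1 a2" "dist v z = m" "path_component ?S \<omega> z"
        then have "joined a1 a2 \<omega> z" using path_component_of_subset[OF sub(2)] by blast
        moreover have "joined a1 a2 v z"
          by (rule joined_near[where r = m]) (use z W a m in \<open>simp_all add: off_iff\<close>)
        ultimately have "joined a1 a2 v \<omega>" by (meson path_component_sym path_component_trans)
        then show False using True \<omega>(1) by (simp add: sep_def)
      qed
    qed
    have "\<exists>u' v'. u' \<in> {a1, a2} \<and> v' \<in> {a1, a2} \<and> dist u' (J x) < m \<and> dist v' (J y) < m \<and> sep u' v' (J c)"
      using x y ne S sep_commute by blast
    then obtain u' v' where uv': "u' \<in> {a1, a2}" "v' \<in> {a1, a2}" "dist u' (J x) < m" "dist v' (J y) < m"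
      "sep u' v' (J c)" by blast
    have "x < s - 2 * m" by (rule xs[OF uv'(3,1)])
    moreover from this have "window c u' v' x y"
      using uv' a W x y m unfolding window_def by auto
    ultimately show ?thesis using y by (intro exI[of _ u'] exI[of _ v'] exI[of _ x] exI[of _ y]) auto
  next
    case False
    then obtain \<omega>0 where \<omega>0: "\<omega>0 \<in> \<Omega>" "joined a1 a2 v \<omega>0" by (auto simp: sep_def)
    \<comment> \<open>If the stretch of \<open>J\<close> between the two balls avoided \<open>a1\<close> and \<open>a2\<close>, it would join \<open>u\<close> via \<open>v\<close> to \<open>\<Omega>\<close>.\<close>
    have duc: "m \<le> dist u (J x)" if "x \<in> {c..r}" for x using dist_J_ge[OF W(7) I(1), of x] that W I m by auto
    have dvc: "m \<le> dist v (J x)" if "x \<in> {0..c}" for x using dist_J_ge[OF W(8) I(2), of x] that W I m by auto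
    obtain p where p: "p \<in> {s..c}" "dist u (J p) = m" "\<forall>x\<in>{p..c}. m \<le> dist u (J x)"
    proof -
      have "continuous_on {s..c} (\<lambda>x. dist u (J x))"
        using I by (auto intro!: continuous_intros continuous_on_subset[OF cont_J])
      from last_crossing[OF this, of m] show ?thesis using that W duc[of c] m by auto
    qed
    obtain q where q: "q \<in> {c..r}" "dist v (J q) = m" "\<forall>x\<in>{c..q}. m \<le> dist v (J x)"
    proof -
      have "continuous_on {c..r} (\<lambda>x. dist v (J x))"
        using I by (auto intro!: continuous_intros continuous_on_subset[OF cont_J])
      from first_crossing[OF this, of m] show ?thesis using that W dvc[of c] I m by auto
    qed
    have offpq: "m \<le> dist u (J x) \<and> m \<le> dist v (J x)" if "x \<in> {p..q}" for x
    proof (cases "x \<le> c")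
      case True
      then show ?thesis using that p(1,3) dvc[of x] W(3) by simp
    next
      case False
      then show ?thesis using that q(1,3) duc[of x] by simp
    qed
    have comp: "joined u v (J c) (J x)" if "x \<in> {p..q}" for x
    proof (cases "x \<le> c")
      case True
      then show ?thesis using that p(1) q(1) I by (intro joined_J(2) offpq) simp_all
    next
      case False
      then show ?thesis using that p(1) q(1) I by (intro joined_J(1) offpq) simp_all
    qed
    have "\<exists>x\<in>{p..q}. dist a1 (J x) < m \<or> dist a2 (J x) < m"
    proof (rule ccontr)
      assume "\<not> ?thesis"
      then have "joined a1 a2 (J p) (J q)" using p(1) q(1) I by (intro joined_J(1)) (simp_all add: not_less)
      moreover have "joined a1 a2 u (J p)" using u_z[OF JX p(2)] p(1) I by simp
      moreover have "joined a1 a2 v (J q)"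
        by (rule joined_near[where r = m]) (use q(1,2) W a m JX[of q] I in simp_all)
      ultimately have "joined a1 a2 u \<omega>0" using \<omega>0 by (meson path_component_sym path_component_trans)
      then show False using a(5) \<omega>0 by (simp add: sep_def)
    qed
    then obtain x1 b a' where x1: "x1 \<in> {p..q}" "dist b (J x1) < m" "{b, a'} = {a1, a2}" by blast
    then have b: "b \<in> X" "a' \<in> X" "4 * m \<le> dist u b" "4 * m \<le> dist u a'" "2 * m \<le> dist v b" "2 * m \<le> dist v a'"
      "off a1 a2 = off b a'"
      using a off_commute by (auto simp: doubleton_eq_iff)
    have inC: "joined u v (J c) z" if z: "z \<in> X" "dist b z < m" for z
    proof -
      have "joined u v (J x1) z"
        by (rule joined_ball[of b]) (use b z x1 m p(1) q(1) I JX[of x1] in \<open>simp_all add: dist_commute\<close>)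
      then show ?thesis using comp[OF x1(1)] path_component_trans by blast
    qed
    \<comment> \<open>The ball around \<open>b\<close> lies in the component of \<open>J c\<close>, so it cannot also block the way to \<open>J 0\<close>.\<close>
    have nb: "\<not> dist b (J x) < m"
    proof
      assume bx: "dist b (J x) < m"
      have "3 * m < dist u (J x)" using dist_triangle[of u b "J x"] bx b by (simp add: dist_commute)
      moreover have "x \<in> {0..\<eta>}" using x I by auto
      ultimately have far: "m \<le> dist u (J y)" if y: "y \<in> {0..x}" for y
      proof -
        have "dist u (J x) \<le> dist u (J s) + (s - x)"
          using dist_triangle[of u "J x" "J s"] iso[of s x] x I by auto
        moreover have "dist u (J x) \<le> dist u (J y) + (x - y)"
          using dist_triangle[of u "J x" "J y"] iso[of y x] x y I by auto
        moreover have "s - y - m \<le> dist u (J y)" using dist_J_ge[OF W(7) I(1), of y] x y I by auto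
        ultimately show ?thesis using \<open>3 * m < dist u (J x)\<close> W(7) m by linarith
      qed
      have "joined u v (J x) (J 0)"
        by (rule joined_J(2)) (use x I W m far dvc in auto)
      moreover have "joined u v (J c) (J x)" using inC bx JX x I by auto
      ultimately have "joined u v (J c) (J 0)" using path_component_trans by blast
      then show False using W(9) ends by (simp add: sep_def)
    qed
    then have a'x: "dist a' (J x) < m" using x(2) x1(3) by (auto simp: doubleton_eq_iff)
    have xs': "x < s - 2 * m" by (rule xs[OF a'x]) (use x1(3) in auto)
    have "sep a' v (J c)"
      unfolding sep_def
    proof (intro ballI notI)
      fix \<omega> assume \<omega>: "\<omega> \<in> \<Omega>" "joined a' v (J c) \<omega>"
      then have j: "joined a' v \<omega> (J c)" by (blast intro: path_component_sym)
      let ?S = "{z \<in> off a' v. m \<le> dist u z \<and> m \<le> dist u z}"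
      have sub: "?S \<subseteq> off u v" by (auto simp: off_iff)
      have no: "\<not> path_component ?S \<omega> z" if "joined u v (J c) z" for z
      proof
        assume "path_component ?S \<omega> z"
        then have "joined u v \<omega> z" using path_component_of_subset[OF sub] by blast
        then have "joined u v (J c) \<omega>" using that by (meson path_component_sym path_component_trans)
        then show False using W(9) \<omega>(1) by (simp add: sep_def)
      qed
      from first_contact_pair[OF j \<omega>u[OF \<omega>(1)] \<omega>u[OF \<omega>(1)]] no[of "J c"] comp[of c] p(1) q(1)
      obtain z where z: "z \<in> off a' v" "dist u z = m" "path_component ?S \<omega> z" by auto
      have "path_component_set ?S \<omega> \<subseteq> off a1 a2"
      proof
        fix y assume "y \<in> path_component_set ?S \<omega>"
        then have y: "path_component ?S \<omega> y" by simp
        then have "y \<in> ?S" by (rule path_component_mem(2))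
        moreover have "\<not> dist b y < m" using no[of y] inC[of y] y \<open>y \<in> ?S\<close> by (auto simp: off_iff)
        ultimately show "y \<in> off a1 a2" unfolding b(7) by (simp add: off_iff)
      qed
      from path_component_of_subset[OF this path_component_within_component[OF z(3)]]
      have "joined a1 a2 \<omega> z" .
      moreover have "joined a1 a2 u z" using u_z z by (simp add: off_iff)
      ultimately have "joined a1 a2 u \<omega>" by (meson path_component_sym path_component_trans)
      then show False using a(5) \<omega>(1) by (simp add: sep_def)
    qed
    then have "window c a' v x r" using W b a'x x xs' m by (auto simp: window_def)
    then show ?thesis using xs' by (intro exI[of _ a'] exI[of _ v] exI[of _ x] exI[of _ r]) auto
  qed
qed

text \<open>
  If each of the two pinching pairs has a ball close to the other centre, then the remaining two balls
  enclose the balls of radius \<open>3m\<close> around \<open>u\<close> and \<open>v\<close>, which swallow the first two.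
\<close>

lemma widen_both_sides:
  assumes win: "window c u v s r" and sr: "50 * m \<le> s" "r \<le> \<eta> - 50 * m"
    and a: "a \<in> X" "a' \<in> X" "4 * m \<le> dist u a" "4 * m \<le> dist u a'" "sep a a' u" "dist v a < 2 * m"
    and b: "b \<in> X" "b' \<in> X" "4 * m \<le> dist v b" "4 * m \<le> dist v b'" "sep b b' v" "dist u b < 2 * m"
  shows "\<exists>u' v' s' r'. window c u' v' s' r' \<and> r - s + 2 * m \<le> r' - s'"
proof -
  have W: "u \<in> X" "v \<in> X" "0 \<le> s" "s \<le> c - 3 * m" "c + 3 * m \<le> r" "r \<le> \<eta>"
    "dist u (J s) < m" "dist v (J r) < m" "sep u v (J c)" using win by (auto simp: window_def)
  have I: "s \<in> {0..\<eta>}" "r \<in> {0..\<eta>}" "c \<in> {0..\<eta>}" using W m by auto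
  have \<omega>u: "3 * m \<le> dist u \<omega>" and \<omega>v: "3 * m \<le> dist v \<omega>" if "\<omega> \<in> \<Omega>" for \<omega>
    using far_from_\<Omega>[OF W(7) _ that] far_from_\<Omega>[OF W(8) _ that] W sr m by auto
  obtain x where x: "x \<in> {0..s}" "dist a (J x) < m \<or> dist a' (J x) < m"
    using left_block[OF W(1) I(1) W(7), of a a'] a m by auto
  have "\<not> dist a (J x) < m"
    using dist_triangle[of v "J x" a] a(6) dist_J_ge[OF W(8) I(2), of x] x I W m by auto
  then have ax: "dist a' (J x) < m" using x by blast
  obtain y where y: "y \<in> {r..\<eta>}" "dist b (J y) < m \<or> dist b' (J y) < m"
    using right_block[OF W(2) I(2) W(8), of b b'] b m by auto
  have "\<not> dist b (J y) < m"
    using dist_triangle[of u "J y" b] b(6) dist_J_ge[OF W(7) I(1), of y] y I W m by auto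
  then have "by": "dist b' (J y) < m" using y by blast
  have xs: "x < s - 2 * m" using hits_apart[OF W(7) ax I(1) _ a(4)] x I by auto
  have yr: "r + 2 * m < y" using hits_apart[OF W(8) "by" I(2) _ b(4)] y I by auto
  have "sep a' b' (J c)"
    unfolding sep_def
  proof (intro ballI notI)
    fix \<omega> assume \<omega>: "\<omega> \<in> \<Omega>" "joined a' b' (J c) \<omega>"
    then have j: "joined a' b' \<omega> (J c)" by (blast intro: path_component_sym)
    let ?S = "{z \<in> off a' b'. 3 * m \<le> dist u z \<and> 3 * m \<le> dist v z}"
    have sub: "?S \<subseteq> off u v" using m by (auto simp: off_iff)
    have suba: "?S \<subseteq> off a a'"
    proof
      fix z assume "z \<in> ?S"
      then show "z \<in> off a a'" using dist_triangle[of v z a] a(6) by (auto simp: off_iff)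
    qed
    have subb: "?S \<subseteq> off b b'"
    proof
      fix z assume "z \<in> ?S"
      then show "z \<in> off b b'" using dist_triangle[of u z b] b(6) by (auto simp: off_iff)
    qed
    from first_contact_pair[OF j \<omega>u[OF \<omega>(1)] \<omega>v[OF \<omega>(1)]]
    show False
    proof (elim disjE bexE conjE)
      assume "path_component ?S \<omega> (J c)"
      then have "joined u v \<omega> (J c)" using path_component_of_subset[OF sub] by blast
      then show False using W(9) \<omega>(1) path_component_sym unfolding sep_def by blast
    next
      fix z assume z: "z \<in> off a' b'" "dist u z = 3 * m" "path_component ?S \<omega> z"
      then have "joined a a' \<omega> z" using path_component_of_subset[OF suba] by blast
      moreover have "joined a a' u z"
        by (rule joined_near[where r = "3 * m"]) (use z W a in \<open>simp_all add: off_iff\<close>)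
      ultimately have "joined a a' u \<omega>" by (meson path_component_sym path_component_trans)
      then show False using a(5) \<omega>(1) by (simp add: sep_def)
    next
      fix z assume z: "z \<in> off a' b'" "dist v z = 3 * m" "path_component ?S \<omega> z"
      then have "joined b b' \<omega> z" using path_component_of_subset[OF subb] by blast
      moreover have "joined b b' v z"
        by (rule joined_near[where r = "3 * m"]) (use z W b in \<open>simp_all add: off_iff\<close>)
      ultimately have "joined b b' v \<omega>" by (meson path_component_sym path_component_trans)
      then show False using b(5) \<omega>(1) by (simp add: sep_def)
    qed
  qed
  then have "window c a' b' x y" using W a b ax "by" x y xs yr m by (auto simp: window_def)
  then show ?thesis using xs yr m by (intro exI[of _ a'] exI[of _ b'] exI[of _ x] exI[of _ y]) auto
qed

lemma widen:
  assumes win: "window c u v s r" and sr: "50 * m \<le> s" "r \<le> \<eta> - 50 * m"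
    and pin: "pinched u" "pinched v"
  shows "\<exists>u' v' s' r'. window c u' v' s' r' \<and> r - s + 2 * m \<le> r' - s'"
proof -
  obtain a1 a2 where a: "a1 \<in> X" "a2 \<in> X" "4 * m \<le> dist u a1" "4 * m \<le> dist u a2" "sep a1 a2 u"
    using pin(1) by (auto simp: pinched_def)
  obtain b1 b2 where b: "b1 \<in> X" "b2 \<in> X" "4 * m \<le> dist v b1" "4 * m \<le> dist v b2" "sep b1 b2 v"
    using pin(2) by (auto simp: pinched_def)
  consider "2 * m \<le> dist v a1" "2 * m \<le> dist v a2" | "2 * m \<le> dist u b1" "2 * m \<le> dist u b2"
    | "dist v a1 < 2 * m \<or> dist v a2 < 2 * m" "dist u b1 < 2 * m \<or> dist u b2 < 2 * m"
    by linarith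
  then show ?thesis
  proof cases
    case 1
    then show ?thesis using widen_one_side[OF win sr a] by blast
  next
    case 2
    interpret rv: pinched_geodesic X m "\<lambda>t. J (\<eta> - t)" \<eta> \<Omega> by (rule rev)
    obtain u' v' s' r' where "rv.window (\<eta> - c) v' u' s' r'" "(\<eta> - s) - (\<eta> - r) + 2 * m \<le> r' - s'"
      using rv.widen_one_side[OF rev_window[OF win], of b1 b2] sr b 2 by auto
    then have "window c u' v' (\<eta> - r') (\<eta> - s')" "r - s + 2 * m \<le> (\<eta> - s') - (\<eta> - r')"
      using rev_window_back by auto
    then show ?thesis by blast
  next
    case 3
    obtain a a' where a': "a \<in> X" "a' \<in> X" "4 * m \<le> dist u a" "4 * m \<le> dist u a'" "sep a a' u" "dist v a < 2 * m"
      using 3(1) a sep_commute by blast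
    obtain b b' where b': "b \<in> X" "b' \<in> X" "4 * m \<le> dist v b" "4 * m \<le> dist v b'" "sep b b' v" "dist u b < 2 * m"
      using 3(2) b sep_commute by blast
    show ?thesis by (rule widen_both_sides[OF win sr a' b'])
  qed
qed

text \<open>Widening gains at least \<open>2m\<close> each time, so the widths of the windows around \<open>J c\<close> cannot stay below \<open>24m\<close>.\<close>

lemma wide_window:
  assumes c: "80 * m \<le> c" "c \<le> \<eta> - 80 * m"
    and pin: "\<And>z t. z \<in> X \<Longrightarrow> t \<in> {c - 30 * m..c + 30 * m} \<Longrightarrow> dist z (J t) < m \<Longrightarrow> pinched z"
  shows "\<exists>u v s r. window c u v s r \<and> 24 * m \<le> r - s"
proof (rule ccontr)
  assume no: "\<not> ?thesis"
  have I: "c \<in> {0..\<eta>}" using c m by auto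
  define Z where "Z = {r - s | u v s r. window c u v s r}"
  have "pinched (J c)" using pin[of "J c" c] JX[OF I] m by auto
  then obtain a b where ab: "a \<in> X" "b \<in> X" "4 * m \<le> dist (J c) a" "4 * m \<le> dist (J c) b" "sep a b (J c)"
    by (auto simp: pinched_def)
  obtain x where x: "x \<in> {0..c}" "dist a (J x) < m \<or> dist b (J x) < m"
    using left_block[OF JX[OF I] I, of a b] ab m by auto
  obtain y where y: "y \<in> {c..\<eta>}" "dist a (J y) < m \<or> dist b (J y) < m"
    using right_block[OF JX[OF I] I, of a b] ab m by auto
  have far: "3 * m < \<bar>c - t\<bar>" if "t \<in> {0..\<eta>}" "e \<in> {a, b}" "dist e (J t) < m" for e t
    using that ab iso[OF I that(1)] dist_triangle[of "J c" e "J t"] by (auto simp: dist_commute)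
  have xc: "x < c - 3 * m" using x far[of x a] far[of x b] I by auto
  have yc: "c + 3 * m < y" using y far[of y a] far[of y b] I by auto
  have "\<not> (dist e (J x) < m \<and> dist e (J y) < m)" for e
    using hits_close[of e x y] x y xc yc I m by auto
  then have "\<exists>u v. u \<in> X \<and> v \<in> X \<and> dist u (J x) < m \<and> dist v (J y) < m \<and> sep u v (J c)"
    using x(2) y(2) ab sep_commute by blast
  then obtain u v where "u \<in> X" "v \<in> X" "dist u (J x) < m" "dist v (J y) < m" "sep u v (J c)" by blast
  then have "window c u v x y" using x y xc yc by (auto simp: window_def)
  then have "Z \<noteq> {}" by (auto simp: Z_def)
  moreover have bdd: "bdd_above Z"
    using no by (intro bdd_aboveI[of _ "24 * m"]) (force simp: Z_def not_le)
  ultimately obtain w where w: "w \<in> Z" "Sup Z - m < w"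
    using less_cSup_iff[of Z "Sup Z - m"] m by auto
  then obtain u v s r where win: "window c u v s r" "w = r - s" by (auto simp: Z_def)
  have "r - s < 24 * m" using no win(1) by force
  moreover have W: "u \<in> X" "v \<in> X" "s \<le> c - 3 * m" "c + 3 * m \<le> r" "dist u (J s) < m" "dist v (J r) < m"
    using win(1) by (auto simp: window_def)
  ultimately have sr: "c - 30 * m \<le> s" "r \<le> c + 30 * m" using m by auto
  have "pinched u" by (rule pin[OF W(1) _ W(5)]) (use sr W m in auto)
  moreover have "pinched v" by (rule pin[OF W(2) _ W(6)]) (use sr W m in auto)
  ultimately obtain u' v' s' r' where "window c u' v' s' r'" "r - s + 2 * m \<le> r' - s'"
    using widen[OF win(1)] sr c by force
  then have "r' - s' \<in> Z" "w + 2 * m \<le> r' - s'" using win(2) by (auto simp: Z_def)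
  then show False using cSup_upper[OF _ bdd] w(2) m by fastforce
qed

end

section \<open>Three long gaps between two path connected sets\<close>

text \<open>
  The normal form of a very fat theta curve: \<open>L\<close> and \<open>R\<close> surround its vertices, and its arms have been
  cut down to geodesics that realise the distance from \<open>L\<close> to \<open>R\<close>. The arm \<open>J 0\<close> is singled out; \<open>J 1\<close> and \<open>J 2\<close> are the two
  ways around. A stem is one of the two parts of \<open>L \<union> J 0 \<union> R\<close> cut at the point \<open>J 0 c\<close>.
\<close>

locale three_gaps = separated_space +
  fixes L R :: "'a set" and J :: "nat \<Rightarrow> real \<Rightarrow> 'a" and \<eta> :: real
  assumes LX: "L \<subseteq> X" and RX: "R \<subseteq> X" and pcL: "path_connected L" and pcR: "path_connected R"
    and JX: "\<And>i t. i < 3 \<Longrightarrow> t \<in> {0..\<eta>} \<Longrightarrow> J i t \<in> X"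
    and iso: "\<And>i s t. i < 3 \<Longrightarrow> s \<in> {0..\<eta>} \<Longrightarrow> t \<in> {0..\<eta>} \<Longrightarrow> dist (J i s) (J i t) = \<bar>s - t\<bar>"
    and JL: "\<And>i. i < 3 \<Longrightarrow> J i 0 \<in> L" and JR: "\<And>i. i < 3 \<Longrightarrow> J i \<eta> \<in> R"
    and dL: "\<And>i t l. i < 3 \<Longrightarrow> t \<in> {0..\<eta>} \<Longrightarrow> l \<in> L \<Longrightarrow> t \<le> dist (J i t) l"
    and dR: "\<And>i t r. i < 3 \<Longrightarrow> t \<in> {0..\<eta>} \<Longrightarrow> r \<in> R \<Longrightarrow> \<eta> - t \<le> dist (J i t) r"
    and dLR: "\<And>l r. l \<in> L \<Longrightarrow> r \<in> R \<Longrightarrow> \<eta> \<le> dist l r"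
    and dJ: "\<And>i j s t. i < 3 \<Longrightarrow> j < 3 \<Longrightarrow> i \<noteq> j \<Longrightarrow> s \<in> {0..\<eta>} \<Longrightarrow> t \<in> {0..\<eta>} \<Longrightarrow> 5 * m \<le> dist (J i s) (J j t)"
    and long: "300 * m \<le> \<eta>"
begin

lemma cont_J: "i < 3 \<Longrightarrow> continuous_on {0..\<eta>} (J i)"
  unfolding continuous_on_iff using iso by (metis abs_minus_commute dist_real_def)

lemma path_component_J:
  assumes "i < 3" "0 \<le> a" "b \<le> \<eta>" "J i ` {a..b} \<subseteq> S" "s \<in> {a..b}" "t \<in> {a..b}"
  shows "path_component S (J i s) (J i t)"
  by (rule path_component_along[OF continuous_on_subset[OF cont_J[OF assms(1)]] assms(4-6)]) (use assms in auto)

lemma rev: "three_gaps X m R L (\<lambda>i t. J i (\<eta> - t)) \<eta>"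
proof unfold_locales
  show "5 * m \<le> dist (J i (\<eta> - s)) (J j (\<eta> - t))"
    if "i < 3" "j < 3" "i \<noteq> j" "s \<in> {0..\<eta>}" "t \<in> {0..\<eta>}" for i j s t
    by (rule dJ) (use that in auto)
  show "t \<le> dist (J i (\<eta> - t)) r" if "i < 3" "t \<in> {0..\<eta>}" "r \<in> R" for i t r
    using dR[of i "\<eta> - t" r] that by auto
  show "\<eta> - t \<le> dist (J i (\<eta> - t)) l" if "i < 3" "t \<in> {0..\<eta>}" "l \<in> L" for i t l
    using dL[of i "\<eta> - t" l] that by auto
  show "\<eta> \<le> dist r l" if "r \<in> R" "l \<in> L" for r l using dLR[OF that(2,1)] by (simp add: dist_commute)
qed (use LX RX pcL pcR JX iso JL JR long in auto)

definition left_stem :: "real \<Rightarrow> 'a set" where "left_stem c = J 0 ` {0..c} \<union> L"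
definition right_stem :: "real \<Rightarrow> 'a set" where "right_stem c = J 0 ` {c..\<eta>} \<union> R"

definition left_side :: "real \<Rightarrow> nat \<Rightarrow> 'a set" where "left_side c i = left_stem c \<union> J i ` {0..\<eta>/2}"
definition right_side :: "real \<Rightarrow> nat \<Rightarrow> 'a set" where "right_side c i = right_stem c \<union> J i ` {\<eta>/2..\<eta>}"

lemma \<eta>_pos: "0 < \<eta>" "20 * m \<le> \<eta> / 2" using long m by auto

lemma left_side_path:
  assumes "c \<in> {0..\<eta>}" "i < 3"
  shows "path_component (left_side c i) (J 0 c) (J i (\<eta>/2))"
proof -
  let ?S = "left_side c i"
  have "path_component ?S (J 0 c) (J 0 0)"
    using assms by (intro path_component_J[of 0 0 c]) (auto simp: left_side_def left_stem_def)
  moreover have "path_component L (J 0 0) (J i 0)" using pcL JL assms by (auto simp: path_connected_component)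
  then have "path_component ?S (J 0 0) (J i 0)"
    by (rule path_component_of_subset[rotated]) (auto simp: left_side_def left_stem_def)
  moreover have "path_component ?S (J i 0) (J i (\<eta>/2))"
    using assms \<eta>_pos by (intro path_component_J[of i 0 "\<eta>/2"]) (auto simp: left_side_def)
  ultimately show ?thesis by (meson path_component_trans)
qed

lemma left_side_X: "c \<in> {0..\<eta>} \<Longrightarrow> i < 3 \<Longrightarrow> left_side c i \<subseteq> X"
  using LX JX \<eta>_pos by (auto simp: left_side_def left_stem_def)

lemma image_rev: "(\<lambda>t. J i (\<eta> - t)) ` {a..b} = J i ` {\<eta> - b..\<eta> - a}"
proof -
  have "x \<in> (\<lambda>t. \<eta> - t) ` {a..b}" if "x \<in> {\<eta> - b..\<eta> - a}" for x
    using that by (intro image_eqI[of _ _ "\<eta> - x"]) auto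
  then have "(\<lambda>t. \<eta> - t) ` {a..b} = {\<eta> - b..\<eta> - a}" by auto
  then show ?thesis by (metis image_image)
qed

lemma right_side_path:
  assumes "c \<in> {0..\<eta>}" "i < 3"
  shows "path_component (right_side c i) (J 0 c) (J i (\<eta>/2))"
proof -
  let ?S = "right_side c i"
  have "path_component ?S (J 0 c) (J 0 \<eta>)"
    using assms by (intro path_component_J[of 0 c \<eta>]) (auto simp: right_side_def right_stem_def)
  moreover have "path_component R (J 0 \<eta>) (J i \<eta>)" using pcR JR assms by (auto simp: path_connected_component)
  then have "path_component ?S (J 0 \<eta>) (J i \<eta>)"
    by (rule path_component_of_subset[rotated]) (auto simp: right_side_def right_stem_def)
  moreover have "path_component ?S (J i \<eta>) (J i (\<eta>/2))"
    using assms \<eta>_pos by (intro path_component_J[of i "\<eta>/2" \<eta>]) (auto simp: right_side_def)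
  ultimately show ?thesis by (meson path_component_trans)
qed

lemma right_side_X: "c \<in> {0..\<eta>} \<Longrightarrow> i < 3 \<Longrightarrow> right_side c i \<subseteq> X"
  using RX JX \<eta>_pos by (auto simp: right_side_def right_stem_def)

lemma stems_far:
  assumes c: "c \<in> {20 * m..\<eta> - 20 * m}"
    and h: "h \<in> left_stem c" "6 * m < dist h (J 0 c)" and z: "z \<in> right_stem c" "6 * m < dist z (J 0 c)"
  shows "12 * m \<le> dist h z"
proof -
  have cI: "c \<in> {0..\<eta>}" using c m by auto
  consider a b where "a \<in> {0..c}" "h = J 0 a" "b \<in> {c..\<eta>}" "z = J 0 b" | a where "a \<in> {0..c}" "h = J 0 a" "z \<in> R"
    | b where "h \<in> L" "b \<in> {c..\<eta>}" "z = J 0 b" | "h \<in> L" "z \<in> R"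
    using h(1) z(1) unfolding left_stem_def right_stem_def by blast
  then show ?thesis
  proof cases
    case 1
    then show ?thesis using h(2) z(2) iso[of 0 a c] iso[of 0 b c] iso[of 0 a b] cI by auto
  next
    case 2
    then show ?thesis using dR[of 0 a z] c m by auto
  next
    case 3
    then show ?thesis using dL[of 0 b h] c m by (auto simp: dist_commute)
  next
    case 4
    then show ?thesis using dLR[of h z] long m by auto
  qed
qed

lemma left_stem_arm_far:
  assumes "c \<in> {0..\<eta>}" "h \<in> left_stem c" "i \<in> {1, 2}" "z \<in> J i ` {\<eta>/2..\<eta>}"
  shows "2 * m \<le> dist h z"
proof -
  obtain t where t: "t \<in> {\<eta>/2..\<eta>}" "z = J i t" using assms by auto
  have tI: "t \<in> {0..\<eta>}" using t \<eta>_pos by auto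
  from assms(2) consider a where "a \<in> {0..c}" "h = J 0 a" | "h \<in> L" by (auto simp: left_stem_def)
  then show ?thesis
  proof cases
    case 1
    have "5 * m \<le> dist h z" unfolding 1 t by (rule dJ) (use 1 tI assms in auto)
    then show ?thesis using m by simp
  next
    case 2
    have "t \<le> dist z h" unfolding t by (rule dL) (use 2 tI assms in auto)
    then show ?thesis using t(1) \<eta>_pos m by (auto simp: dist_commute)
  qed
qed

lemma right_stem_arm_far:
  assumes "c \<in> {0..\<eta>}" "h \<in> right_stem c" "i \<in> {1, 2}" "z \<in> J i ` {0..\<eta>/2}"
  shows "2 * m \<le> dist h z"
proof -
  obtain t where t: "t \<in> {0..\<eta>/2}" "z = J i t" using assms by auto
  have tI: "t \<in> {0..\<eta>}" using t \<eta>_pos by auto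
  from assms(2) consider a where "a \<in> {c..\<eta>}" "h = J 0 a" | "h \<in> R" by (auto simp: right_stem_def)
  then show ?thesis
  proof cases
    case 1
    have "5 * m \<le> dist h z" unfolding 1 t by (rule dJ) (use 1 tI assms in auto)
    then show ?thesis using m by simp
  next
    case 2
    have "\<eta> - t \<le> dist z h" unfolding t by (rule dR) (use 2 tI assms in auto)
    then show ?thesis using t(1) \<eta>_pos m by (auto simp: dist_commute)
  qed
qed

lemma close_points: "dist w h < m \<Longrightarrow> dist w z < m \<Longrightarrow> dist h z < 2 * m"
  using dist_triangle[of h z w] by (simp add: dist_commute)

text \<open>The arms \<open>J 1\<close> and \<open>J 2\<close> are too far apart for a single ball.\<close>

lemma meets_stem:
  assumes "\<And>i. i \<in> {1, 2} \<Longrightarrow> \<exists>z\<in>S \<union> J i ` {0..\<eta>}. dist w z < m"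
  shows "\<exists>z\<in>S. dist w z < m"
proof (rule ccontr)
  assume no: "\<not> ?thesis"
  obtain z1 z2 where z: "z1 \<in> J 1 ` {0..\<eta>}" "dist w z1 < m" "z2 \<in> J 2 ` {0..\<eta>}" "dist w z2 < m"
    using assms[of 1] assms[of 2] no by blast
  then have "5 * m \<le> dist z1 z2" using dJ[of 1 2] by auto
  then show False using close_points[OF z(2,4)] m by simp
qed

lemma left_stem_excludes_right_side:
  assumes c: "c \<in> {20 * m..\<eta> - 20 * m}" and w: "7 * m \<le> dist w (J 0 c)" "h \<in> left_stem c" "dist w h < m"
    and z: "i \<in> {1, 2}" "z \<in> right_side c i"
  shows "m \<le> dist w z"
proof (rule ccontr)
  assume less: "\<not> m \<le> dist w z"
  then have hz: "dist h z < 2 * m" using close_points[OF w(3)] by simp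
  have "6 * m < dist h (J 0 c)" "6 * m < dist z (J 0 c)"
    using w less dist_triangle[of w "J 0 c" h] dist_triangle[of w "J 0 c" z] by auto
  then have "z \<notin> right_stem c" using stems_far[OF c w(2)] hz m by fastforce
  moreover have "z \<notin> J i ` {\<eta>/2..\<eta>}" using left_stem_arm_far[OF _ w(2) z(1)] hz c m by fastforce
  ultimately show False using z by (auto simp: right_side_def)
qed

lemma right_stem_excludes_left_side:
  assumes c: "c \<in> {20 * m..\<eta> - 20 * m}" and w: "7 * m \<le> dist w (J 0 c)" "h \<in> right_stem c" "dist w h < m"
    and z: "i \<in> {1, 2}" "z \<in> left_side c i"
  shows "m \<le> dist w z"
proof (rule ccontr)
  assume less: "\<not> m \<le> dist w z"
  then have hz: "dist h z < 2 * m" using close_points[OF w(3)] by simp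
  have "6 * m < dist h (J 0 c)" "6 * m < dist z (J 0 c)"
    using w less dist_triangle[of w "J 0 c" h] dist_triangle[of w "J 0 c" z] by auto
  then have "z \<notin> left_stem c" using stems_far[OF c _ _ w(2)] hz m by (fastforce simp: dist_commute)
  moreover have "z \<notin> J i ` {0..\<eta>/2}" using right_stem_arm_far[OF _ w(2) z(1)] hz c m by fastforce
  ultimately show False using z by (auto simp: left_side_def)
qed

text \<open>
  Here \<open>J 0 c\<close> and the midpoints of \<open>J 1\<close> and \<open>J 2\<close> form a frame, with the two sides as the ranges of its paths.
\<close>

lemma no_separating_pair:
  assumes c: "c \<in> {20 * m..\<eta> - 20 * m}"
    and uv: "u \<in> X" "v \<in> X" "7 * m \<le> dist u (J 0 c)" "7 * m \<le> dist v (J 0 c)"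
    and u: "\<And>i z. i \<in> {1, 2} \<Longrightarrow> z \<in> right_side c i \<Longrightarrow> m \<le> dist u z"
    and v: "\<And>i z. i \<in> {1, 2} \<Longrightarrow> z \<in> left_side c i \<Longrightarrow> m \<le> dist v z"
    and no: "\<And>i. i \<in> {1, 2} \<Longrightarrow> \<not> joined u v (J 0 c) (J i (\<eta>/2))"
  shows False
proof -
  define arm where "arm = (\<lambda>b. if b then 1 else 2::nat)"
  have arm: "arm b \<in> {1, 2}" "arm b < 3" for b by (auto simp: arm_def)
  have cI: "c \<in> {0..\<eta>}" using c m by auto
  have "\<exists>g. path g \<and> path_image g \<subseteq> left_side c (arm b) \<and> g 0 = J 0 c \<and> g 1 = J (arm b) (\<eta>/2)" for b
    using left_side_path[OF cI arm(2)] by (auto simp: path_component_def pathstart_def pathfinish_def)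
  then obtain \<zeta> where \<zeta>: "\<And>b. path (\<zeta> b)" "\<And>b. path_image (\<zeta> b) \<subseteq> left_side c (arm b)"
      "\<And>b. \<zeta> b 0 = J 0 c" "\<And>b. \<zeta> b 1 = J (arm b) (\<eta>/2)"
    by metis
  have "\<exists>g. path g \<and> path_image g \<subseteq> right_side c (arm b) \<and> g 0 = J 0 c \<and> g 1 = J (arm b) (\<eta>/2)" for b
    using right_side_path[OF cI arm(2)] by (auto simp: path_component_def pathstart_def pathfinish_def)
  then obtain \<xi> where \<xi>: "\<And>b. path (\<xi> b)" "\<And>b. path_image (\<xi> b) \<subseteq> right_side c (arm b)"
      "\<And>b. \<xi> b 0 = J 0 c" "\<And>b. \<xi> b 1 = J (arm b) (\<eta>/2)"
    by metis
  have ex_arm: "\<exists>b. i = arm b" if "i \<in> {1, 2}" for i using that by (auto simp: arm_def)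
  have left_sub: "left_side c i \<subseteq> left_stem c \<union> J i ` {0..\<eta>}"
    and right_sub: "right_side c i \<subseteq> right_stem c \<union> J i ` {0..\<eta>}" for i
    using \<eta>_pos by (auto simp: left_side_def right_side_def)
  have far: "\<exists>h\<in>left_stem c. dist w h < m"
    if meets: "\<And>b. ball w m \<inter> path_image (\<zeta> b) \<noteq> {}" for w
  proof (rule meets_stem)
    fix i :: nat assume "i \<in> {1, 2}"
    then obtain b where b: "i = arm b" using ex_arm by blast
    obtain z where "z \<in> path_image (\<zeta> b)" "dist w z < m" using meets[of b] by auto
    then show "\<exists>z\<in>left_stem c \<union> J i ` {0..\<eta>}. dist w z < m"
      using \<zeta>(2)[of b] left_sub[of i] unfolding b by blast
  qed
  have far': "\<exists>h\<in>right_stem c. dist w h < m"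
    if meets: "\<And>b. ball w m \<inter> path_image (\<xi> b) \<noteq> {}" for w
  proof (rule meets_stem)
    fix i :: nat assume "i \<in> {1, 2}"
    then obtain b where b: "i = arm b" using ex_arm by blast
    obtain z where "z \<in> path_image (\<xi> b)" "dist w z < m" using meets[of b] by auto
    then show "\<exists>z\<in>right_stem c \<union> J i ` {0..\<eta>}. dist w z < m"
      using \<xi>(2)[of b] right_sub[of i] unfolding b by blast
  qed
  have miss\<xi>: "ball w m \<inter> path_image (\<xi> b) = {}"
    if "\<forall>i\<in>{1, 2}. \<forall>z\<in>right_side c i. m \<le> dist w z" for w b
    using that arm(1)[of b] \<xi>(2)[of b] by (force simp: disjoint_iff)
  have miss\<zeta>: "ball w m \<inter> path_image (\<zeta> b) = {}"
    if "\<forall>i\<in>{1, 2}. \<forall>z\<in>left_side c i. m \<le> dist w z" for w b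
    using that arm(1)[of b] \<zeta>(2)[of b] by (force simp: disjoint_iff)
  interpret theta_frame X m "J 0 c" "\<lambda>b. J (arm b) (\<eta>/2)" \<zeta> \<xi>
  proof unfold_locales
    show "path_image (\<zeta> b) \<subseteq> X" "path_image (\<xi> b) \<subseteq> X" for b
      using \<zeta>(2) \<xi>(2) left_side_X[OF cI arm(2)] right_side_X[OF cI arm(2)] by blast+
    show "(\<forall>i. ball w m \<inter> path_image (\<xi> i) = {}) \<or> (\<forall>i. ball w m \<inter> path_image (\<zeta> i) = {})"
      if w: "w \<in> X" "7 * m \<le> dist w (J 0 c)" "\<And>i. ball w m \<inter> (path_image (\<zeta> i) \<union> path_image (\<xi> i)) \<noteq> {}" for w
    proof -
      have "\<exists>h\<in>left_stem c \<union> right_stem c. dist w h < m"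
      proof (rule meets_stem)
        fix i :: nat assume "i \<in> {1, 2}"
        then obtain b where b: "i = arm b" using ex_arm by blast
        from w(3)[of b] have "\<exists>z. z \<in> path_image (\<zeta> b) \<union> path_image (\<xi> b) \<and> dist w z < m"
          unfolding disjoint_iff mem_ball by metis
        then show "\<exists>z\<in>(left_stem c \<union> right_stem c) \<union> J i ` {0..\<eta>}. dist w z < m"
          using \<zeta>(2)[of b] \<xi>(2)[of b] left_sub[of i] right_sub[of i] unfolding b by blast
      qed
      then obtain h where h: "h \<in> left_stem c \<or> h \<in> right_stem c" "dist w h < m" by blast
      from h(1) have "(\<forall>i\<in>{1, 2}. \<forall>z\<in>right_side c i. m \<le> dist w z) \<or> (\<forall>i\<in>{1, 2}. \<forall>z\<in>left_side c i. m \<le> dist w z)"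
        using left_stem_excludes_right_side[OF c w(2) _ h(2)] right_stem_excludes_left_side[OF c w(2) _ h(2)]
        by blast
      then show ?thesis using miss\<xi> miss\<zeta> by blast
    qed
    show "10 * m \<le> dist u v"
      if uv: "7 * m \<le> dist u (J 0 c)" "7 * m \<le> dist v (J 0 c)"
        "\<And>i. ball u m \<inter> path_image (\<zeta> i) \<noteq> {}" "\<And>i. ball v m \<inter> path_image (\<xi> i) \<noteq> {}" for u v
    proof -
      obtain h z where h: "h \<in> left_stem c" "dist u h < m" and z: "z \<in> right_stem c" "dist v z < m"
        using far[OF uv(3)] far'[OF uv(4)] by blast
      have "6 * m < dist h (J 0 c)" "6 * m < dist z (J 0 c)"
        using uv h z dist_triangle[of u "J 0 c" h] dist_triangle[of v "J 0 c" z] by auto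
      from stems_far[OF c h(1) this(1) z(1) this(2)]
      show ?thesis using h z dist_triangle[of h z u] dist_triangle[of u z v] by (simp add: dist_commute)
    qed
  qed (use \<zeta> \<xi> in auto)
  have "cut_pair u v"
    unfolding cut_pair_def using uv no[OF arm(1)] u v by (intro conjI allI miss\<xi> miss\<zeta>) blast+
  then show False using no_cut_pair by blast
qed

definition \<Omega> :: "'a set" where "\<Omega> = L \<union> R \<union> J 1 ` {0..\<eta>} \<union> J 2 ` {0..\<eta>}"

lemma \<Omega>_far:
  assumes "t \<in> {k..\<eta> - k}" "5 * m \<le> k" "\<omega> \<in> \<Omega>" shows "5 * m \<le> dist \<omega> (J 0 t)"
proof -
  have t: "t \<in> {0..\<eta>}" using assms m by auto
  from assms(3) consider "\<omega> \<in> L" | "\<omega> \<in> R" | i s where "i \<in> {1, 2}" "s \<in> {0..\<eta>}" "\<omega> = J i s"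
    unfolding \<Omega>_def by blast
  then show ?thesis
  proof cases
    case 1 then show ?thesis using dL[of 0 t \<omega>] t assms m by (auto simp: dist_commute)
  next
    case 2 then show ?thesis using dR[of 0 t \<omega>] t assms m by (auto simp: dist_commute)
  next
    case 3
    then show ?thesis using dJ[of i 0 s t] t by auto
  qed
qed

lemma path_connected_\<Omega>: "path_connected \<Omega>"
proof -
  have pcJ: "path_connected (J i ` {0..\<eta>})" if "i < 3" for i
    by (intro path_connected_continuous_image cont_J that) (auto intro: convex_imp_path_connected)
  have "path_connected (L \<union> J 1 ` {0..\<eta>})"
    by (rule path_connected_Un[OF pcL pcJ]) (use JL[of 1] \<eta>_pos in \<open>auto intro!: image_eqI[of _ _ 0]\<close>)
  then have "path_connected ((L \<union> J 1 ` {0..\<eta>}) \<union> J 2 ` {0..\<eta>})"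
    by (rule path_connected_Un[OF _ pcJ]) (use JL[of 2] \<eta>_pos in \<open>auto intro!: image_eqI[of _ _ 0]\<close>)
  then have "path_connected (((L \<union> J 1 ` {0..\<eta>}) \<union> J 2 ` {0..\<eta>}) \<union> R)"
    by (rule path_connected_Un[OF _ pcR]) (use JR[of 2] \<eta>_pos in \<open>auto intro!: image_eqI[of _ _ \<eta>]\<close>)
  then show ?thesis unfolding \<Omega>_def by (simp add: Un_ac)
qed

text \<open>
  A separating pair with one ball on \<open>J 0\<close> and the other one at the left end would cut off the
  point \<open>J 0 c\<close>, which lies \<open>20m\<close> to the left of the first ball and hence is far from both.
\<close>

lemma left_blocker:
  assumes w: "w \<in> X" "w' \<in> X" and h: "h \<in> L \<union> J 0 ` {0..2 * m}" "dist w h < m"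
    and \<tau>: "\<tau> \<in> {50 * m..\<eta> - 50 * m}" "dist w' (J 0 \<tau>) < m"
    and pq: "p \<in> {50 * m..\<tau>}" "q \<in> {\<tau>..\<eta> - 50 * m}"
    and w': "\<And>x. x \<in> {0..p} \<union> {q..\<eta>} \<Longrightarrow> m \<le> dist w' (J 0 x)"
    and no: "\<not> joined w w' (J 0 p) (J 0 q)"
  shows False
proof -
  define c where "c = \<tau> - 20 * m"
  have \<tau>I: "\<tau> \<in> {0..\<eta>}" and cI: "c \<in> {0..\<eta>}" and c: "c \<in> {20 * m..\<eta> - 20 * m}" "30 * m \<le> c"
    using \<tau> m by (auto simp: c_def)
  have hJ: "x - 2 * m \<le> dist h (J i x)" if x: "x \<in> {0..\<eta>}" "i < 3" for x i
  proof -
    from h(1) consider "h \<in> L" | y where "y \<in> {0..2 * m}" "h = J 0 y" by blast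
    then show ?thesis
    proof cases
      case 1 then show ?thesis using dL[OF x(2,1) 1] m by (simp add: dist_commute)
    next
      case 2
      then have y: "y \<in> {0..\<eta>}" using long m by auto
      have "dist (J 0 0) h \<le> 2 * m" using 2 iso[of 0 0 y] y by auto
      then show ?thesis using dL[OF x(2,1) JL[of 0]] dist_triangle[of "J i x" "J 0 0" h] by (auto simp: dist_commute)
    qed
  qed
  have hR: "\<eta> - 2 * m \<le> dist h z" if z: "z \<in> R" for z
  proof -
    from h(1) consider "h \<in> L" | y where "y \<in> {0..2 * m}" "h = J 0 y" by blast
    then show ?thesis
    proof cases
      case 1 then show ?thesis using dLR[of h z] z m by auto
    next
      case 2
      then have y: "y \<in> {0..\<eta>}" using long m by auto
      then show ?thesis using 2 dR[of 0 y z] z by auto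
    qed
  qed
  have wJ: "x - 3 * m \<le> dist w (J i x)" if "x \<in> {0..\<eta>}" "i < 3" for x i
    using hJ[OF that] h(2) dist_triangle[of h "J i x" w] by (auto simp: dist_commute)
  have wR: "\<eta> - 3 * m \<le> dist w z" if "z \<in> R" for z
    using hR[OF that] h(2) dist_triangle[of h z w] by (auto simp: dist_commute)
  have w'\<tau>: "dist z (J 0 \<tau>) - m \<le> dist w' z" for z
    using \<tau>(2) dist_triangle[of z "J 0 \<tau>" w'] by (auto simp: dist_commute)
  have w'J: "m \<le> dist w' (J 0 x)" if "x \<in> {0..c}" for x
    using w'\<tau>[of "J 0 x"] iso[of 0 x \<tau>] that cI \<tau>I m by (auto simp: c_def)
  have w'\<Omega>: "m \<le> dist w' z" if "z \<in> \<Omega>" for z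
    using w'\<tau>[of z] \<Omega>_far[OF \<tau>(1) _ that] m by auto
  show False
  proof (rule no_separating_pair[OF c(1) w])
    show "7 * m \<le> dist w (J 0 c)" using wJ[OF cI, of 0] c(2) m by simp
    show "7 * m \<le> dist w' (J 0 c)" using w'\<tau>[of "J 0 c"] iso[of 0 c \<tau>] cI \<tau>I m by (auto simp: c_def)
    show "m \<le> dist w' z" if "i \<in> {1, 2}" "z \<in> left_side c i" for i z
    proof -
      have "z \<in> J 0 ` {0..c} \<or> z \<in> \<Omega>"
        using that \<eta>_pos unfolding left_side_def left_stem_def \<Omega>_def by fastforce
      then show ?thesis using w'J w'\<Omega> by blast
    qed
    show wr: "m \<le> dist w z" if z: "i \<in> {1, 2}" "z \<in> right_side c i" for i z
    proof -
      from z(2) consider "z \<in> R" | x where "x \<in> {c..\<eta>}" "z = J 0 x" | x where "x \<in> {\<eta>/2..\<eta>}" "z = J i x"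
        by (auto simp: right_side_def right_stem_def)
      then show ?thesis
      proof cases
        case 1 then show ?thesis using wR[of z] long m by auto
      next
        case 2 then show ?thesis using wJ[of x 0] c m by auto
      next
        case 3 then show ?thesis using wJ[of x i] z(1) \<eta>_pos long m by auto
      qed
    qed
    show "\<not> joined w w' (J 0 c) (J i (\<eta>/2))" if i: "i \<in> {1, 2}" for i
    proof
      assume j: "joined w w' (J 0 c) (J i (\<eta>/2))"
      have i3: "i < 3" using i by auto
      define Q where "Q = J 0 ` {q..\<eta>} \<union> R \<union> J i ` {\<eta>/2..\<eta>}"
      have Q: "Q = right_side q i" by (simp add: Q_def right_side_def right_stem_def)
      have qI: "q \<in> {0..\<eta>}" using pq(2) \<tau>I m by auto
      have "Q \<subseteq> right_side c i" using pq(2) m by (fastforce simp: Q_def right_side_def right_stem_def c_def)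
      then have "m \<le> dist w z" if "z \<in> Q" for z using wr[OF i] that by blast
      moreover have "m \<le> dist w' z" if "z \<in> Q" for z
      proof -
        have "z \<in> J 0 ` {q..\<eta>} \<or> z \<in> \<Omega>" using that i \<eta>_pos unfolding Q_def \<Omega>_def by fastforce
        then show ?thesis using w' w'\<Omega> by blast
      qed
      moreover have "Q \<subseteq> X" unfolding Q by (rule right_side_X[OF qI i3])
      ultimately have "Q \<subseteq> off w w'" by (auto simp: off_iff)
      then have "joined w w' (J 0 q) (J i (\<eta>/2))"
        using right_side_path[OF qI i3] unfolding Q[symmetric] by (rule path_component_of_subset)
      moreover have "joined w w' (J 0 p) (J 0 c)"
      proof -
        let ?I = "{min p c..max p c}"
        have "J 0 ` ?I \<subseteq> off w w'"
        proof (rule image_subsetI)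
          fix x assume x: "x \<in> ?I"
          then have xI: "x \<in> {0..\<eta>}" "30 * m \<le> x" using pq \<tau> c cI m by (auto simp: c_def)
          have "x \<in> {0..p} \<or> x \<in> {0..c}" using x xI by (auto simp: max_def split: if_splits)
          then have "m \<le> dist w' (J 0 x)" using w' w'J by blast
          then show "J 0 x \<in> off w w'" using wJ[OF xI(1), of 0] xI m JX[OF _ xI(1), of 0] by (auto simp: off_iff)
        qed
        then show ?thesis
          by (rule path_component_J[rotated 3]) (use pq \<tau>I cI m in \<open>auto simp: min_def max_def\<close>)
      qed
      ultimately have "joined w w' (J 0 p) (J 0 q)"
        using j by (meson path_component_sym path_component_trans)
      then show False using no by blast
    qed
  qed
qed

lemma right_blocker:
  assumes w: "w \<in> X" "w' \<in> X" and h: "h \<in> R \<union> J 0 ` {\<eta> - 2 * m..\<eta>}" "dist w h < m"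
    and \<tau>: "\<tau> \<in> {50 * m..\<eta> - 50 * m}" "dist w' (J 0 \<tau>) < m"
    and pq: "p \<in> {50 * m..\<tau>}" "q \<in> {\<tau>..\<eta> - 50 * m}"
    and w': "\<And>x. x \<in> {0..p} \<union> {q..\<eta>} \<Longrightarrow> m \<le> dist w' (J 0 x)"
    and no: "\<not> joined w w' (J 0 p) (J 0 q)"
  shows False
proof -
  interpret rv: three_gaps X m R L "\<lambda>i t. J i (\<eta> - t)" \<eta> by (rule rev)
  show False
  proof (rule rv.left_blocker[OF w _ h(2), of "\<eta> - \<tau>" "\<eta> - q" "\<eta> - p"])
    show "h \<in> R \<union> (\<lambda>t. J 0 (\<eta> - t)) ` {0..2 * m}" using h(1) unfolding image_rev by simp
    show "\<not> joined w w' (J 0 (\<eta> - (\<eta> - q))) (J 0 (\<eta> - (\<eta> - p)))"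
      using no path_component_sym by fastforce
    show "m \<le> dist w' (J 0 (\<eta> - x))" if "x \<in> {0..\<eta> - q} \<union> {\<eta> - p..\<eta>}" for x
      by (rule w') (use that in auto)
  qed (use \<tau> pq in auto)
qed

sublocale pinched_geodesic X m "J 0" \<eta> \<Omega>
proof unfold_locales
  show "J 0 0 \<in> \<Omega>" "J 0 \<eta> \<in> \<Omega>" using JL[of 0] JR[of 0] by (auto simp: \<Omega>_def)
  show "\<Omega> \<subseteq> X" using LX RX JX by (auto simp: \<Omega>_def)
  show "5 * m \<le> dist \<omega> (J 0 t)" if "t \<in> {50 * m..\<eta> - 50 * m}" "\<omega> \<in> \<Omega>" for t \<omega>
    by (rule \<Omega>_far[of _ "50 * m"]) (use that m in auto)
qed (use JX iso in auto)

end

context three_gaps begin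

text \<open>
  Of two points close to the arm \<open>0\<close> one is pinched: a separating pair has one ball on the stretch between
  the two points, and if the other ball met \<open>\<Omega>\<close> then it would have to block one end.
\<close>

lemma pinched_or_pinched:
  assumes t: "50 * m \<le> t" "t + 12 * m \<le> t'" "t' \<le> \<eta> - 50 * m"
    and z: "z \<in> X" "z' \<in> X" "dist z (J 0 t) < m" "dist z' (J 0 t') < m"
  shows "pinched z \<or> pinched z'"
proof (rule ccontr)
  assume np: "\<not> ?thesis"
  have I: "t \<in> {0..\<eta>}" "t' \<in> {0..\<eta>}" using t m by auto
  have "10 * m \<le> dist z z'"
    using iso[of 0 t t'] I t z dist_triangle[of "J 0 t" "J 0 t'" z] dist_triangle[of z "J 0 t'" z'] m
    by (auto simp: dist_commute)
  then obtain a b where ab: "a \<in> X" "b \<in> X" "4 * m \<le> dist z a" "4 * m \<le> dist z b" "4 * m \<le> dist z' a" "4 * m \<le> dist z' b"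
      "\<not> joined a b z z'"
    using separated[OF z(1,2)] unfolding off_def by blast
  have zt: "joined a b z (J 0 t)" "joined a b z' (J 0 t')"
    by (rule joined_near[where r = m]; use z ab JX I m in auto)+
  have "\<exists>\<tau>\<in>{t..t'}. dist a (J 0 \<tau>) < m \<or> dist b (J 0 \<tau>) < m"
  proof (rule ccontr)
    assume "\<not> ?thesis"
    then have "joined a b (J 0 t) (J 0 t')" using t I m by (intro joined_J(1)) (auto simp: not_less)
    then have "joined a b z z'" using zt by (meson path_component_sym path_component_trans)
    then show False using ab by blast
  qed
  then obtain \<tau> w w' where \<tau>: "\<tau> \<in> {t..t'}" "dist w' (J 0 \<tau>) < m" "{w, w'} = {a, b}" by blast
  then have w: "w \<in> X" "w' \<in> X" "4 * m \<le> dist z w" "4 * m \<le> dist z w'" "4 * m \<le> dist z' w" "4 * m \<le> dist z' w'"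
      "off w w' = off a b"
    using ab off_commute by (auto simp: doubleton_eq_iff)
  have \<tau>I: "\<tau> \<in> {0..\<eta>}" "\<tau> \<in> {50 * m..\<eta> - 50 * m}" using \<tau>(1) I t by auto
  have no: "\<not> joined w w' (J 0 t) (J 0 t')"
    unfolding w(7) using zt ab(7) by (meson path_component_sym path_component_trans)
  have w'\<Omega>: "m \<le> dist w' \<omega>" if "\<omega> \<in> \<Omega>" for \<omega>
    using \<Omega>_far[OF \<tau>I(2) _ that] \<tau>(2) dist_triangle[of \<omega> "J 0 \<tau>" w'] m by (auto simp: dist_commute)
  \<comment> \<open>The ball hits \<open>J 0\<close> between the two points and is far from both, so it is too small to hit \<open>J 0\<close> beyond them.\<close>
  have w'J: "m \<le> dist w' (J 0 x)" if x: "x \<in> {0..t} \<union> {t'..\<eta>}" for x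
  proof (rule ccontr)
    assume *: "\<not> m \<le> dist w' (J 0 x)"
    have xI: "x \<in> {0..\<eta>}" using x I by auto
    have c: "\<bar>\<tau> - x\<bar> < 2 * m" using hits_close[OF \<tau>(2) _ \<tau>I(1) xI] * by auto
    have "3 * m < dist w' (J 0 t)" "3 * m < dist w' (J 0 t')"
      using w(4,6) z dist_triangle[of z w' "J 0 t"] dist_triangle[of z' w' "J 0 t'"] by (auto simp: dist_commute)
    moreover have "dist w' (J 0 t) < 3 * m \<or> dist w' (J 0 t') < 3 * m"
      using x
    proof
      assume "x \<in> {0..t}"
      then have "dist (J 0 x) (J 0 t) < 2 * m" using iso[of 0 x t] xI I c \<tau>(1) by auto
      then show ?thesis using * dist_triangle[of w' "J 0 t" "J 0 x"] by auto
    next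
      assume "x \<in> {t'..\<eta>}"
      then have "dist (J 0 x) (J 0 t') < 2 * m" using iso[of 0 x t'] xI I c \<tau>(1) by auto
      then show ?thesis using * dist_triangle[of w' "J 0 t'" "J 0 x"] by auto
    qed
    ultimately show False by auto
  qed
  have pq: "t \<in> {50 * m..\<tau>}" "t' \<in> {\<tau>..\<eta> - 50 * m}" using \<tau>(1) t by auto
  show False
  proof (cases "\<exists>\<omega>\<in>\<Omega>. dist w \<omega> < m")
    case False
    then have sub: "\<Omega> \<subseteq> off a b" unfolding w(7)[symmetric] using w'\<Omega> \<Omega>X by (auto simp: off_iff not_less)
    obtain \<omega> \<omega>' where \<omega>: "\<omega> \<in> \<Omega>" "\<omega>' \<in> \<Omega>" "joined a b z \<omega>" "joined a b z' \<omega>'"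
      using np ab unfolding pinched_def sep_def by blast
    have "path_component \<Omega> \<omega> \<omega>'" using path_connected_\<Omega> \<omega> unfolding path_connected_component by blast
    then have "joined a b \<omega> \<omega>'" by (rule path_component_of_subset[OF sub])
    then have "joined a b z z'" using \<omega> by (meson path_component_sym path_component_trans)
    then show False using ab by blast
  next
    case True
    then obtain \<omega> where \<omega>: "\<omega> \<in> \<Omega>" "dist w \<omega> < m" by blast
    \<comment> \<open>If \<open>w\<close> blocked one end, then the pair would be of the excluded kind.\<close>
    have left: "m \<le> dist w h" if "h \<in> L \<union> J 0 ` {0..2 * m}" for h
      using left_blocker[OF w(1,2) that _ \<tau>I(2) \<tau>(2) pq w'J no] by (meson not_le)
    have right: "m \<le> dist w h" if "h \<in> R \<union> J 0 ` {\<eta> - 2 * m..\<eta>}" for h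
      using right_blocker[OF w(1,2) that _ \<tau>I(2) \<tau>(2) pq w'J no] by (meson not_le)
    \<comment> \<open>Now \<open>w\<close> meets one of the arms \<open>1\<close> and \<open>2\<close>, and the other arm \<open>j\<close> is a free way around.\<close>
    have "\<omega> \<notin> L \<union> R" using left right \<omega>(2) by (meson UnCI UnE not_less)
    then have "\<exists>i\<in>{1, 2}. \<omega> \<in> J i ` {0..\<eta>}" using \<omega>(1) by (simp add: \<Omega>_def)
    then obtain i x where ix: "i \<in> {1, 2}" "x \<in> {0..\<eta>}" "\<omega> = J i x" by blast
    define j where "j = 3 - i"
    have j: "j \<in> {1, 2}" "j \<noteq> i" "j < 3" "i < 3" using ix(1) by (auto simp: j_def)
    have arm: "m \<le> dist w (J k y)" if "k < 3" "k \<noteq> i" "y \<in> {0..\<eta>}" for k y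
      using dJ[OF j(4) that(1) that(2)[symmetric] ix(2) that(3)] \<omega>(2) ix(3) dist_triangle[of \<omega> "J k y" w] m
      by (auto simp: dist_commute)
    have "i \<noteq> 0" using ix by auto
    define S where "S = J 0 ` {0..t} \<union> L \<union> J j ` {0..\<eta>} \<union> R \<union> J 0 ` {t'..\<eta>}"
    have "S \<subseteq> off w w'"
    proof
      fix y assume y: "y \<in> S"
      then have "y \<in> X" using LX RX JX j I by (auto simp: S_def)
      moreover have "y \<in> \<Omega> \<or> y \<in> J 0 ` ({0..t} \<union> {t'..\<eta>})" using y j by (auto simp: S_def \<Omega>_def)
      then have "m \<le> dist w' y" using w'\<Omega> w'J by blast
      moreover have "m \<le> dist w y"
        using y left right arm[OF j(3,2)] arm[of 0] I \<open>i \<noteq> 0\<close> unfolding S_def by auto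
      ultimately show "y \<in> off w w'" by (simp add: off_iff)
    qed
    have "path_component S (J 0 t) (J 0 0)"
      using I by (intro path_component_J[of 0 0 t]) (auto simp: S_def)
    moreover have "path_component L (J 0 0) (J j 0)" using pcL JL j by (auto simp: path_connected_component)
    then have "path_component S (J 0 0) (J j 0)"
      by (rule path_component_of_subset[rotated]) (auto simp: S_def)
    moreover have "path_component S (J j 0) (J j \<eta>)"
      using \<eta>_pos by (intro path_component_J[OF j(3), of 0 \<eta>]) (auto simp: S_def)
    moreover have "path_component R (J j \<eta>) (J 0 \<eta>)" using pcR JR j by (auto simp: path_connected_component)
    then have "path_component S (J j \<eta>) (J 0 \<eta>)"
      by (rule path_component_of_subset[rotated]) (auto simp: S_def)
    moreover have "path_component S (J 0 \<eta>) (J 0 t')"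
      using I by (intro path_component_J[of 0 t' \<eta>]) (auto simp: S_def)
    ultimately have "path_component S (J 0 t) (J 0 t')" by (meson path_component_trans)
    then have "joined w w' (J 0 t) (J 0 t')" by (rule path_component_of_subset[OF \<open>S \<subseteq> off w w'\<close>])
    then show False using no by blast
  qed
qed

text \<open>
  A point at distance at least \<open>8m\<close> from both hits exists within \<open>8m\<close> of \<open>c\<close>; around it the pair is of the kind
  that has been excluded.
\<close>

lemma wide_window_contradiction:
  assumes c: "c \<in> {80 * m..\<eta> - 80 * m}" and win: "window c u v s r" and wide: "24 * m \<le> r - s"
  shows False
proof -
  have W: "u \<in> X" "v \<in> X" "0 \<le> s" "s \<le> c - 3 * m" "c + 3 * m \<le> r" "r \<le> \<eta>"
    "dist u (J 0 s) < m" "dist v (J 0 r) < m" "sep u v (J 0 c)" using win by (auto simp: window_def)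
  have I: "s \<in> {0..\<eta>}" "r \<in> {0..\<eta>}" "c \<in> {0..\<eta>}" using W m by auto
  \<comment> \<open>The hits are at least \<open>3m\<close> away from \<open>c\<close>; a hit closer than \<open>8m\<close> leaves at least \<open>16m\<close> on the other side.\<close>
  define e where "e = (if c - 8 * m < s then c + 8 * m else if r < c + 8 * m then c - 8 * m else c)"
  have e: "8 * m \<le> e - s" "8 * m \<le> r - e" "e \<in> {c - 8 * m..c + 8 * m}"
    using W wide m by (auto simp: e_def)
  have eI: "e \<in> {0..\<eta>}" "e \<in> {20 * m..\<eta> - 20 * m}" using e c m by auto
  have uJ: "\<bar>s - x\<bar> - m \<le> dist u (J 0 x)" and vJ: "\<bar>r - x\<bar> - m \<le> dist v (J 0 x)" if "x \<in> {0..\<eta>}" for x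
    using dist_J_ge[OF W(7) I(1) that] dist_J_ge[OF W(8) I(2) that] by auto
  have ui: "dist (J 0 s) z - m \<le> dist u z" and vi: "dist (J 0 r) z - m \<le> dist v z" for z
    using W(7,8) dist_triangle[of "J 0 s" z u] dist_triangle[of "J 0 r" z v] by (auto simp: dist_commute)
  show False
  proof (rule no_separating_pair[OF eI(2) W(1,2)])
    show "7 * m \<le> dist u (J 0 e)" "7 * m \<le> dist v (J 0 e)" using uJ[OF eI(1)] vJ[OF eI(1)] e m by auto
    show "m \<le> dist u z" if z: "i \<in> {1, 2}" "z \<in> right_side e i" for i z
    proof -
      from z(2) consider "z \<in> R" | x where "x \<in> {e..\<eta>}" "z = J 0 x" | x where "x \<in> {\<eta>/2..\<eta>}" "z = J i x"
        by (auto simp: right_side_def right_stem_def)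
      then show ?thesis
      proof cases
        case 1 then show ?thesis using ui[of z] dR[of 0 s z] W c I m by auto
      next
        case 2 then show ?thesis using uJ[of x] e eI m by auto
      next
        case 3 then show ?thesis using ui[of z] dJ[of 0 i s x] z(1) I \<eta>_pos m by auto
      qed
    qed
    show "m \<le> dist v z" if z: "i \<in> {1, 2}" "z \<in> left_side e i" for i z
    proof -
      from z(2) consider "z \<in> L" | x where "x \<in> {0..e}" "z = J 0 x" | x where "x \<in> {0..\<eta>/2}" "z = J i x"
        by (auto simp: left_side_def left_stem_def)
      then show ?thesis
      proof cases
        case 1 then show ?thesis using vi[of z] dL[of 0 r z] W c I m by auto
      next
        case 2 then show ?thesis using vJ[of x] e eI m by auto
      next
        case 3 then show ?thesis using vi[of z] dJ[of 0 i r x] z(1) I \<eta>_pos m by auto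
      qed
    qed
    show "\<not> joined u v (J 0 e) (J i (\<eta>/2))" if i: "i \<in> {1, 2}" for i
    proof
      assume j: "joined u v (J 0 e) (J i (\<eta>/2))"
      have "joined u v (J 0 c) (J 0 e)"
      proof (rule path_component_J[of 0 "min c e" "max c e"])
        show "J 0 ` {min c e..max c e} \<subseteq> off u v"
        proof (rule image_subsetI)
          fix x assume x: "x \<in> {min c e..max c e}"
          then have xI: "x \<in> {0..\<eta>}" using I eI by (auto simp: min_def max_def split: if_splits)
          have "3 * m \<le> x - s" "3 * m \<le> r - x" using x e W m by (auto simp: min_def max_def split: if_splits)
          then show "J 0 x \<in> off u v" using uJ[OF xI] vJ[OF xI] JX[OF _ xI, of 0] m by (auto simp: off_iff)
        qed
      qed (use I eI in auto)
      then have "joined u v (J 0 c) (J i (\<eta>/2))" using j path_component_trans by blast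
      moreover have "J i (\<eta>/2) \<in> \<Omega>" using i \<eta>_pos by (auto simp: \<Omega>_def)
      ultimately show False using W(9) by (simp add: sep_def)
    qed
  qed
qed

text \<open>
  By the dichotomy for two distant points, points that are not pinched occur near at most one of two
  disjoint stretches of \<open>J 0\<close>. Along the other stretch a wide window can be grown.
\<close>

lemma three_gaps_impossible: False
proof -
  define near where "near = (\<lambda>c z. z \<in> X \<and> (\<exists>t\<in>{c - 30 * m..c + 30 * m}. dist z (J 0 t) < m))"
  have "(\<forall>z. near (100 * m) z \<longrightarrow> pinched z) \<or> (\<forall>z. near (200 * m) z \<longrightarrow> pinched z)"
  proof (rule ccontr)
    assume "\<not> ?thesis"
    then obtain z z' where "near (100 * m) z" "near (200 * m) z'" "\<not> pinched z" "\<not> pinched z'" by blast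
    then obtain t t' where "z \<in> X" "z' \<in> X" "t \<in> {70 * m..130 * m}" "t' \<in> {170 * m..230 * m}"
      "dist z (J 0 t) < m" "dist z' (J 0 t') < m" by (auto simp: near_def)
    then show False using pinched_or_pinched[of t t' z z'] \<open>\<not> pinched z\<close> \<open>\<not> pinched z'\<close> long m by auto
  qed
  moreover have "100 * m \<in> {80 * m..\<eta> - 80 * m}" "200 * m \<in> {80 * m..\<eta> - 80 * m}"
    using long m by auto
  ultimately obtain c where c: "c \<in> {80 * m..\<eta> - 80 * m}" "\<forall>z. near c z \<longrightarrow> pinched z" by blast
  have "pinched z" if "z \<in> X" "t \<in> {c - 30 * m..c + 30 * m}" "dist z (J 0 t) < m" for z t
    using c(2) that unfolding near_def by blast
  then have "\<exists>u v s r. window c u v s r \<and> 24 * m \<le> r - s"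
    using c(1) by (intro wide_window) simp_all
  then show False using wide_window_contradiction[OF c(1)] by blast
qed

end

section \<open>A very fat theta curve contains three long gaps\<close>

text \<open>
  The sets \<open>A\<close> and \<open>B\<close> are the unions of the \<open>\<alpha>\<close> and of the \<open>\<beta>\<close>; they are path connected because their parts
  share the image of a vertex.
\<close>

lemma fat_theta_curve_arms:
  assumes fat: "fat_theta_curve M X f" and M: "0 < M"
  obtains A B and c :: "nat \<Rightarrow> real \<Rightarrow> 'a::metric_space" and P :: "nat \<Rightarrow> 'a set" where
    "A \<subseteq> X" "B \<subseteq> X" "path_connected A" "path_connected B" "compact A" "compact B"
    "\<forall>i<3. path (c i) \<and> path_image (c i) \<subseteq> X \<and> c i 0 \<in> A \<and> c i 1 \<in> B \<and> path_image (c i) \<subseteq> A \<union> P i \<union> B"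
    "\<forall>a\<in>A. \<forall>b\<in>B. 2 * M \<le> dist a b"
    "\<forall>i<3. \<forall>j<3. i \<noteq> j \<longrightarrow> (\<forall>p\<in>P i. \<forall>q\<in>P j. M \<le> dist p q)"
proof -
  define q where "q = (\<lambda>i::nat. theta_arc (if i = 0 then 1 else if i = 1 then -1 else 0))"
  have cont: "continuous_on Theta f" and fX: "f ` Theta \<subseteq> X"
    using fat by (auto simp: fat_theta_curve_def theta_curve_def)
  obtain S T where ST:
    "\<forall>q\<in>theta_arcs. subarc (S q) q \<and> subarc (T q) q \<and> -1 \<in> S q \<and> 1 \<in> T q"
    "\<forall>q\<in>theta_arcs. \<forall>r\<in>theta_arcs. q \<noteq> r \<longrightarrow>
      (\<forall>t\<in>f ` q - (f ` S q \<union> f ` T q). \<forall>s\<in>f ` r - (f ` S r \<union> f ` T r). M \<le> dist t s)"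
    "\<forall>t\<in>\<Union> ((\<lambda>q. f ` S q) ` theta_arcs). \<forall>s\<in>\<Union> ((\<lambda>q. f ` T q) ` theta_arcs). 2 * M \<le> dist t s"
    using fat unfolding fat_theta_curve_def Let_def by (elim conjE exE) (rule that; assumption)
  have q: "q i \<in> theta_arcs" for i by (auto simp: q_def theta_arcs_param)
  have q_inj: "q i \<noteq> q j" if "i < 3" "j < 3" "i \<noteq> j" for i j
  proof -
    define \<epsilon> where "\<epsilon> = (\<lambda>i::nat. if i = 0 then 1 else if i = 1 then -1 else 0 :: real)"
    have "\<epsilon> i \<noteq> \<epsilon> j" "\<epsilon> i \<in> {1, -1, 0}" "\<epsilon> j \<in> {1, -1, 0}" using that by (auto simp: \<epsilon>_def)
    then have "theta_arc (\<epsilon> i) \<noteq> theta_arc (\<epsilon> j)" using inj_onD[OF theta_arc_inj] by blast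
    then show ?thesis by (simp add: q_def \<epsilon>_def)
  qed
  have qT: "r \<subseteq> Theta" if "r \<in> theta_arcs" for r using that by (auto simp: theta_arcs_param Theta_param)
  have star: "path_connected (\<Union>r\<in>theta_arcs. f ` U r) \<and> compact (\<Union>r\<in>theta_arcs. f ` U r)"
    if U: "\<forall>r\<in>theta_arcs. subarc (U r) r \<and> x \<in> U r" for U x
  proof
    have Ur: "path_connected (U r) \<and> compact (U r) \<and> continuous_on (U r) f" if r: "r \<in> theta_arcs" for r
    proof -
      obtain g where "arc g" "path_image g = U r" "U r \<subseteq> r" using U r by (auto simp: subarc_def)
      then show ?thesis
        using path_connected_path_image[of g] compact_path_image[of g] arc_imp_path[of g]
          continuous_on_subset[OF cont subset_trans[OF _ qT[OF r]]] by simp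
    qed
    then have pc: "path_connected (f ` U r)" and cp: "compact (f ` U r)" if "r \<in> theta_arcs" for r
      using that by (simp_all add: path_connected_continuous_image compact_continuous_image)
    have fin: "finite theta_arcs" by (simp add: theta_arcs_param)
    show "compact (\<Union>r\<in>theta_arcs. f ` U r)" by (intro compact_UN fin cp)
    show "path_connected (\<Union>r\<in>theta_arcs. f ` U r)"
      unfolding path_connected_component
    proof (intro ballI)
      fix y z assume y: "y \<in> (\<Union>r\<in>theta_arcs. f ` U r)" and z: "z \<in> (\<Union>r\<in>theta_arcs. f ` U r)"
      have to_x: "path_component (\<Union>r\<in>theta_arcs. f ` U r) y (f x)" if y: "y \<in> (\<Union>r\<in>theta_arcs. f ` U r)" for y
      proof -
        obtain r where r: "r \<in> theta_arcs" "y \<in> f ` U r" using y by blast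
        then have "path_component (f ` U r) y (f x)"
          using pc[OF r(1)] U unfolding path_connected_component by blast
        then show ?thesis by (rule path_component_of_subset[rotated]) (use r in blast)
      qed
      show "path_component (\<Union>r\<in>theta_arcs. f ` U r) y z"
        using to_x[OF y] to_x[OF z] by (meson path_component_sym path_component_trans)
    qed
  qed
  define A where "A = (\<Union>r\<in>theta_arcs. f ` S r)"
  define B where "B = (\<Union>r\<in>theta_arcs. f ` T r)"
  define P where "P = (\<lambda>i. f ` q i - (f ` S (q i) \<union> f ` T (q i)))"
  define c where "c = (\<lambda>(i::nat) t. f (theta_arc_point (if i = 0 then 1 else if i = 1 then -1 else 0) (2 * t - 1)))"
  have c: "path (c i) \<and> path_image (c i) \<subseteq> f ` q i \<and> c i 0 = f (-1) \<and> c i 1 = f 1" for i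
  proof (intro conjI)
    have sub: "theta_arc_point (if i = 0 then 1 else if i = 1 then -1 else 0) (2 * t - 1) \<in> q i" if "t \<in> {0..1}" for t
      using that by (auto simp: q_def theta_arc_def)
    show "path_image (c i) \<subseteq> f ` q i" using sub by (auto simp: path_image_def c_def)
    show "path (c i)" unfolding path_def c_def
    proof (rule continuous_on_compose2[OF cont])
      show "continuous_on {0..1} (\<lambda>t. theta_arc_point (if i = 0 then 1 else if i = 1 then -1 else 0) (2 * t - 1))"
        by (rule continuous_on_compose2[OF continuous_theta_arc_point[of UNIV]]) (auto intro!: continuous_intros)
    qed (use sub qT[OF q] in blast)
  qed (auto simp: c_def theta_arc_point_ends)
  show ?thesis
  proof (rule that[of A B c P])
    have "S r \<subseteq> r \<and> T r \<subseteq> r" if "r \<in> theta_arcs" for r using ST(1) that by (auto simp: subarc_def)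
    then have "f ` S r \<subseteq> X \<and> f ` T r \<subseteq> X" if "r \<in> theta_arcs" for r
      using that qT[OF that] fX by (meson image_mono subset_trans)
    then show "A \<subseteq> X" "B \<subseteq> X" unfolding A_def B_def by (intro UN_least; simp)+
    show "path_connected A" "compact A" using star[of S "-1"] ST(1) by (auto simp: A_def)
    show "path_connected B" "compact B" using star[of T 1] ST(1) by (auto simp: B_def)
    show "\<forall>a\<in>A. \<forall>b\<in>B. 2 * M \<le> dist a b" using ST(3) unfolding A_def B_def .
    have "M \<le> dist x y" if "i < 3" "j < 3" "i \<noteq> j" "x \<in> P i" "y \<in> P j" for i j x y
      by (rule ST(2)[rule_format, OF q q q_inj[OF that(1-3)] that(4,5)[unfolded P_def]])
    then show "\<forall>i<3. \<forall>j<3. i \<noteq> j \<longrightarrow> (\<forall>p\<in>P i. \<forall>q\<in>P j. M \<le> dist p q)" by blast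
    have "path (c i) \<and> path_image (c i) \<subseteq> X \<and> c i 0 \<in> A \<and> c i 1 \<in> B \<and> path_image (c i) \<subseteq> A \<union> P i \<union> B" for i
    proof (intro conjI)
      show "path (c i)" using c by blast
      show "path_image (c i) \<subseteq> X" using c[of i] qT[OF q[of i]] fX by blast
      show "c i 0 \<in> A" "c i 1 \<in> B" using c[of i] ST(1) q[of i] by (auto simp: A_def B_def)
      have "f ` q i \<subseteq> A \<union> P i \<union> B" using q[of i] by (auto simp: A_def B_def P_def)
      then show "path_image (c i) \<subseteq> A \<union> P i \<union> B" using c[of i] by blast
    qed
    then show "\<forall>i<3. path (c i) \<and> path_image (c i) \<subseteq> X \<and> c i 0 \<in> A \<and> c i 1 \<in> B \<and> path_image (c i) \<subseteq> A \<union> P i \<union> B"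
      by blast
  qed
qed

text \<open>
  On each arm, the part after the last time at distance \<open>\<eta>\<close> from \<open>A\<close> is added to \<open>B\<close>. What remains of the arm is
  replaced by a shortest geodesic to \<open>A\<close>. The starting points \<open>e i\<close> lie on different \<open>P i\<close>, and \<open>\<eta>\<close> is small
  compared with the fatness, so the geodesics are far apart.
\<close>

lemma sharp_condition_imp_no_fat_theta_curve:
  fixes X :: "'a::metric_space set"
  assumes geo: "geodesic_space X" and m: "0 < m" and sharp: "sharp_condition X m"
  shows "\<not> fat_theta_curve (1000 * m) X f"
proof
  assume fat: "fat_theta_curve (1000 * m) X f"
  define \<eta> where "\<eta> = 300 * m"
  have M0: "0 < 1000 * m" using m by simp
  obtain A B and c :: "nat \<Rightarrow> real \<Rightarrow> 'a" and P :: "nat \<Rightarrow> 'a set" where AX: "A \<subseteq> X" "B \<subseteq> X" "path_connected A" "path_connected B" "compact A" "compact B"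
    and c': "\<forall>i<3. path (c i) \<and> path_image (c i) \<subseteq> X \<and> c i 0 \<in> A \<and> c i 1 \<in> B \<and> path_image (c i) \<subseteq> A \<union> P i \<union> B"
    and AB': "\<forall>a\<in>A. \<forall>b\<in>B. 2 * (1000 * m) \<le> dist a b"
    and P': "\<forall>i<3. \<forall>j<3. i \<noteq> j \<longrightarrow> (\<forall>p\<in>P i. \<forall>q\<in>P j. 1000 * m \<le> dist p q)"
    by (rule fat_theta_curve_arms[OF fat M0])
  note c = c'[rule_format] and AB = AB'[rule_format] and P = P'[rule_format]
  have Ane: "A \<noteq> {}" using c[of 0] by auto
  have "\<exists>s. s \<in> {0..1} \<and> infdist (c i s) A = \<eta> \<and> (\<forall>t\<in>{s..1}. \<eta> \<le> infdist (c i t) A)" if i: "i < 3" for i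
  proof -
    have "continuous_on {0..1} (\<lambda>t. infdist (c i t) A)"
      using c[OF i] by (intro continuous_on_infdist) (simp add: path_def)
    moreover have "infdist (c i 0) A \<le> \<eta>" using c[OF i] m by (simp add: \<eta>_def)
    moreover have "\<eta> \<le> infdist (c i 1) A"
    proof -
      have "\<eta> \<le> dist (c i 1) a" if "a \<in> A" for a
        using AB[OF that, of "c i 1"] c[OF i] m by (simp add: \<eta>_def dist_commute)
      then show ?thesis using Ane unfolding infdist_def by (auto intro!: cINF_greatest)
    qed
    ultimately show ?thesis using last_crossing[of 0 1 "\<lambda>t. infdist (c i t) A" \<eta>] by auto
  qed
  then obtain s where s: "\<And>i. i < 3 \<Longrightarrow> s i \<in> {0..1}" "\<And>i. i < 3 \<Longrightarrow> infdist (c i (s i)) A = \<eta>"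
    "\<And>i t. i < 3 \<Longrightarrow> t \<in> {s i..1} \<Longrightarrow> \<eta> \<le> infdist (c i t) A"
    by metis
  define e where "e = (\<lambda>i. c i (s i))"
  have eX: "e i \<in> X" if "i < 3" for i using c[OF that] s(1)[OF that] by (auto simp: e_def path_image_def)
  have "\<exists>a\<in>A. dist (e i) a = \<eta>" if i: "i < 3" for i
  proof -
    have "continuous_on A (dist (e i))" by (intro continuous_intros)
    then obtain a where a: "a \<in> A" "\<forall>x\<in>A. dist (e i) a \<le> dist (e i) x"
      using continuous_attains_inf[OF AX(5) Ane] by blast
    have "dist (e i) a \<le> infdist (e i) A"
      using a(2) Ane unfolding infdist_def by (auto intro!: cINF_greatest)
    with infdist_le[OF a(1), of "e i"] have "infdist (e i) A = dist (e i) a" by simp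
    with a(1) show ?thesis using s(2)[OF i] by (auto simp: e_def)
  qed
  then obtain a where a: "\<And>i. i < 3 \<Longrightarrow> a i \<in> A \<and> dist (e i) (a i) = \<eta>" by metis
  have eP: "e i \<in> P i" if i: "i < 3" for i
  proof -
    have "e i \<in> path_image (c i)" using s(1)[OF i] by (simp add: e_def path_image_def)
    then have "e i \<in> A \<union> P i \<union> B" using c[OF i] by blast
    moreover have "e i \<notin> A" using s(2)[OF i] m by (auto simp: e_def \<eta>_def)
    moreover have "e i \<notin> B" using AB[of "a i" "e i"] a[OF i] m by (auto simp: \<eta>_def dist_commute)
    ultimately show ?thesis by blast
  qed
  define R where "R = B \<union> (\<Union>i\<in>{..<3}. c i ` {s i..1})"
  have AR: "\<eta> \<le> dist x y" if x: "x \<in> A" and y: "y \<in> R" for x y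
  proof -
    from y consider "y \<in> B" | i t where "i < 3" "t \<in> {s i..1}" "y = c i t" by (auto simp: R_def)
    then show ?thesis
    proof cases
      case 1 then show ?thesis using AB[OF x 1] m by (simp add: \<eta>_def)
    next
      case 2
      then have "\<eta> \<le> infdist y A" using s(3) by blast
      also have "\<dots> \<le> dist y x" using x by (rule infdist_le)
      finally show ?thesis by (simp add: dist_commute)
    qed
  qed
  have eR: "e i \<in> R" if "i < 3" for i
  proof -
    have "e i \<in> c i ` {s i..1}" using s(1)[OF that] by (simp add: e_def)
    then show ?thesis using that unfolding R_def by blast
  qed
  have pcR: "path_connected R"
  proof -
    have tail: "path_connected (c i ` {s i..1})" if "i < 3" for i
      using c[OF that] s(1)[OF that]
      by (intro path_connected_continuous_image) (auto simp: path_def intro: continuous_on_subset convex_imp_path_connected)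
    have end_B: "c i 1 \<in> B" "c i 1 \<in> c i ` {s i..1}" if "i < 3" for i using c[OF that] s(1)[OF that] by auto
    have "path_connected (B \<union> c 0 ` {s 0..1})"
      by (rule path_connected_Un[OF AX(4) tail]) (use end_B[of 0] in auto)
    then have "path_connected ((B \<union> c 0 ` {s 0..1}) \<union> c 1 ` {s 1..1})"
      by (rule path_connected_Un[OF _ tail]) (use end_B[of 1] in auto)
    then have "path_connected (((B \<union> c 0 ` {s 0..1}) \<union> c 1 ` {s 1..1}) \<union> c 2 ` {s 2..1})"
      by (rule path_connected_Un[OF _ tail]) (use end_B[of 2] in auto)
    moreover have "R = ((B \<union> c 0 ` {s 0..1}) \<union> c 1 ` {s 1..1}) \<union> c 2 ` {s 2..1}"
      by (auto simp: R_def lessThan_nat_numeral lessThan_Suc numeral_3_eq_3 numeral_2_eq_2)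
    ultimately show ?thesis by simp
  qed
  have "\<exists>g. g 0 = a i \<and> g \<eta> = e i \<and> g ` {0..\<eta>} \<subseteq> X \<and> (\<forall>s\<in>{0..\<eta>}. \<forall>t\<in>{0..\<eta>}. dist (g s) (g t) = \<bar>s - t\<bar>)"
    if i: "i < 3" for i
  proof -
    have "a i \<in> X" "dist (a i) (e i) = \<eta>" using a[OF i] AX(1) by (auto simp: dist_commute)
    then show ?thesis using geo eX[OF i] unfolding geodesic_space_def by metis
  qed
  then obtain J where J: "\<And>i. i < 3 \<Longrightarrow> J i 0 = a i \<and> J i \<eta> = e i \<and> J i ` {0..\<eta>} \<subseteq> X \<and>
      (\<forall>s\<in>{0..\<eta>}. \<forall>t\<in>{0..\<eta>}. dist (J i s) (J i t) = \<bar>s - t\<bar>)"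
    by metis
  have \<eta>0: "0 \<le> \<eta>" using m by (simp add: \<eta>_def)
  have Je: "dist (J i t) (e i) = \<eta> - t" and Ja: "dist (J i t) (a i) = t" if "i < 3" "t \<in> {0..\<eta>}" for i t
  proof -
    have iso: "\<forall>s\<in>{0..\<eta>}. \<forall>t\<in>{0..\<eta>}. dist (J i s) (J i t) = \<bar>s - t\<bar>"
      using J[OF that(1)] by blast
    have "dist (J i t) (J i \<eta>) = \<bar>t - \<eta>\<bar>" "dist (J i t) (J i 0) = \<bar>t - 0\<bar>"
      by (rule iso[rule_format]; use that(2) \<eta>0 in simp)+
    moreover have "J i \<eta> = e i" "J i 0 = a i" using J[OF that(1)] by blast+
    ultimately show "dist (J i t) (e i) = \<eta> - t" "dist (J i t) (a i) = t" using that(2) by auto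
  qed
  interpret three_gaps X m A R J \<eta>
  proof unfold_locales
    show "\<exists>a\<in>X. \<exists>b\<in>X. 4 * m \<le> dist x a \<and> 4 * m \<le> dist x b \<and> 4 * m \<le> dist y a \<and> 4 * m \<le> dist y b \<and>
        \<not> path_component (X - (ball a m \<union> ball b m)) x y"
      if "x \<in> X" "y \<in> X" "10 * m \<le> dist x y" for x y
      using sharp_condition_imp_separated[OF sharp that] by metis
    have "c i ` {s i..1} \<subseteq> X" if "i < 3" for i
    proof -
      have "c i ` {s i..1} \<subseteq> path_image (c i)" using s(1)[OF that] by (auto simp: path_image_def)
      then show ?thesis using c[OF that] by blast
    qed
    then show "R \<subseteq> X" using AX(2) unfolding R_def by blast
    show "geodesic_space X" "0 < m" "A \<subseteq> X" "path_connected A" "path_connected R" by fact+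
    show "J i t \<in> X" if "i < 3" "t \<in> {0..\<eta>}" for i t using J[OF that(1)] that(2) by blast
    show "dist (J i s) (J i t) = \<bar>s - t\<bar>" if "i < 3" "s \<in> {0..\<eta>}" "t \<in> {0..\<eta>}" for i s t
      using J[OF that(1)] that(2,3) by blast
    show "J i 0 \<in> A" "J i \<eta> \<in> R" if "i < 3" for i using J[OF that] a[OF that] eR[OF that] by auto
    show "t \<le> dist (J i t) l" if "i < 3" "t \<in> {0..\<eta>}" "l \<in> A" for i t l
      using AR[OF that(3) eR[OF that(1)]] Je[OF that(1,2)] dist_triangle[of l "e i" "J i t"] by (simp add: dist_commute)
    show "\<eta> - t \<le> dist (J i t) r" if "i < 3" "t \<in> {0..\<eta>}" "r \<in> R" for i t r
      using AR[OF _ that(3), of "a i"] a[OF that(1)] Ja[OF that(1,2)] dist_triangle[of "a i" r "J i t"]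
      by (simp add: dist_commute)
    show "\<eta> \<le> dist l r" if "l \<in> A" "r \<in> R" for l r using AR that by blast
    show "5 * m \<le> dist (J i s) (J j t)" if ij: "i < 3" "j < 3" "i \<noteq> j" "s \<in> {0..\<eta>}" "t \<in> {0..\<eta>}" for i j s t
    proof -
      have "1000 * m \<le> dist (e i) (e j)" by (rule P[OF ij(1-3) eP eP]) (use ij in auto)
      moreover have "dist (J i s) (e i) \<le> 300 * m" "dist (J j t) (e j) \<le> 300 * m"
        using Je[OF ij(1,4)] Je[OF ij(2,5)] ij by (auto simp: \<eta>_def)
      ultimately show ?thesis
        using dist_triangle[of "e i" "e j" "J i s"] dist_triangle[of "J i s" "e j" "J j t"] m
        by (auto simp: dist_commute)
    qed
    show "300 * m \<le> \<eta>" by (simp add: \<eta>_def)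
  qed
  show False by (rule three_gaps_impossible)
qed

theorem proposition1p10:
  fixes X :: "'a::metric_space set"
  assumes "geodesic_space X"
  shows "(\<exists>m>0. sharp_condition X m) \<longleftrightarrow> (\<exists>M>0. \<not> (\<exists>f. fat_theta_curve M X f))"
proof
  assume "\<exists>m>0. sharp_condition X m"
  then obtain m where "m > 0" "sharp_condition X m" by blast
  then show "\<exists>M>0. \<not> (\<exists>f. fat_theta_curve M X f)"
    using sharp_condition_imp_no_fat_theta_curve[OF assms] by (intro exI[of _ "1000 * m"]) auto
next
  assume "\<exists>M>0. \<not> (\<exists>f. fat_theta_curve M X f)"
  then obtain M where "M > 0" "\<not> (\<exists>f. fat_theta_curve M X f)" by blast
  then show "\<exists>m>0. sharp_condition X m"
    using not_sharp_condition_imp_fat_theta_curve[OF assms] by (intro exI[of _ "10 * M"]) auto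
qed

end
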